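(* For each $n\ge1$ let $\beta=\beta_n>0$, $p_1=p_1(n)\ge n$, $p_2=p_2(n)\ge n$, put $\beta'=\beta/2$, and let $\mu_n$ be the (random) spectral measure of the rescaled tridiagonal random matrix $\widetilde{\mathcal J}_n$ of the $\beta$-Jacobi ensemble (defined in the context). Suppose that $$\lim_{n\to\infty}\frac{n}{p_1}=\gamma\in[0,1],\qquad \lim_{n\to\infty}\frac{p_1}{p_2}=\sigma\in[0,\gamma^{-1}),\qquad \lim_{n\to\infty}\beta n=+\infty$$ (with $\gamma^{-1}=+\infty$ when $\gamma=0$). Then for each polynomial $p$ there is a constant $\sigma_p^2$ such that $$\sqrt{\beta' n}\,\big(\langle\mu_n,p\rangle-\mathbb E\langle\mu_n,p\rangle\big)\to\mathcal N(0,\sigma_p^2)$$ weakly as $n\to\infty$.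
   Context: $\langle\mu,f\rangle=\int f\,d\mu$. Matrix model: let $c_1,\dots,c_n,s_1,\dots,s_{n-1}$ be independent with $$c_k\sim\operatorname{Beta}\big(\beta'(p_1-k+1),\beta'(p_2-k+1)\big)\ (1\le k\le n),\quad s_k\sim\operatorname{Beta}\big(\beta'(n-k),\beta'(p_1+p_2-n-k+1)\big)\ (1\le k\le n-1),$$ and $c_0=s_0=0$. Put $$a_k=s_{k-1}(1-c_{k-1})+c_k(1-s_{k-1}),\qquad b_k=\sqrt{c_k(1-c_k)s_k(1-s_{k-1})}.$$ $\mathcal J_n$ is the symmetric tridiagonal $n\times n$ matrix with diagonal $a_1,\dots,a_n$ and off-diagonal entries $b_1,\dots,b_{n-1}$, and $$\widetilde{\mathcal J}_n=\frac{(p_1+p_2)\mathcal J_n-p_1\mathbf I_n}{\sqrt{np_1}}.$$ Spectral measure: the spectral measure of a finite symmetric tridiagonal real matrix $J$ with positive off-diagonal entries is the unique probability measure $\mu$ on $\mathbb R$ with $\langle\mu,x^k\rangle=J^k(1,1)$ (the $(1,1)$ entry of $J^k$) for all $k\in\mathbb N$. *)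

theory Defs
  imports "HOL-Probability.Probability" "Jordan_Normal_Form.Matrix"
begin

text \<open>Only used with positive parameters, where it is a probability density.\<close>

definition beta_density :: "real \<Rightarrow> real \<Rightarrow> real \<Rightarrow> real" where
  "beta_density a b x =
     (if 0 < x \<and> x < 1 then x powr (a - 1) * (1 - x) powr (b - 1) / Beta a b else 0)"

text \<open>The second parameter is the variance; variance \<open>0\<close> gives the point mass at the mean.\<close>

definition normal_law :: "real \<Rightarrow> real \<Rightarrow> real measure" where
  "normal_law m v =
     (if v = 0 then return borel m
      else density lborel (\<lambda>x. ennreal (normal_density m (sqrt v) x)))"

text \<open>The coefficient sequences \<open>a\<close>, \<open>b\<close> are indexed from \<open>1\<close>, whereas matrix
  rows and columns are indexed from \<open>0\<close>.\<close>

definition jacobi_matrix :: "nat \<Rightarrow> (nat \<Rightarrow> real) \<Rightarrow> (nat \<Rightarrow> real) \<Rightarrow> real mat" where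
  "jacobi_matrix n a b = Matrix.mat n n (\<lambda>(i, j).
     if i = j then a (i + 1)
     else if j = i + 1 then b (i + 1)
     else if i = j + 1 then b (j + 1)
     else 0)"

definition is_spectral_measure :: "real mat \<Rightarrow> real measure \<Rightarrow> bool" where
  "is_spectral_measure J \<mu> \<longleftrightarrow>
     prob_space \<mu> \<and> sets \<mu> = sets borel \<and>
     (\<forall>k. integrable \<mu> (\<lambda>x. x ^ k) \<and> (\<integral>x. x ^ k \<partial>\<mu>) = (J ^\<^sub>m k) $$ (0, 0))"

text \<open>For every symmetric real matrix of positive size exactly one measure satisfies
  \<^const>\<open>is_spectral_measure\<close>: existence is the spectral theorem, and uniqueness holds because
  such a measure is carried by the finitely many roots of the characteristic polynomial.
  Positivity of the off-diagonal entries is therefore not needed for the description to be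
  meaningful, and below it only holds almost surely.\<close>

definition spectral_measure :: "real mat \<Rightarrow> real measure" where
  "spectral_measure J = (THE \<mu>. is_spectral_measure J \<mu>)"

definition model_diag :: "(nat \<Rightarrow> real) \<Rightarrow> (nat \<Rightarrow> real) \<Rightarrow> nat \<Rightarrow> real" where
  "model_diag c s k = s (k - 1) * (1 - c (k - 1)) + c k * (1 - s (k - 1))"

definition model_offdiag :: "(nat \<Rightarrow> real) \<Rightarrow> (nat \<Rightarrow> real) \<Rightarrow> nat \<Rightarrow> real" where
  "model_offdiag c s k = sqrt (c k * (1 - c k) * s k * (1 - s (k - 1)))"

definition model_matrix :: "nat \<Rightarrow> (nat \<Rightarrow> real) \<Rightarrow> (nat \<Rightarrow> real) \<Rightarrow> real mat" where
  "model_matrix n c s = jacobi_matrix n (model_diag c s) (model_offdiag c s)"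

definition rescaled_model_matrix ::
    "nat \<Rightarrow> real \<Rightarrow> real \<Rightarrow> (nat \<Rightarrow> real) \<Rightarrow> (nat \<Rightarrow> real) \<Rightarrow> real mat" where
  "rescaled_model_matrix n p1 p2 c s =
     (1 / sqrt (real n * p1)) \<cdot>\<^sub>m ((p1 + p2) \<cdot>\<^sub>m model_matrix n c s - p1 \<cdot>\<^sub>m 1\<^sub>m n)"

text \<open>Joint independence of all the \<open>c k\<close> and \<open>s k\<close> is expressed for the single family
  indexed by the disjoint sum of the two index sets.\<close>

definition beta_jacobi_model ::
    "nat \<Rightarrow> real \<Rightarrow> real \<Rightarrow> real \<Rightarrow> 'a measure \<Rightarrow> (nat \<Rightarrow> 'a \<Rightarrow> real) \<Rightarrow> (nat \<Rightarrow> 'a \<Rightarrow> real) \<Rightarrow> bool"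
  where
  "beta_jacobi_model n \<beta> p1 p2 M c s \<longleftrightarrow>
     prob_space M \<and>
     prob_space.indep_vars M (\<lambda>_. borel) (case_sum c s) ({1..n} <+> {1..<n}) \<and>
     (\<forall>k\<in>{1..n}. distributed M lborel (c k)
        (\<lambda>x. ennreal (beta_density
           (\<beta> / 2 * (p1 - real k + 1)) (\<beta> / 2 * (p2 - real k + 1)) x))) \<and>
     (\<forall>k\<in>{1..<n}. distributed M lborel (s k)
        (\<lambda>x. ennreal (beta_density
           (\<beta> / 2 * (real n - real k)) (\<beta> / 2 * (p1 + p2 - real n - real k + 1)) x))) \<and>
     c 0 = (\<lambda>_. 0) \<and> s 0 = (\<lambda>_. 0)"

text \<open>The random variable obtained by integrating a polynomial against the random spectral
  measure of the rescaled matrix.\<close>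

definition linear_statistic ::
    "nat \<Rightarrow> real \<Rightarrow> real \<Rightarrow> (nat \<Rightarrow> 'a \<Rightarrow> real) \<Rightarrow> (nat \<Rightarrow> 'a \<Rightarrow> real) \<Rightarrow> real poly \<Rightarrow> 'a \<Rightarrow> real" where
  "linear_statistic n p1 p2 c s p \<omega> =
     (\<integral>x. poly p x \<partial>spectral_measure
        (rescaled_model_matrix n p1 p2 (\<lambda>k. c k \<omega>) (\<lambda>k. s k \<omega>)))"

end

theory Submission
  imports Defs "Jordan_Normal_Form.Char_Poly"
    "HOL-Computational_Algebra.Fundamental_Theorem_Algebra"
begin

text \<open>A polynomial statistic of the spectral measure involves only finitely many matrix entries,
  however large the matrix is: \<open>\<langle>\<mu>\<^sub>n, x^m\<rangle>\<close> is the corner entry of the \<open>m\<close>-th power, a sum over walks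
  of \<open>m\<close> steps that start and end at the first vertex, and such walks see only the first \<open>m\<close> diagonal and
  off-diagonal entries. Walks cross each edge equally often in both directions, so only squares of
  off-diagonal entries occur and the square roots in the model disappear
  (\<open>linear_statistic_eq_jacobi_walk\<close>). This needs that the spectral measure exists and is unique,
  which is proved for every symmetric matrix by quadrature on the roots of a polynomial annihilated by the
  moment functional (\<open>is_spectral_measure_spectral_measure\<close>).

  The Beta variables enter through the rescaled quantities
  \<open>((p\<^sub>1 + p\<^sub>2) c\<^sub>k - p\<^sub>1) / sqrt (n p\<^sub>1)\<close> and \<open>(p\<^sub>1 + p\<^sub>2) s\<^sub>k / n\<close>. With
  \<open>g = sqrt (n / p\<^sub>1)\<close> and \<open>r = p\<^sub>1 / (p\<^sub>1 + p\<^sub>2)\<close>, both convergent, the rescaled matrix entries are fixed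
  polynomials in \<open>g\<close>, \<open>r\<close> and these quantities. Each quantity is a convergent number plus a
  fluctuation of order \<open>(\<beta>' n) powr (-1/2)\<close> that is asymptotically Gaussian.

  The Gaussian limit of a single Beta variable comes from its Stein identity
  \<open>(a + b) E[(X - a / (a + b)) f X] = E[X (1 - X) f' X]\<close>. After centring and scaling, the
  coefficient of \<open>f'\<close> is nearly constant. Powers as test functions then bound all moments, and
  trigonometric test functions give the approximate differential equation \<open>\<phi>' = - \<kappa> t \<phi>\<close> for the
  characteristic function, with its rate (\<open>even_moment_step\<close>, \<open>char_bound\<close>).

  It remains to carry out a delta method in which expectations are controlled as well. Sequences of the
  form number + linear combination of fluctuations \<open>/ sqrt N\<close> + moment-bounded remainder \<open>/ N\<close>, where
  \<open>N = \<beta>' n\<close>, are closed under sums and products (\<open>asymp_linear_mult\<close>), so every polynomial statistic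
  has this form. After centring and multiplying by \<open>sqrt N\<close> only the linear part survives; it is a
  combination of independent, asymptotically Gaussian variables, and Levy's continuity theorem concludes
  (\<open>asymp_linear_clt\<close>).\<close>

section \<open>Spectral measures of symmetric matrices\<close>

definition root_poly :: "real set \<Rightarrow> real poly" where
  "root_poly R = (\<Prod>r\<in>R. [:- r, 1:])"

definition lagrange_poly :: "real set \<Rightarrow> real \<Rightarrow> real poly" where
  "lagrange_poly R r = Polynomial.smult (1 / (\<Prod>s\<in>R - {r}. r - s)) (root_poly (R - {r}))"

lemma poly_root_poly: "poly (root_poly R) x = (\<Prod>r\<in>R. x - r)"
  by (simp add: root_poly_def poly_prod)

lemma poly_root_poly_eq_0_iff: "finite R \<Longrightarrow> poly (root_poly R) x = 0 \<longleftrightarrow> x \<in> R"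
  by (auto simp: poly_root_poly)

lemma poly_lagrange_poly:
  assumes "finite R" "r \<in> R" "s \<in> R"
  shows "poly (lagrange_poly R r) s = (if s = r then 1 else 0)"
  using assms by (auto simp: lagrange_poly_def poly_root_poly)

lemma root_poly_dvd:
  assumes "finite R" "\<And>r. r \<in> R \<Longrightarrow> poly f r = 0"
  shows "root_poly R dvd f"
  using assms
proof (induction R rule: finite_induct)
  case empty
  then show ?case by (simp add: root_poly_def)
next
  case (insert r R)
  then obtain g where g: "f = root_poly R * g" by (auto elim!: dvdE)
  have "poly (root_poly R) r \<noteq> 0"
    using insert by (simp add: poly_root_poly_eq_0_iff)
  moreover have "poly f r = 0" using insert by simp
  ultimately have "poly g r = 0" by (simp add: g)
  then have "[:- r, 1:] dvd g" by (simp add: poly_eq_0_iff_dvd)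
  then have "[:- r, 1:] * root_poly R dvd g * root_poly R" by (rule mult_dvd_mono) simp
  then show ?case
    using insert by (simp add: root_poly_def g mult.commute)
qed

text \<open>The moment functional of a measure, seen algebraically. If such a functional vanishes on a nonzero
  ideal, it is a quadrature formula with positive weights; this replaces diagonalisation of the matrix.\<close>

locale positive_functional =
  fixes L :: "real poly \<Rightarrow> real"
  assumes L_add: "L (p + q) = L p + L q"
    and L_smult: "L (Polynomial.smult a p) = a * L p"
    and L_square: "L (q * q) \<ge> 0"
begin

lemma L_diff: "L (p - q) = L p - L q"
  using L_add[of p "Polynomial.smult (-1) q"] L_smult[of "-1" q] by simp

lemma L_zero [simp]: "L 0 = 0"
  using L_smult[of 0 0] by simp

lemma L_sum: "L (\<Sum>i\<in>A. f i) = (\<Sum>i\<in>A. L (f i))"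
  by (induction A rule: infinite_finite_induct) (auto simp: L_add)

text \<open>Cauchy--Schwarz: a nonnegative quadratic function of \<open>t\<close> without quadratic term has no linear term.\<close>

lemma null_if_square_null:
  assumes "L (q * q) = 0"
  shows "L (q * f) = 0"
proof -
  have *: "L (f * f) + 2 * t * L (q * f) \<ge> 0" for t
  proof -
    have "L ((f + Polynomial.smult t q) * (f + Polynomial.smult t q)) = L (f * f) + 2 * t * L (q * f)"
      by (simp add: distrib_left distrib_right L_add L_smult assms mult.commute[of f q])
    then show ?thesis using L_square[of "f + Polynomial.smult t q"] by simp
  qed
  show ?thesis
  proof (rule ccontr)
    assume "L (q * f) \<noteq> 0"
    then show False
      using *[of "- (L (f * f) + 1) / (2 * L (q * f))"] by (simp add: field_simps)
  qed
qed

text \<open>A polynomial of least degree in the annihilated ideal has simple real roots. A double real root or a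
  pair of conjugate roots would give a factorisation \<open>p = Q g\<close> from which positivity extracts a polynomial
  of smaller degree whose square is annihilated, and which therefore lies in the ideal itself.\<close>

lemma ex_real_quadrature_nodes:
  assumes "p \<noteq> 0" "\<And>q. L (p * q) = 0"
  obtains R where "finite R" "\<And>q. L (root_poly R * q) = 0"
proof -
  define null where "null = {p. p \<noteq> 0 \<and> (\<forall>q. L (p * q) = 0)}"
  have "p \<in> null" using assms by (simp add: null_def)
  then obtain p where p: "p \<in> null" and min: "\<And>q. q \<in> null \<Longrightarrow> degree p \<le> degree q"
    using ex_has_least_nat[of "\<lambda>p. p \<in> null" p degree] by auto
  have p0: "p \<noteq> 0" and pnull: "L (p * q) = 0" for q using p by (auto simp: null_def)
  have no_sq: "L (h * h) \<noteq> 0" if "h \<noteq> 0" "degree h < degree p" for h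
    using min[of h] null_if_square_null[of h] that by (force simp: null_def)
  define R where "R = {x. poly p x = 0}"
  have R: "finite R" using p0 poly_roots_finite unfolding R_def by blast
  have "root_poly R dvd p" by (rule root_poly_dvd[OF R]) (simp add: R_def)
  then obtain q where q: "p = root_poly R * q" by blast
  have q0: "q \<noteq> 0" using p0 q by auto
  have "degree q = 0"
  proof (rule ccontr)
    assume "degree q \<noteq> 0"
    then have "\<not> constant (poly (map_poly complex_of_real q))"
      by (simp add: constant_degree degree_map_poly)
    then obtain z where z: "poly (map_poly complex_of_real q) z = 0"
      using fundamental_theorem_of_algebra by blast
    define a b where "a = Re z" and "b = Im z"
    show False
    proof (cases "b = 0")
      case True
      then have za: "z = complex_of_real a" by (simp add: a_def b_def complex_eq_iff)
      moreover have "poly (map_poly complex_of_real q) (of_real a) = of_real (poly q a)"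
        by (induction q) (simp_all add: map_poly_pCons)
      ultimately have "complex_of_real (poly q a) = 0" using z by simp
      then have qa: "poly q a = 0" by simp
      have "poly p a = 0" by (simp add: q qa)
      then have "a \<in> R" unfolding R_def by simp
      then have "poly (root_poly R) a = 0" using R by (simp add: poly_root_poly_eq_0_iff)
      then obtain g h where g: "root_poly R = [:- a, 1:] * g" and h: "q = [:- a, 1:] * h"
        using qa by (auto simp: poly_eq_0_iff_dvd elim!: dvdE)
      define k where "k = [:- a, 1:] * (g * h)"
      have pk: "p = [:- a, 1:] * k" by (simp only: q g h k_def ac_simps)
      have "k \<noteq> 0" using p0 pk by auto
      moreover have "degree k < degree p"
        using \<open>k \<noteq> 0\<close> unfolding pk by (subst degree_mult_eq) auto
      moreover have "L (k * k) = 0"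
        using pnull[of "g * h"] unfolding pk by (simp only: k_def ac_simps)
      ultimately show False using no_sq by blast
    next
      case False
      define Q where "Q = [:a\<^sup>2 + b\<^sup>2, - 2 * a, 1:]"
      have Qz: "poly (map_poly complex_of_real Q) z = 0"
        unfolding Q_def a_def b_def
        by (auto simp: map_poly_pCons complex_eq_iff power2_eq_square algebra_simps)
      have "degree Q = 2" "Q \<noteq> 0" by (simp_all add: Q_def)
      define r where "r = q mod Q"
      have "q = q div Q * Q + r" by (simp add: r_def)
      then have "map_poly complex_of_real q
          = map_poly complex_of_real (q div Q) * map_poly complex_of_real Q + map_poly complex_of_real r"
      proof -
        interpret h: map_poly_comm_ring_hom complex_of_real ..
        assume "q = q div Q * Q + r"
        then show ?thesis by (metis h.hom_add h.hom_mult)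
      qed
      then have rz: "poly (map_poly complex_of_real r) z = 0" using z Qz by simp
      have "degree r < 2"
        using degree_mod_less'[of Q q] \<open>degree Q = 2\<close> \<open>Q \<noteq> 0\<close>
        by (cases "r = 0") (auto simp: r_def)
      then have "coeff r k = 0" if "k \<ge> 2" for k
        using that by (intro coeff_eq_0) simp
      then have "coeff r k = coeff [:coeff r 0, coeff r 1:] k" for k
        by (cases k; cases "k - 1") (auto simp: coeff_pCons)
      then obtain u v where r: "r = [:u, v:]" using poly_eqI by blast
      have "complex_of_real u + z * complex_of_real v = 0"
        using rz by (simp add: r of_real_hom.map_poly_pCons_hom)
      then have "v * b = 0" "u + v * a = 0"
        by (auto simp: complex_eq_iff a_def b_def algebra_simps)
      then have "r = 0" using False r by simp
      then have "Q dvd q" by (simp add: r_def dvd_eq_mod_eq_0)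
      then obtain g where g: "p = Q * g" using q by (metis dvdE dvd_mult)
      have "g \<noteq> 0" using p0 g by auto
      moreover have "degree g < degree p"
        using \<open>g \<noteq> 0\<close> \<open>degree Q = 2\<close> unfolding g by (subst degree_mult_eq) auto
      moreover have "L (g * g) = 0"
      proof -
        have Q: "Q = [:- a, 1:] * [:- a, 1:] + [:b\<^sup>2:]" by (simp add: Q_def power2_eq_square)
        have "p * g = ([:- a, 1:] * g) * ([:- a, 1:] * g) + [:b\<^sup>2:] * (g * g)"
          unfolding g Q by (simp only: distrib_left distrib_right ac_simps)
        then have "p * g = ([:- a, 1:] * g) * ([:- a, 1:] * g) + Polynomial.smult (b\<^sup>2) (g * g)"
          by simp
        then have "0 = L (([:- a, 1:] * g) * ([:- a, 1:] * g)) + b\<^sup>2 * L (g * g)"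
          using pnull[of g] by (metis L_add L_smult)
        moreover have "b\<^sup>2 * L (g * g) \<ge> 0" using L_square by simp
        ultimately have "b\<^sup>2 * L (g * g) = 0"
          using L_square[of "[:- a, 1:] * g"] by linarith
        then show ?thesis using False by simp
      qed
      ultimately show False using no_sq by blast
    qed
  qed
  then obtain a where a: "q = [:a:]" by (rule degree_eq_zeroE)
  then have "a \<noteq> 0" using q0 by simp
  have "L (root_poly R * f) = 0" for f
  proof -
    have "root_poly R * f = p * Polynomial.smult (1 / a) f"
      using \<open>a \<noteq> 0\<close> by (simp add: q a)
    then show ?thesis by (metis pnull)
  qed
  with R that show ?thesis by blast
qed

text \<open>Modulo the ideal a polynomial is determined by its values at the nodes, hence equals its Lagrange
  interpolant; and each Lagrange polynomial equals its own square, so its weight is nonnegative.\<close>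

lemma
  assumes R: "finite R" "\<And>q. L (root_poly R * q) = 0"
  shows quadrature: "L f = (\<Sum>r\<in>R. poly f r * L (lagrange_poly R r))"
    and quadrature_weight_nonneg: "r \<in> R \<Longrightarrow> L (lagrange_poly R r) \<ge> 0"
proof -
  have cong: "L f = L g" if "\<And>r. r \<in> R \<Longrightarrow> poly f r = poly g r" for f g
  proof -
    have "root_poly R dvd f - g" using that by (intro root_poly_dvd R) simp
    then have "L (f - g) = 0" using R(2) by (metis dvdE)
    then show ?thesis by (simp add: L_diff)
  qed
  have "poly f s = poly (\<Sum>r\<in>R. Polynomial.smult (poly f r) (lagrange_poly R r)) s" if "s \<in> R" for s
  proof -
    have "poly (\<Sum>r\<in>R. Polynomial.smult (poly f r) (lagrange_poly R r)) s
        = (\<Sum>r\<in>R. if s = r then poly f r else 0)"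
      unfolding poly_sum using that R by (intro sum.cong) (auto simp: poly_lagrange_poly)
    also have "\<dots> = poly f s" using that R by simp
    finally show ?thesis by simp
  qed
  then have "L f = L (\<Sum>r\<in>R. Polynomial.smult (poly f r) (lagrange_poly R r))" by (rule cong)
  then show "L f = (\<Sum>r\<in>R. poly f r * L (lagrange_poly R r))"
    by (simp add: L_sum L_smult)
  assume "r \<in> R"
  then have "L (lagrange_poly R r) = L (lagrange_poly R r * lagrange_poly R r)"
    using R by (intro cong) (simp add: poly_lagrange_poly)
  then show "L (lagrange_poly R r) \<ge> 0" using L_square by simp
qed

text \<open>Existence is the quadrature formula. For uniqueness, any representing measure integrates the square
  of the node polynomial to \<open>0\<close>, so it lives on the nodes, where its masses are integrals of Lagrange
  polynomials.\<close>

lemma ex1_representing_measure: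
  assumes "L 1 = 1" "p \<noteq> 0" "\<And>q. L (p * q) = 0"
  shows "\<exists>!\<mu>. prob_space \<mu> \<and> sets \<mu> = sets borel \<and>
     (\<forall>k. integrable \<mu> (\<lambda>x. x ^ k) \<and> (\<integral>x. x ^ k \<partial>\<mu>) = L (monom 1 k))"
proof -
  obtain R where R: "finite R" "\<And>q. L (root_poly R * q) = 0"
    using ex_real_quadrature_nodes assms by blast
  define w where "w r = (if r \<in> R then L (lagrange_poly R r) else 0)" for r
  have w0: "w r \<ge> 0" for r using quadrature_weight_nonneg[OF R] by (simp add: w_def)
  have quad: "L f = (\<Sum>r\<in>R. poly f r * w r)" for f
    using quadrature[OF R, of f] by (simp add: w_def)
  have w1: "(\<Sum>r\<in>R. w r) = 1" using quad[of 1] assms by simp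
  have nn: "(\<integral>\<^sup>+ x. ennreal (w x) \<partial>count_space UNIV) = 1"
  proof -
    have "(\<integral>\<^sup>+ x. ennreal (w x) \<partial>count_space UNIV) = (\<Sum>x\<in>R. ennreal (w x))"
      using R by (intro nn_integral_count_space') (auto simp: w_def)
    then show ?thesis using w1 w0 by simp
  qed
  define P where "P = embed_pmf w"
  have pmfP: "pmf P x = w x" for x
    unfolding P_def by (rule pmf_embed_pmf[OF w0 nn])
  have setP: "set_pmf P \<subseteq> R" by (auto simp: set_pmf_eq pmfP w_def)
  have finP: "finite (set_pmf P)" using setP R finite_subset by blast
  define \<mu> where "\<mu> = distr (measure_pmf P) borel (\<lambda>x::real. x)"
  have \<mu>: "prob_space \<mu> \<and> sets \<mu> = sets borel \<and>
      (\<forall>k. integrable \<mu> (\<lambda>x. x ^ k) \<and> (\<integral>x. x ^ k \<partial>\<mu>) = L (monom 1 k))"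
  proof (intro conjI allI)
    show "prob_space \<mu>" unfolding \<mu>_def by (rule measure_pmf.prob_space_distr) simp
    show "sets \<mu> = sets borel" by (simp add: \<mu>_def)
    fix k :: nat
    show "integrable \<mu> (\<lambda>x. x ^ k)" unfolding \<mu>_def
      by (subst integrable_distr_eq) (auto intro: integrable_measure_pmf_finite finP)
    have "(\<integral>x. x ^ k \<partial>\<mu>) = (\<integral>x. x ^ k \<partial>measure_pmf P)" unfolding \<mu>_def
      by (subst integral_distr) auto
    also have "\<dots> = (\<Sum>x\<in>R. pmf P x *\<^sub>R x ^ k)"
      using setP R by (intro integral_measure_pmf) auto
    also have "\<dots> = L (monom 1 k)" by (simp add: quad poly_monom pmfP mult.commute)
    finally show "(\<integral>x. x ^ k \<partial>\<mu>) = L (monom 1 k)" .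
  qed
  show ?thesis
  proof (rule ex1I[of _ \<mu>], rule \<mu>)
    have formula: "measure \<nu> A = (\<Sum>r\<in>R. indicator A r * w r)"
      if \<nu>: "prob_space \<nu> \<and> sets \<nu> = sets borel \<and>
        (\<forall>k. integrable \<nu> (\<lambda>x. x ^ k) \<and> (\<integral>x. x ^ k \<partial>\<nu>) = L (monom 1 k))"
        and A: "A \<in> sets borel" for \<nu> A
    proof -
      interpret \<nu>: prob_space \<nu> using \<nu> by simp
      have sets[measurable_cong]: "sets \<nu> = sets borel" using \<nu> by simp
      have int: "integrable \<nu> (poly f)" and val: "(\<integral>x. poly f x \<partial>\<nu>) = L f" for f
      proof -
        have f: "poly f = (\<lambda>x. \<Sum>k\<le>degree f. coeff f k * x ^ k)"
          by (auto simp: poly_altdef)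
        show "integrable \<nu> (poly f)" unfolding f using \<nu> by auto
        have "(\<integral>x. poly f x \<partial>\<nu>) = (\<Sum>k\<le>degree f. coeff f k * L (monom 1 k))"
          unfolding f using \<nu> by (subst Bochner_Integration.integral_sum) auto
        also have "\<dots> = L (\<Sum>k\<le>degree f. monom (coeff f k) k)"
          by (simp add: L_sum L_smult[symmetric] smult_monom)
        finally show "(\<integral>x. poly f x \<partial>\<nu>) = L f" by (simp add: poly_as_sum_of_monoms)
      qed
      have "(\<integral>x. (poly (root_poly R) x)\<^sup>2 \<partial>\<nu>) = 0"
        using val[of "root_poly R * root_poly R"] R by (simp add: power2_eq_square)
      moreover have "integrable \<nu> (\<lambda>x. (poly (root_poly R) x)\<^sup>2)"
        using int[of "root_poly R * root_poly R"] by (simp add: power2_eq_square poly_mult[abs_def])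
      ultimately have "AE x in \<nu>. (poly (root_poly R) x)\<^sup>2 = 0"
        by (subst (asm) integral_nonneg_eq_0_iff_AE) auto
      then have supp: "AE x in \<nu>. x \<in> R"
        by eventually_elim (use R in \<open>simp add: poly_root_poly_eq_0_iff\<close>)
      have "measure \<nu> A = (\<integral>x. indicator A x \<partial>\<nu>)"
        using A by (simp add: sets)
      also have "\<dots> = (\<integral>x. (\<Sum>r\<in>R. indicator A r * poly (lagrange_poly R r) x) \<partial>\<nu>)"
      proof (rule integral_cong_AE)
        show "(\<lambda>x. \<Sum>r\<in>R. indicator A r * poly (lagrange_poly R r) x) \<in> borel_measurable \<nu>"
          by (intro borel_measurable_sum borel_measurable_times borel_measurable_const
              borel_measurable_integrable int)
        show "indicat_real A \<in> borel_measurable \<nu>" using A by (simp add: sets)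
        show "AE x in \<nu>. indicat_real A x = (\<Sum>r\<in>R. indicator A r * poly (lagrange_poly R r) x)"
          using supp
        proof eventually_elim
          case (elim x)
          then have "(\<Sum>r\<in>R. indicator A r * poly (lagrange_poly R r) x)
              = (\<Sum>r\<in>R. if x = r then indicator A r else 0)"
            using R by (auto intro!: sum.cong simp: poly_lagrange_poly)
          then show ?case using elim R by simp
        qed
      qed
      also have "\<dots> = (\<Sum>r\<in>R. indicator A r * w r)"
        using int val by (subst Bochner_Integration.integral_sum) (auto simp: w_def)
      finally show ?thesis .
    qed
    fix \<nu> assume \<nu>: "prob_space \<nu> \<and> sets \<nu> = sets borel \<and>
        (\<forall>k. integrable \<nu> (\<lambda>x. x ^ k) \<and> (\<integral>x. x ^ k \<partial>\<nu>) = L (monom 1 k))"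
    show "\<nu> = \<mu>"
    proof (rule measure_eqI)
      show "sets \<nu> = sets \<mu>" using \<mu> \<nu> by simp
      fix A assume "A \<in> sets \<nu>"
      then have A: "A \<in> sets borel" using \<nu> by simp
      interpret \<nu>: prob_space \<nu> using \<nu> by simp
      interpret \<mu>: prob_space \<mu> using \<mu> by simp
      show "emeasure \<nu> A = emeasure \<mu> A"
        by (simp add: \<nu>.emeasure_eq_measure \<mu>.emeasure_eq_measure formula[OF \<nu> A] formula[OF \<mu> A])
    qed
  qed
qed

end


text \<open>More vectors than coordinates: the square matrix of the \<open>n + 1\<close> vectors, padded by a zero row, is
  singular.\<close>

lemma nontrivial_relation:
  fixes v :: "nat \<Rightarrow> nat \<Rightarrow> real"
  obtains p :: "real poly" where "p \<noteq> 0" "\<And>j. j < n \<Longrightarrow> (\<Sum>k\<le>n. coeff p k * v k j) = 0" "degree p \<le> n"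
proof -
  define A where "A = Matrix.mat (Suc n) (Suc n) (\<lambda>(j, k). if j < n then v k j else 0)"
  have A: "A \<in> carrier_mat (Suc n) (Suc n)" by (simp add: A_def)
  have "Determinant.det A = 0"
    using laplace_expansion_row[OF A, of n] by (simp add: A_def)
  then obtain c where c: "c \<in> carrier_vec (Suc n)" "c \<noteq> 0\<^sub>v (Suc n)" "A *\<^sub>v c = 0\<^sub>v (Suc n)"
    using det_0_iff_vec_prod_zero[OF A] by blast
  define p where "p = (\<Sum>k\<le>n. monom (c $ k) k)"
  have coeff_p: "coeff p k = (if k \<le> n then c $ k else 0)" for k
    by (simp add: p_def coeff_sum)
  obtain k where "k < Suc n" "c $ k \<noteq> 0" using c by (metis eq_vecI index_zero_vec carrier_vecD)
  then have "p \<noteq> 0" using coeff_p[of k] by auto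
  moreover have "(\<Sum>k\<le>n. coeff p k * v k j) = 0" if "j < n" for j
  proof -
    have "0 = (A *\<^sub>v c) $ j" using that by (simp add: c)
    also have "\<dots> = (\<Sum>k\<in>{0..<Suc n}. A $$ (j, k) * c $ k)"
      unfolding index_mult_mat_vec[of j A c, unfolded carrier_matD[OF A], OF less_SucI[OF that]]
      using that carrier_matD[OF A] carrier_vecD[OF c(1)]
      by (simp add: scalar_prod_def del: sum.op_ivl_Suc)
    also have "\<dots> = (\<Sum>k\<le>n. coeff p k * v k j)"
      using that by (intro sum.cong) (auto simp: A_def coeff_p)
    finally show ?thesis by simp
  qed
  moreover have "degree p \<le> n" by (rule degree_le) (simp add: coeff_p)
  ultimately show ?thesis using that by blast
qed

definition matrix_functional :: "real mat \<Rightarrow> real poly \<Rightarrow> real" where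
  "matrix_functional J p = (\<Sum>k\<le>degree p. coeff p k * (J ^\<^sub>m k) $$ (0, 0))"

lemma matrix_functional_eq:
  assumes "degree p \<le> N"
  shows "matrix_functional J p = (\<Sum>k\<le>N. coeff p k * (J ^\<^sub>m k) $$ (0, 0))"
  unfolding matrix_functional_def using assms
  by (intro sum.mono_neutral_left) (auto simp: coeff_eq_0)

lemma matrix_functional_add: "matrix_functional J (p + q) = matrix_functional J p + matrix_functional J q"
  by (simp add: matrix_functional_eq[of _ "max (degree p) (degree q)"] degree_add_le
      sum.distrib algebra_simps)

lemma matrix_functional_smult: "matrix_functional J (Polynomial.smult a p) = a * matrix_functional J p"
  by (simp add: matrix_functional_eq[of _ "degree p"] degree_smult_le sum_distrib_left algebra_simps)

lemma matrix_functional_monom: "matrix_functional J (monom a k) = a * (J ^\<^sub>m k) $$ (0, 0)"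
proof -
  have "(\<Sum>i\<le>k. coeff (monom a k) i * (J ^\<^sub>m i) $$ (0, 0))
      = (\<Sum>i\<le>k. if k = i then a * (J ^\<^sub>m i) $$ (0, 0) else 0)"
    by (intro sum.cong) (auto)
  then show ?thesis
    using matrix_functional_eq[of "monom a k" k] by (simp add: degree_monom_le)
qed

text \<open>For symmetric \<open>J\<close> the functional is \<open>p q \<mapsto> p(J) e\<^sub>1 \<bullet> q(J) e\<^sub>1\<close>. This form shows at once that
  it is positive and that it annihilates the multiples of any \<open>p\<close> with \<open>p(J) e\<^sub>1 = 0\<close>.\<close>

lemma matrix_functional_mult:
  assumes J: "J \<in> carrier_mat n n" "transpose_mat J = J" and n: "n > 0"
  shows "matrix_functional J (p * q) = (\<Sum>j<n. (\<Sum>k\<le>degree p. coeff p k * (J ^\<^sub>m k) $$ (j, 0)) *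
     (\<Sum>k\<le>degree q. coeff q k * (J ^\<^sub>m k) $$ (j, 0)))"
proof -
  have sum: "matrix_functional J (\<Sum>i\<in>A. f i) = (\<Sum>i\<in>A. matrix_functional J (f i))" for f and A :: "nat set"
  proof (induction A rule: infinite_finite_induct)
    case (insert x F)
    then show ?case by (simp add: matrix_functional_add)
  qed (simp_all add: matrix_functional_def)
  have pc: "J ^\<^sub>m k \<in> carrier_mat n n" for k using J by simp
  have add: "J ^\<^sub>m (k + l) = J ^\<^sub>m k * J ^\<^sub>m l" for k l
  proof (induction l)
    case (Suc l)
    then show ?case using pc[of k] pc[of l] J by (simp add: assoc_mult_mat[of _ n n _ n _ n])
  qed (use pc[of k] J in simp)
  have sym: "transpose_mat (J ^\<^sub>m k) = J ^\<^sub>m k" for k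
  proof (induction k)
    case (Suc k)
    have "transpose_mat (J ^\<^sub>m Suc k) = J * J ^\<^sub>m k"
      using Suc J pc[of k] by (simp add: transpose_mult[of _ n n _ n])
    also have "\<dots> = J ^\<^sub>m Suc k" using J add[of 1 k] by simp
    finally show ?case .
  qed (use J in auto)
  have prod: "(J ^\<^sub>m (k + l)) $$ (0, 0) = (\<Sum>j<n. (J ^\<^sub>m k) $$ (j, 0) * (J ^\<^sub>m l) $$ (j, 0))" for k l
  proof -
    have "(J ^\<^sub>m (k + l)) $$ (0, 0) = (\<Sum>j<n. (J ^\<^sub>m k) $$ (0, j) * (J ^\<^sub>m l) $$ (j, 0))"
      using carrier_matD[OF pc[of k]] carrier_matD[OF pc[of l]] n
      by (simp add: add scalar_prod_def atLeast0LessThan)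
    also have "\<dots> = (\<Sum>j<n. (J ^\<^sub>m k) $$ (j, 0) * (J ^\<^sub>m l) $$ (j, 0))"
    proof (intro sum.cong refl)
      fix j assume "j \<in> {..<n}"
      then have "(J ^\<^sub>m k) $$ (0, j) = transpose_mat (J ^\<^sub>m k) $$ (j, 0)"
        using carrier_matD[OF pc[of k]] n by simp
      then show "(J ^\<^sub>m k) $$ (0, j) * (J ^\<^sub>m l) $$ (j, 0) = (J ^\<^sub>m k) $$ (j, 0) * (J ^\<^sub>m l) $$ (j, 0)"
        by (simp add: sym)
    qed
    finally show ?thesis .
  qed
  have "p * q = (\<Sum>k\<le>degree p. monom (coeff p k) k) * (\<Sum>l\<le>degree q. monom (coeff q l) l)"
    by (simp add: poly_as_sum_of_monoms)
  also have "\<dots> = (\<Sum>k\<le>degree p. \<Sum>l\<le>degree q. monom (coeff p k * coeff q l) (k + l))"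
    by (simp add: sum_product mult_monom)
  finally have "matrix_functional J (p * q)
      = (\<Sum>k\<le>degree p. \<Sum>l\<le>degree q. \<Sum>j<n. (coeff p k * (J ^\<^sub>m k) $$ (j, 0)) * (coeff q l * (J ^\<^sub>m l) $$ (j, 0)))"
    by (simp add: sum matrix_functional_monom prod sum_distrib_left mult_ac)
  also have "\<dots> = (\<Sum>k\<le>degree p. \<Sum>j<n. \<Sum>l\<le>degree q. (coeff p k * (J ^\<^sub>m k) $$ (j, 0)) * (coeff q l * (J ^\<^sub>m l) $$ (j, 0)))"
    by (intro sum.cong refl sum.swap)
  also have "\<dots> = (\<Sum>j<n. \<Sum>k\<le>degree p. \<Sum>l\<le>degree q. (coeff p k * (J ^\<^sub>m k) $$ (j, 0)) * (coeff q l * (J ^\<^sub>m l) $$ (j, 0)))"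
    by (rule sum.swap)
  finally show ?thesis by (simp add: sum_product)
qed

lemma is_spectral_measure_spectral_measure:
  assumes J: "J \<in> carrier_mat n n" "transpose_mat J = J" and n: "n > 0"
  shows "is_spectral_measure J (spectral_measure J)"
proof -
  interpret positive_functional "matrix_functional J"
    by unfold_locales (auto simp: matrix_functional_add matrix_functional_smult
      matrix_functional_mult[OF assms] intro!: sum_nonneg)
  obtain p :: "real poly" where p: "p \<noteq> 0" "degree p \<le> n"
    and rel: "\<And>j. j < n \<Longrightarrow> (\<Sum>k\<le>n. coeff p k * (J ^\<^sub>m k) $$ (j, 0)) = 0"
    using nontrivial_relation[where v = "\<lambda>k j. (J ^\<^sub>m k) $$ (j, 0)"] by metis
  have "(\<Sum>k\<le>degree p. coeff p k * (J ^\<^sub>m k) $$ (j, 0)) = 0" if "j < n" for j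
  proof -
    have "(\<Sum>k\<le>degree p. coeff p k * (J ^\<^sub>m k) $$ (j, 0)) = (\<Sum>k\<le>n. coeff p k * (J ^\<^sub>m k) $$ (j, 0))"
      using p by (intro sum.mono_neutral_left) (auto simp: coeff_eq_0)
    then show ?thesis using rel that by simp
  qed
  then have null: "matrix_functional J (p * q) = 0" for q
    by (simp add: matrix_functional_mult[OF assms])
  have "matrix_functional J 1 = 1"
    using J n by (simp add: matrix_functional_def)
  then have "\<exists>!\<mu>. is_spectral_measure J \<mu>"
    using ex1_representing_measure[OF _ p(1) null]
    by (simp add: is_spectral_measure_def matrix_functional_monom)
  then show ?thesis unfolding spectral_measure_def by (rule theI')
qed

lemma integral_poly_spectral_measure:
  assumes "J \<in> carrier_mat n n" "transpose_mat J = J" "n > 0"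
  shows "(\<integral>x. poly p x \<partial>spectral_measure J) = (\<Sum>k\<le>degree p. coeff p k * (J ^\<^sub>m k) $$ (0, 0))"
proof -
  have "is_spectral_measure J (spectral_measure J)"
    using assms by (rule is_spectral_measure_spectral_measure)
  then show ?thesis
    unfolding poly_altdef is_spectral_measure_def
    by (subst Bochner_Integration.integral_sum) auto
qed

section \<open>Entries of powers of a Jacobi matrix\<close>

text \<open>Total weight of the \<open>m\<close>-step walks on the half line from vertex \<open>i\<close> to vertex \<open>0\<close>, with weight
  \<open>a\<close> for staying, \<open>q\<close> for a step up and \<open>1\<close> for a step down. The full weight \<open>q\<close> of an edge is
  charged to the upward step only, so that no square root of \<open>q\<close> is needed.\<close>

fun jacobi_walk :: "(nat \<Rightarrow> real) \<Rightarrow> (nat \<Rightarrow> real) \<Rightarrow> nat \<Rightarrow> nat \<Rightarrow> real" where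
  "jacobi_walk a q 0 i = (if i = 0 then 1 else 0)"
| "jacobi_walk a q (Suc m) i =
     a (Suc i) * jacobi_walk a q m i + (if i = 0 then 0 else jacobi_walk a q m (i - 1))
     + q (Suc i) * jacobi_walk a q m (Suc i)"

lemma jacobi_walk_eq_0: "m < i \<Longrightarrow> jacobi_walk a q m i = 0"
  by (induction m arbitrary: i) auto

lemma jacobi_matrix_carrier [simp]: "jacobi_matrix n a b \<in> carrier_mat n n"
  by (simp add: jacobi_matrix_def)

lemma transpose_jacobi_matrix: "transpose_mat (jacobi_matrix n a b) = jacobi_matrix n a b"
  by (rule eq_matI) (auto simp: jacobi_matrix_def)

text \<open>Conjugating by the diagonal matrix of the products of the \<open>b\<close>'s turns the symmetric matrix into the one
  with \<open>b\<^sup>2\<close> above and \<open>1\<close> below the diagonal. The identity is stated multiplied out, so that vanishing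
  \<open>b\<close>'s are harmless. A walk of at most \<open>n\<close> steps does not notice that the matrix ends at \<open>n\<close>.\<close>

lemma jacobi_matrix_pow_entry:
  assumes "m \<le> n" "i < n"
  shows "(jacobi_matrix n a b ^\<^sub>m m) $$ (i, 0) =
    (\<Prod>j<i. b (Suc j)) * jacobi_walk a (\<lambda>k. (b k)\<^sup>2) m i"
  using assms
proof (induction m arbitrary: i)
  case 0
  then show ?case by (auto simp: jacobi_matrix_def)
next
  case (Suc m)
  define J where "J = jacobi_matrix n a b"
  let ?w = "jacobi_walk a (\<lambda>k. (b k)\<^sup>2) m"
  let ?v = "\<lambda>j. (J ^\<^sub>m m) $$ (j, 0)"
  have J: "J \<in> carrier_mat n n" by (simp add: J_def)
  have pc: "J ^\<^sub>m k \<in> carrier_mat n n" for k using J by simp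
  have comm: "J ^\<^sub>m k * J = J * J ^\<^sub>m k" for k
  proof (induction k)
    case (Suc k)
    then show ?case using J pc[of k] by (simp add: assoc_mult_mat[of _ n n _ n _ n])
  qed (use J in simp)
  have IH: "?v j = (\<Prod>j<j. b (Suc j)) * ?w j" if "j < n" for j
    using Suc.IH[of j] Suc.prems that by (simp add: J_def)
  have "(J ^\<^sub>m Suc m) $$ (i, 0) = (\<Sum>j<n. J $$ (i, j) * ?v j)"
    using carrier_matD[OF J] carrier_matD[OF pc[of m]] Suc.prems
    by (simp add: comm scalar_prod_def atLeast0LessThan)
  also have "\<dots> = (\<Sum>j<n. (if j = i then a (Suc i) * ?v i else 0)
      + ((if j = i - 1 then (if i = 0 then 0 else b i * ?v (i - 1)) else 0)
      + (if j = Suc i then b (Suc i) * ?v (Suc i) else 0)))"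
    using Suc.prems by (intro sum.cong refl) (auto simp: J_def jacobi_matrix_def)
  also have "\<dots> = a (Suc i) * ?v i + (if i = 0 then 0 else b i * ?v (i - 1))
      + (if Suc i < n then b (Suc i) * ?v (Suc i) else 0)"
    using Suc.prems by (simp add: sum.distrib)
  also have "\<dots> = (\<Prod>j<i. b (Suc j)) * jacobi_walk a (\<lambda>k. (b k)\<^sup>2) (Suc m) i"
  proof -
    have "(if Suc i < n then b (Suc i) * ?v (Suc i) else 0)
        = (\<Prod>j<i. b (Suc j)) * ((b (Suc i))\<^sup>2 * ?w (Suc i))"
      using Suc.prems by (auto simp: IH power2_eq_square jacobi_walk_eq_0)
    moreover have "(if i = 0 then 0 else b i * ?v (i - 1))
        = (\<Prod>j<i. b (Suc j)) * (if i = 0 then 0 else ?w (i - 1))"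
      using Suc.prems by (cases i) (auto simp: IH)
    ultimately show ?thesis using Suc.prems by (simp add: IH algebra_simps)
  qed
  finally show ?case by (simp add: J_def)
qed

lemma smult_minus_smult_one_jacobi:
  "t \<cdot>\<^sub>m (u \<cdot>\<^sub>m jacobi_matrix n a b - v \<cdot>\<^sub>m 1\<^sub>m n)
    = jacobi_matrix n (\<lambda>k. t * (u * a k - v)) (\<lambda>k. t * u * b k)"
  by (rule eq_matI) (auto simp: jacobi_matrix_def)

lemma linear_statistic_eq_jacobi_walk:
  assumes "n > 0" "degree p \<le> n"
  shows "linear_statistic n p1 p2 c s p \<omega> = (\<Sum>m\<le>degree p. coeff p m *
    jacobi_walk (\<lambda>k. ((p1 + p2) * model_diag (\<lambda>k. c k \<omega>) (\<lambda>k. s k \<omega>) k - p1) / sqrt (real n * p1))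
      (\<lambda>k. ((p1 + p2) / sqrt (real n * p1) * model_offdiag (\<lambda>k. c k \<omega>) (\<lambda>k. s k \<omega>) k)\<^sup>2) m 0)"
  using assms
  unfolding linear_statistic_def rescaled_model_matrix_def model_matrix_def smult_minus_smult_one_jacobi
  by (subst integral_poly_spectral_measure)
    (auto simp: transpose_jacobi_matrix jacobi_matrix_pow_entry)

lemma jacobi_walk_cong:
  assumes "\<And>k. 0 < k \<Longrightarrow> k \<le> i + m \<Longrightarrow> a k = a' k" "\<And>k. 0 < k \<Longrightarrow> k \<le> i + m \<Longrightarrow> q k = q' k"
  shows "jacobi_walk a q m i = jacobi_walk a' q' m i"
  using assms
proof (induction m arbitrary: i)
  case (Suc m)
  have "jacobi_walk a q m j = jacobi_walk a' q' m j" if "j \<le> Suc i" for j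
    using that Suc.prems by (intro Suc.IH) auto
  then show ?case using Suc.prems[of "Suc i"] by simp
qed simp

lemma borel_measurable_jacobi_walk:
  assumes "\<And>k. 0 < k \<Longrightarrow> k \<le> i + m \<Longrightarrow> (\<lambda>\<omega>. a \<omega> k) \<in> borel_measurable M"
    "\<And>k. 0 < k \<Longrightarrow> k \<le> i + m \<Longrightarrow> (\<lambda>\<omega>. q \<omega> k) \<in> borel_measurable M"
  shows "(\<lambda>\<omega>. jacobi_walk (a \<omega>) (q \<omega>) m i) \<in> borel_measurable M"
  using assms
proof (induction m arbitrary: i)
  case (Suc m)
  have [measurable]: "(\<lambda>\<omega>. jacobi_walk (a \<omega>) (q \<omega>) m j) \<in> borel_measurable M" if "j \<le> Suc i" for j
    using that Suc.prems by (intro Suc.IH) auto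
  have [measurable]: "(\<lambda>\<omega>. a \<omega> (Suc i)) \<in> borel_measurable M" "(\<lambda>\<omega>. q \<omega> (Suc i)) \<in> borel_measurable M"
    using Suc.prems by auto
  show ?case by simp
qed simp

section \<open>Stein identities and the characteristic function\<close>

lemma abs_integral_le:
  fixes f g :: "'a \<Rightarrow> real"
  assumes "integrable M f" "integrable M g" "\<And>x. \<bar>f x\<bar> \<le> g x"
  shows "\<bar>\<integral>x. f x \<partial>M\<bar> \<le> (\<integral>x. g x \<partial>M)"
  using assms by (intro order_trans[OF integral_abs_bound integral_mono]) auto

text \<open>A centred bounded variable whose Stein identity has a quadratic coefficient, as for the Pearson family of
  distributions. A Gaussian of variance \<open>\<kappa>\<close> corresponds to \<open>\<theta> = \<delta> = 0\<close>, so small \<open>\<theta>\<close> and \<open>\<delta>\<close> mean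
  nearly Gaussian.\<close>

locale pearson_variable = prob_space +
  fixes Y :: "'a \<Rightarrow> real" and \<kappa> \<theta> \<delta> :: real
  assumes Y_measurable [measurable]: "Y \<in> borel_measurable M"
    and Y_bounded: "\<exists>B. AE \<omega> in M. \<bar>Y \<omega>\<bar> \<le> B"
    and stein: "\<And>h h'. (\<And>x. (h has_real_derivative h' x) (at x)) \<Longrightarrow> continuous_on UNIV h' \<Longrightarrow>
      expectation (\<lambda>\<omega>. Y \<omega> * h (Y \<omega>)) = expectation (\<lambda>\<omega>. (\<kappa> + \<theta> * Y \<omega> - \<delta> * (Y \<omega>)\<^sup>2) * h' (Y \<omega>))"
    and \<kappa>_nonneg: "\<kappa> \<ge> 0" and \<delta>_nonneg: "\<delta> \<ge> 0"
begin

lemma integrable_continuous: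
  fixes g :: "real \<Rightarrow> real"
  assumes "continuous_on UNIV g"
  shows "integrable M (\<lambda>\<omega>. g (Y \<omega>))"
proof -
  have [measurable]: "g \<in> borel_measurable borel"
    using assms by (rule borel_measurable_continuous_onI)
  obtain B where B: "AE \<omega> in M. \<bar>Y \<omega>\<bar> \<le> B" using Y_bounded by blast
  have "compact (g ` {- B..B})"
    using assms by (intro compact_continuous_image) (auto intro: continuous_on_subset)
  then obtain C where C: "\<And>y. y \<in> {- B..B} \<Longrightarrow> norm (g y) \<le> C"
    by (meson bounded_iff compact_imp_bounded image_eqI)
  show ?thesis
  proof (rule integrable_const_bound[of _ C])
    show "AE \<omega> in M. norm (g (Y \<omega>)) \<le> C" using B
    proof eventually_elim
      case (elim \<omega>)
      then have "Y \<omega> \<in> {- B..B}" by auto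
      then show ?case by (rule C)
    qed
  qed simp
qed

lemma expectation_eq_0: "expectation Y = 0"
  using stein[of "\<lambda>_. 1" "\<lambda>_. 0"] by simp

text \<open>The Stein identity for an odd power expresses the next even moment by the previous one, up to a term in
  \<open>\<theta>\<close> that is absorbed by the moment on the left when \<open>\<theta>\<close> is small. The term in \<open>\<delta>\<close> has a
  favourable sign.\<close>

lemma even_moment_step:
  assumes "(2 * real k + 1) * \<bar>\<theta>\<bar> \<le> 1"
  shows "expectation (\<lambda>\<omega>. Y \<omega> ^ (2 * Suc k))
    \<le> 2 * (2 * real k + 1) * (\<kappa> + 1) * expectation (\<lambda>\<omega>. Y \<omega> ^ (2 * k))"
proof -
  define A where "A k = expectation (\<lambda>\<omega>. Y \<omega> ^ (2 * k))" for k :: nat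
  have int [simp]: "integrable M (\<lambda>\<omega>. Y \<omega> ^ j)" for j
    by (rule integrable_continuous[of "\<lambda>x. x ^ j"]) (intro continuous_intros)
  have A0: "A j \<ge> 0" for j unfolding A_def by (intro integral_nonneg_AE) simp
  define K where "K = 2 * real k + 1"
  have "K \<ge> 1" by (simp add: K_def)
  have "A (Suc k) = expectation (\<lambda>\<omega>. Y \<omega> * Y \<omega> ^ (2 * k + 1))"
    by (simp add: A_def mult_ac)
  also have "\<dots> = expectation (\<lambda>\<omega>. (\<kappa> + \<theta> * Y \<omega> - \<delta> * (Y \<omega>)\<^sup>2) * (K * Y \<omega> ^ (2 * k)))"
  proof (rule stein)
    show "((\<lambda>y. y ^ (2 * k + 1)) has_real_derivative K * x ^ (2 * k)) (at x)" for x
      using DERIV_pow[of "2 * k + 1" x UNIV] by (simp add: K_def add.commute)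
  qed (intro continuous_intros)
  also have "\<dots> \<le> expectation (\<lambda>\<omega>. (K * \<kappa> + 1 / 2) * Y \<omega> ^ (2 * k) + (1 / 2) * Y \<omega> ^ (2 * Suc k))"
  proof (rule integral_mono)
    show "integrable M (\<lambda>\<omega>. (\<kappa> + \<theta> * Y \<omega> - \<delta> * (Y \<omega>)\<^sup>2) * (K * Y \<omega> ^ (2 * k)))"
      by (rule integrable_continuous[of "\<lambda>y. (\<kappa> + \<theta> * y - \<delta> * y\<^sup>2) * (K * y ^ (2 * k))"])
        (intro continuous_intros)
    show "integrable M (\<lambda>\<omega>. (K * \<kappa> + 1 / 2) * Y \<omega> ^ (2 * k) + (1 / 2) * Y \<omega> ^ (2 * Suc k))"
      by (intro Bochner_Integration.integrable_add integrable_mult_right int)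
    fix \<omega>
    define y where "y = Y \<omega>"
    have e: "y ^ (2 * k) \<ge> 0" by simp
    have "K * \<theta> * y \<le> \<bar>K * \<theta>\<bar> * \<bar>y\<bar>" by (metis abs_ge_self abs_mult)
    also have "\<dots> \<le> 1 * \<bar>y\<bar>"
      using assms \<open>K \<ge> 1\<close> by (intro mult_right_mono) (auto simp: K_def abs_mult)
    also have "\<dots> \<le> 1 / 2 + (1 / 2) * y\<^sup>2"
      using zero_le_power2[of "\<bar>y\<bar> - 1"] by (simp add: power2_eq_square algebra_simps)
    finally have "K * (\<kappa> + \<theta> * y - \<delta> * y\<^sup>2) \<le> K * \<kappa> + 1 / 2 + (1 / 2) * y\<^sup>2"
    proof -
      assume *: "K * \<theta> * y \<le> 1 / 2 + (1 / 2) * y\<^sup>2"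
      have "K * (\<delta> * y\<^sup>2) \<ge> 0" using \<delta>_nonneg \<open>K \<ge> 1\<close> by simp
      moreover have "K * (\<kappa> + \<theta> * y - \<delta> * y\<^sup>2) = K * \<kappa> + K * \<theta> * y - K * (\<delta> * y\<^sup>2)"
        by (simp add: algebra_simps)
      ultimately show ?thesis using * by linarith
    qed
    from mult_right_mono[OF this e]
    show "(\<kappa> + \<theta> * Y \<omega> - \<delta> * (Y \<omega>)\<^sup>2) * (K * Y \<omega> ^ (2 * k))
        \<le> (K * \<kappa> + 1 / 2) * Y \<omega> ^ (2 * k) + (1 / 2) * Y \<omega> ^ (2 * Suc k)"
      unfolding y_def[symmetric] by (simp add: algebra_simps power2_eq_square)
  qed
  also have "\<dots> = (K * \<kappa> + 1 / 2) * A k + (1 / 2) * A (Suc k)"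
    unfolding A_def by (subst Bochner_Integration.integral_add) (auto intro: int simp del: power_Suc)
  finally have "A (Suc k) \<le> 2 * ((K * \<kappa> + 1 / 2) * A k)" by simp
  also have "\<dots> \<le> 2 * ((K * (\<kappa> + 1)) * A k)"
    using A0[of k] \<open>K \<ge> 1\<close> by (intro mult_left_mono mult_right_mono) (auto simp: algebra_simps)
  finally show ?thesis by (simp only: A_def K_def mult.assoc)
qed

text \<open>By the Stein identity, \<open>u t = E[cos (t Y + \<alpha>)]\<close> satisfies \<open>u' = - \<kappa> t u\<close> up to an error \<open>\<bar>t\<bar> \<eta>\<close>.
  Multiplying by the integrating factor \<open>exp (\<kappa> t\<^sup>2 / 2)\<close> and applying the mean value theorem compares
  \<open>u\<close> with the exact solution. The phase \<open>\<alpha>\<close> treats the real and the imaginary part of the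
  characteristic function in one argument.\<close>

lemma expectation_cos_bound_nonneg:
  assumes t: "t \<ge> 0"
  defines "\<eta> \<equiv> \<bar>\<theta>\<bar> * expectation (\<lambda>\<omega>. \<bar>Y \<omega>\<bar>) + \<delta> * expectation (\<lambda>\<omega>. (Y \<omega>)\<^sup>2)"
  shows "\<bar>expectation (\<lambda>\<omega>. cos (t * Y \<omega> + \<alpha>)) - cos \<alpha> * exp (- \<kappa> * t\<^sup>2 / 2)\<bar> \<le> \<eta> * t\<^sup>2"
proof (cases "t = 0")
  case True
  then show ?thesis by (simp add: prob_space)
next
  case False
  with t have t: "t > 0" by simp
  define u where "u t = expectation (\<lambda>\<omega>. cos (t * Y \<omega> + \<alpha>))" for t
  define u' where "u' t = - expectation (\<lambda>\<omega>. Y \<omega> * sin (t * Y \<omega> + \<alpha>))" for t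
  have int_cos: "integrable M (\<lambda>\<omega>. cos (t * Y \<omega> + \<alpha>))" for t
    by (rule integrable_continuous) (intro continuous_intros)
  have int_sin: "integrable M (\<lambda>\<omega>. Y \<omega> * sin (t * Y \<omega> + \<alpha>))" for t
    by (rule integrable_continuous[of "\<lambda>y. y * sin (t * y + \<alpha>)"]) (intro continuous_intros)
  have int2: "integrable M (\<lambda>\<omega>. (Y \<omega>)\<^sup>2)"
    by (rule integrable_continuous) (intro continuous_intros)
  have int1: "integrable M (\<lambda>\<omega>. \<bar>Y \<omega>\<bar>)"
    by (rule integrable_continuous) (intro continuous_intros)
  have sin_lip: "\<bar>sin x - sin y\<bar> \<le> \<bar>x - y\<bar>" for x y :: real
  proof -
    have "\<bar>sin x - sin y\<bar> = 2 * (\<bar>sin ((x - y) / 2)\<bar> * \<bar>cos ((x + y) / 2)\<bar>)"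
      by (simp add: sin_diff_sin abs_mult)
    also have "\<dots> \<le> 2 * (\<bar>(x - y) / 2\<bar> * 1)"
      by (intro mult_left_mono mult_mono abs_sin_x_le_abs_x) auto
    finally show ?thesis by simp
  qed
  have taylor: "\<bar>cos (x + h) - cos x + h * sin x\<bar> \<le> h\<^sup>2" for x h :: real
  proof -
    have main: "\<bar>cos (x + h) - cos x + h * sin x\<bar> \<le> h\<^sup>2" if "h > 0" for x h :: real
    proof -
      have "\<exists>z>x. z < x + h \<and> cos (x + h) - cos x = (x + h - x) * - sin z"
        using that by (intro MVT2) (auto intro!: derivative_eq_intros)
      then obtain z where z: "x < z" "z < x + h" "cos (x + h) - cos x = - h * sin z" by auto
      then have "\<bar>cos (x + h) - cos x + h * sin x\<bar> = h * \<bar>sin x - sin z\<bar>"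
        using that by (metis (no_types, opaque_lifting) abs_mult abs_of_pos add.commute
            diff_conv_add_uminus mult_minus_left right_diff_distrib)
      also have "\<dots> \<le> h * h"
        using sin_lip[of x z] z that by (intro mult_left_mono) auto
      finally show ?thesis by (simp add: power2_eq_square)
    qed
    show ?thesis
    proof (cases "h = 0")
      case False
      then consider "h > 0" | "- h > 0" by linarith
      then show ?thesis
      proof cases
        case 2
        have "cos (- x + - h) = cos (x + h)" by (metis cos_minus minus_add_distrib)
        then show ?thesis using main[OF 2, of "- x"] by simp
      qed (use main in simp)
    qed simp
  qed
  have deriv_u: "(u has_real_derivative u' t) (at t)" for t
  proof -
    have "norm ((u (t + h) - u t) / h - u' t) \<le> expectation (\<lambda>\<omega>. (Y \<omega>)\<^sup>2) * \<bar>h\<bar>" if "h \<noteq> 0" for h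
    proof -
      have "u (t + h) - u t - h * u' t = expectation (\<lambda>\<omega>. cos ((t * Y \<omega> + \<alpha>) + h * Y \<omega>)
          - cos (t * Y \<omega> + \<alpha>) + h * Y \<omega> * sin (t * Y \<omega> + \<alpha>))"
        unfolding u_def u'_def using int_cos[of "t + h"] int_cos[of t] int_sin[of t]
        by (simp add: algebra_simps)
      also have "\<bar>\<dots>\<bar> \<le> expectation (\<lambda>\<omega>. h\<^sup>2 * (Y \<omega>)\<^sup>2)"
      proof (rule abs_integral_le)
        show "integrable M (\<lambda>\<omega>. cos ((t * Y \<omega> + \<alpha>) + h * Y \<omega>)
          - cos (t * Y \<omega> + \<alpha>) + h * Y \<omega> * sin (t * Y \<omega> + \<alpha>))"
          using int_cos[of "t + h"] int_cos[of t] integrable_mult_right[OF int_sin[of t], of h]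
          by (auto simp: algebra_simps)
        show "integrable M (\<lambda>\<omega>. h\<^sup>2 * (Y \<omega>)\<^sup>2)" using int2 by simp
        show "\<bar>cos ((t * Y \<omega> + \<alpha>) + h * Y \<omega>) - cos (t * Y \<omega> + \<alpha>) + h * Y \<omega> * sin (t * Y \<omega> + \<alpha>)\<bar>
            \<le> h\<^sup>2 * (Y \<omega>)\<^sup>2" for \<omega>
          using taylor[of "t * Y \<omega> + \<alpha>" "h * Y \<omega>"] by (simp add: power_mult_distrib)
      qed
      finally have "\<bar>u (t + h) - u t - h * u' t\<bar> \<le> \<bar>h\<bar> * (expectation (\<lambda>\<omega>. (Y \<omega>)\<^sup>2) * \<bar>h\<bar>)"
        by (simp add: power2_eq_square mult_ac flip: abs_mult)
      moreover have "(u (t + h) - u t) / h - u' t = (u (t + h) - u t - h * u' t) / h"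
        using that by (simp add: field_simps)
      ultimately show ?thesis
        using that by (simp add: abs_divide divide_le_eq mult_ac)
    qed
    then have "\<forall>\<^sub>F h in at 0. norm ((u (t + h) - u t) / h - u' t) \<le> expectation (\<lambda>\<omega>. (Y \<omega>)\<^sup>2) * \<bar>h\<bar>"
      unfolding eventually_at_filter by (intro always_eventually allI impI) blast
    moreover have "((\<lambda>h. expectation (\<lambda>\<omega>. (Y \<omega>)\<^sup>2) * \<bar>h\<bar>) \<longlongrightarrow> 0) (at 0)"
      by (auto intro!: tendsto_eq_intros)
    ultimately have "((\<lambda>h. (u (t + h) - u t) / h - u' t) \<longlongrightarrow> 0) (at 0)"
      by (rule Lim_null_comparison)
    then show ?thesis by (simp add: DERIV_def LIM_zero_iff)
  qed
  have "\<eta> \<ge> 0" unfolding \<eta>_def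
    by (intro add_nonneg_nonneg mult_nonneg_nonneg \<delta>_nonneg integral_nonneg_AE) auto
  have ode: "\<bar>u' t + \<kappa> * t * u t\<bar> \<le> \<bar>t\<bar> * \<eta>" for t
  proof -
    have "u' t = - expectation (\<lambda>\<omega>. (\<kappa> + \<theta> * Y \<omega> - \<delta> * (Y \<omega>)\<^sup>2) * (t * cos (t * Y \<omega> + \<alpha>)))"
      unfolding u'_def
      by (subst stein[where h' = "\<lambda>y. t * cos (t * y + \<alpha>)" and h = "\<lambda>y. sin (t * y + \<alpha>)"])
        (auto intro!: derivative_eq_intros continuous_intros)
    moreover have "integrable M (\<lambda>\<omega>. (\<kappa> + \<theta> * Y \<omega> - \<delta> * (Y \<omega>)\<^sup>2) * (t * cos (t * Y \<omega> + \<alpha>)))"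
      by (rule integrable_continuous[of "\<lambda>y. (\<kappa> + \<theta> * y - \<delta> * y\<^sup>2) * (t * cos (t * y + \<alpha>))"])
        (intro continuous_intros)
    ultimately have "u' t + \<kappa> * t * u t
        = expectation (\<lambda>\<omega>. \<kappa> * t * cos (t * Y \<omega> + \<alpha>)
           - (\<kappa> + \<theta> * Y \<omega> - \<delta> * (Y \<omega>)\<^sup>2) * (t * cos (t * Y \<omega> + \<alpha>)))"
      unfolding u_def using int_cos[of t] by (subst Bochner_Integration.integral_diff) auto
    also have "\<dots> = expectation (\<lambda>\<omega>. t * cos (t * Y \<omega> + \<alpha>) * (\<delta> * (Y \<omega>)\<^sup>2 - \<theta> * Y \<omega>))"
      by (simp add: algebra_simps)
    also have "\<bar>\<dots>\<bar> \<le> expectation (\<lambda>\<omega>. \<bar>t\<bar> * (\<bar>\<theta>\<bar> * \<bar>Y \<omega>\<bar> + \<delta> * (Y \<omega>)\<^sup>2))"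
    proof (rule abs_integral_le)
      show "integrable M (\<lambda>\<omega>. t * cos (t * Y \<omega> + \<alpha>) * (\<delta> * (Y \<omega>)\<^sup>2 - \<theta> * Y \<omega>))"
        by (rule integrable_continuous[of "\<lambda>y. t * cos (t * y + \<alpha>) * (\<delta> * y\<^sup>2 - \<theta> * y)"])
          (intro continuous_intros)
      show "integrable M (\<lambda>\<omega>. \<bar>t\<bar> * (\<bar>\<theta>\<bar> * \<bar>Y \<omega>\<bar> + \<delta> * (Y \<omega>)\<^sup>2))"
        using int1 int2 by simp
      fix \<omega>
      have "\<bar>t * cos (t * Y \<omega> + \<alpha>) * (\<delta> * (Y \<omega>)\<^sup>2 - \<theta> * Y \<omega>)\<bar>
          = \<bar>t\<bar> * (\<bar>cos (t * Y \<omega> + \<alpha>)\<bar> * \<bar>\<delta> * (Y \<omega>)\<^sup>2 - \<theta> * Y \<omega>\<bar>)"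
        by (simp add: abs_mult)
      also have "\<dots> \<le> \<bar>t\<bar> * (1 * (\<bar>\<theta>\<bar> * \<bar>Y \<omega>\<bar> + \<delta> * (Y \<omega>)\<^sup>2))"
      proof (intro mult_left_mono mult_mono)
        have "\<bar>\<delta> * (Y \<omega>)\<^sup>2 - \<theta> * Y \<omega>\<bar> \<le> \<bar>\<delta> * (Y \<omega>)\<^sup>2\<bar> + \<bar>\<theta> * Y \<omega>\<bar>"
          by (rule abs_triangle_ineq4)
        then show "\<bar>\<delta> * (Y \<omega>)\<^sup>2 - \<theta> * Y \<omega>\<bar> \<le> \<bar>\<theta>\<bar> * \<bar>Y \<omega>\<bar> + \<delta> * (Y \<omega>)\<^sup>2"
          using \<delta>_nonneg by (simp add: abs_mult)
      qed (auto simp: \<delta>_nonneg)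
      finally show "\<bar>t * cos (t * Y \<omega> + \<alpha>) * (\<delta> * (Y \<omega>)\<^sup>2 - \<theta> * Y \<omega>)\<bar>
          \<le> \<bar>t\<bar> * (\<bar>\<theta>\<bar> * \<bar>Y \<omega>\<bar> + \<delta> * (Y \<omega>)\<^sup>2)" by simp
    qed
    also have "\<dots> = \<bar>t\<bar> * \<eta>" using int1 int2 by (simp add: \<eta>_def)
    finally show ?thesis .
  qed
  \<comment> \<open>the integrating factor removes the main term of the differential equation\<close>
  define g where "g t = u t * exp (\<kappa> * t\<^sup>2 / 2)" for t
  have "(g has_real_derivative (u' t + \<kappa> * t * u t) * exp (\<kappa> * t\<^sup>2 / 2)) (at t)" for t
    unfolding g_def by (auto intro!: derivative_eq_intros deriv_u simp: algebra_simps)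
  then have "\<exists>z>0. z < t \<and> g t - g 0 = (t - 0) * ((u' z + \<kappa> * z * u z) * exp (\<kappa> * z\<^sup>2 / 2))"
    using t by (intro MVT2) auto
  then obtain z where z: "0 < z" "z < t"
    "g t - g 0 = t * ((u' z + \<kappa> * z * u z) * exp (\<kappa> * z\<^sup>2 / 2))" by auto
  have "\<bar>g t - g 0\<bar> = t * (\<bar>u' z + \<kappa> * z * u z\<bar> * exp (\<kappa> * z\<^sup>2 / 2))"
    using t by (simp add: z(3) abs_mult)
  also have "\<dots> \<le> t * ((t * \<eta>) * exp (\<kappa> * t\<^sup>2 / 2))"
  proof (intro mult_left_mono mult_mono)
    show "\<bar>u' z + \<kappa> * z * u z\<bar> \<le> t * \<eta>"
      using ode[of z] mult_right_mono[of z t \<eta>] z \<open>\<eta> \<ge> 0\<close> by simp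
    have "z\<^sup>2 \<le> t\<^sup>2" using z by (intro power_mono) auto
    then show "exp (\<kappa> * z\<^sup>2 / 2) \<le> exp (\<kappa> * t\<^sup>2 / 2)"
      using \<kappa>_nonneg by (simp add: mult_left_mono)
  qed (use t \<open>\<eta> \<ge> 0\<close> in auto)
  finally have *: "\<bar>g t - g 0\<bar> \<le> \<eta> * t\<^sup>2 * exp (\<kappa> * t\<^sup>2 / 2)"
    by (simp add: power2_eq_square mult_ac)
  have "u t - cos \<alpha> * exp (- \<kappa> * t\<^sup>2 / 2) = (g t - g 0) * exp (- (\<kappa> * t\<^sup>2 / 2))"
    unfolding g_def by (simp add: u_def prob_space left_diff_distrib mult.assoc flip: exp_add)
  also have "\<bar>\<dots>\<bar> = \<bar>g t - g 0\<bar> * exp (- (\<kappa> * t\<^sup>2 / 2))" by (simp add: abs_mult)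
  also have "\<dots> \<le> \<eta> * t\<^sup>2 * exp (\<kappa> * t\<^sup>2 / 2) * exp (- (\<kappa> * t\<^sup>2 / 2))"
    using * by (intro mult_right_mono) auto
  also have "\<dots> = \<eta> * t\<^sup>2" by (simp add: mult.assoc flip: exp_add)
  finally show ?thesis by (simp add: u_def)
qed

text \<open>Negative \<open>t\<close> is reduced to positive \<open>t\<close> by reflecting the phase, since the cosine is even.\<close>

lemma expectation_cos_bound:
  "\<bar>expectation (\<lambda>\<omega>. cos (t * Y \<omega> + \<alpha>)) - cos \<alpha> * exp (- \<kappa> * t\<^sup>2 / 2)\<bar>
    \<le> (\<bar>\<theta>\<bar> * expectation (\<lambda>\<omega>. \<bar>Y \<omega>\<bar>) + \<delta> * expectation (\<lambda>\<omega>. (Y \<omega>)\<^sup>2)) * t\<^sup>2"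
proof (cases "t \<ge> 0")
  case True
  then show ?thesis by (rule expectation_cos_bound_nonneg)
next
  case False
  have "cos (- t * Y \<omega> + - \<alpha>) = cos (t * Y \<omega> + \<alpha>)" for \<omega>
    by (metis cos_minus minus_add_distrib mult_minus_left)
  then show ?thesis using expectation_cos_bound_nonneg[of "- t" "- \<alpha>"] False by simp
qed

lemma char_bound:
  "cmod (char (distr M borel Y) t - exp (- \<kappa> * t\<^sup>2 / 2))
    \<le> 2 * (\<bar>\<theta>\<bar> * expectation (\<lambda>\<omega>. \<bar>Y \<omega>\<bar>) + \<delta> * expectation (\<lambda>\<omega>. (Y \<omega>)\<^sup>2)) * t\<^sup>2"
    (is "_ \<le> 2 * ?\<eta> * _")
proof -
  have int: "integrable M (\<lambda>\<omega>. iexp (t * Y \<omega>))"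
    by (rule integrable_iexp) auto
  have "char (distr M borel Y) t = expectation (\<lambda>\<omega>. iexp (t * Y \<omega>))"
    unfolding char_def by (subst integral_distr) auto
  moreover have "Re (expectation (\<lambda>\<omega>. iexp (t * Y \<omega>))) = expectation (\<lambda>\<omega>. cos (t * Y \<omega> + 0))"
    using int by (simp flip: integral_Re add: Re_exp)
  \<comment> \<open>the sine is the cosine with phase \<open>- \<pi> / 2\<close>\<close>
  moreover have "Im (expectation (\<lambda>\<omega>. iexp (t * Y \<omega>))) = expectation (\<lambda>\<omega>. cos (t * Y \<omega> + - (pi / 2)))"
  proof -
    have "cos (x + - (pi / 2)) = sin x" for x :: real by (simp only: cos_add) simp
    then show ?thesis using int by (simp flip: integral_Im add: Im_exp)
  qed
  moreover define D where "D = char (distr M borel Y) t - exp (- \<kappa> * t\<^sup>2 / 2)"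
  ultimately have "Re D = expectation (\<lambda>\<omega>. cos (t * Y \<omega> + 0)) - cos 0 * exp (- \<kappa> * t\<^sup>2 / 2)"
    "Im D = expectation (\<lambda>\<omega>. cos (t * Y \<omega> + - (pi / 2))) - cos (- (pi / 2)) * exp (- \<kappa> * t\<^sup>2 / 2)"
    by simp_all
  then have "\<bar>Re D\<bar> \<le> ?\<eta> * t\<^sup>2" "\<bar>Im D\<bar> \<le> ?\<eta> * t\<^sup>2"
    using expectation_cos_bound[of t 0] expectation_cos_bound[of t "- (pi / 2)"] by metis+
  then have "cmod D \<le> ?\<eta> * t\<^sup>2 + ?\<eta> * t\<^sup>2" using cmod_le[of D] by linarith
  then show ?thesis unfolding D_def by (simp only: mult.assoc mult_2[of "?\<eta> * t\<^sup>2"])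
qed

end

section \<open>Beta variables\<close>

lemma Beta_real_pos: "a > 0 \<Longrightarrow> b > 0 \<Longrightarrow> Beta a b > (0::real)"
  by (simp add: Beta_def)

lemma beta_density_nonneg: "a > 0 \<Longrightarrow> b > 0 \<Longrightarrow> beta_density a b x \<ge> 0"
  using Beta_real_pos[of a b] by (simp add: beta_density_def)

lemma beta_variable_in_unit_interval:
  assumes "prob_space M" and X: "distributed M lborel X (\<lambda>x. ennreal (beta_density a b x))"
  shows "AE \<omega> in M. 0 < X \<omega> \<and> X \<omega> < 1"
proof -
  have "AE x in lborel. 0 < ennreal (beta_density a b x) \<longrightarrow> 0 < x \<and> x < 1"
    by (auto simp: beta_density_def)
  then show ?thesis
    using prob_space.distributed_AE2[OF assms, of "\<lambda>x. 0 < x \<and> x < 1"] by simp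
qed

text \<open>Expectations over a Beta variable as gauge integrals over the closed unit interval, where the
  fundamental theorem of calculus applies; for parameters above \<open>1\<close> the integrand is continuous up to
  the end points.\<close>

lemma beta_integral:
  fixes g :: "real \<Rightarrow> real"
  assumes ab: "a > 1" "b > 1"
    and X: "distributed M lborel X (\<lambda>x. ennreal (beta_density a b x))"
    and g: "continuous_on UNIV g"
  shows "(\<integral>\<omega>. g (X \<omega>) \<partial>M) * Beta a b =
    integral {0..1} (\<lambda>x. x powr (a - 1) * (1 - x) powr (b - 1) * g x)"
proof -
  let ?k = "\<lambda>x. x powr (a - 1) * (1 - x) powr (b - 1) * g x"
  have [measurable]: "g \<in> borel_measurable borel"
    using g by (rule borel_measurable_continuous_onI)
  have "(\<integral>\<omega>. g (X \<omega>) \<partial>M) = (\<integral>x. beta_density a b x * g x \<partial>lborel)"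
    using ab by (intro distributed_integral[OF X, symmetric]) (auto intro: beta_density_nonneg)
  also have "\<dots> = (\<integral>x. (indicator {0..1} x *\<^sub>R ?k x) / Beta a b \<partial>lborel)"
    by (intro Bochner_Integration.integral_cong refl)
      (auto simp: beta_density_def indicator_def less_le)
  also have "\<dots> = (LINT x:{0..1}|lborel. ?k x) / Beta a b"
    by (simp add: set_lebesgue_integral_def)
  also have "(LINT x:{0..1}|lborel. ?k x) = integral {0..1} ?k"
  proof (rule set_borel_integral_eq_integral)
    show "set_integrable lborel {0..1} ?k"
      using ab by (intro borel_integrable_atLeastAtMost' continuous_intros continuous_on_powr'
          continuous_on_subset[OF g]) auto
  qed
  finally show ?thesis using Beta_real_pos[of a b] ab by simp
qed

text \<open>Integration by parts: the integrand is the derivative of \<open>- x^a (1 - x)^b f x\<close>, which vanishes at both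
  end points.\<close>

lemma beta_stein:
  fixes f f' :: "real \<Rightarrow> real"
  assumes ab: "a > 1" "b > 1"
    and X: "distributed M lborel X (\<lambda>x. ennreal (beta_density a b x))"
    and f: "\<And>x. (f has_real_derivative f' x) (at x)" and f': "continuous_on UNIV f'"
  shows "(\<integral>\<omega>. ((a + b) * X \<omega> - a) * f (X \<omega>) - X \<omega> * (1 - X \<omega>) * f' (X \<omega>) \<partial>M) = 0"
proof -
  have cf: "continuous_on UNIV f"
    by (intro continuous_at_imp_continuous_on ballI DERIV_isCont[OF f])
  let ?g = "\<lambda>x. ((a + b) * x - a) * f x - x * (1 - x) * f' x"
  define G where "G x = - (x powr a * (1 - x) powr b * f x)" for x
  have "((\<lambda>x. x powr (a - 1) * (1 - x) powr (b - 1) * ?g x) has_integral G 1 - G 0) {0..1}"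
  proof (rule fundamental_theorem_of_calculus_interior)
    show "continuous_on {0..1} G" unfolding G_def
      using ab by (intro continuous_intros continuous_on_powr' continuous_on_subset[OF cf]) auto
    fix x :: real assume x: "x \<in> {0<..<1}"
    have p: "y powr c = y * y powr (c - 1)" if "y > 0" for y c :: real
      using that by (simp add: powr_diff)
    have "(G has_real_derivative - (((a * x powr (a - 1)) * (1 - x) powr b
        - x powr a * (b * (1 - x) powr (b - 1))) * f x + x powr a * (1 - x) powr b * f' x)) (at x)"
      unfolding G_def using x by (auto intro!: derivative_eq_intros f simp: algebra_simps)
    also have "- (((a * x powr (a - 1)) * (1 - x) powr b
        - x powr a * (b * (1 - x) powr (b - 1))) * f x + x powr a * (1 - x) powr b * f' x)
        = x powr (a - 1) * (1 - x) powr (b - 1) * ?g x"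
    proof -
      have pa: "x powr a = x * x powr (a - 1)" and pb: "(1 - x) powr b = (1 - x) * (1 - x) powr (b - 1)"
        using x by (intro p; simp)+
      have "- (((a * U) * ((1 - x) * V) - x * U * (b * V)) * F + x * U * ((1 - x) * V) * F')
        = U * V * (((a + b) * x - a) * F - x * (1 - x) * F')" for U V F F'
        by (simp add: algebra_simps)
      then show ?thesis unfolding pa pb .
    qed
    finally show "(G has_vector_derivative x powr (a - 1) * (1 - x) powr (b - 1) * ?g x) (at x)"
      by (simp add: has_real_derivative_iff_has_vector_derivative)
  qed simp
  then have "integral {0..1} (\<lambda>x. x powr (a - 1) * (1 - x) powr (b - 1) * ?g x) = 0"
    by (simp add: integral_unique G_def)
  then have "(\<integral>\<omega>. ?g (X \<omega>) \<partial>M) * Beta a b = 0"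
    by (subst beta_integral[OF ab X]) (auto intro!: continuous_intros cf f')
  then show ?thesis using Beta_real_pos[of a b] ab by simp
qed

text \<open>The coefficient \<open>X (1 - X)\<close> of the Stein identity, expanded around the mean \<open>a / (a + b)\<close>, is the
  quadratic polynomial with the stated coefficients.\<close>

lemma beta_pearson_variable:
  assumes "prob_space M" and ab: "a > 1" "b > 1" and l: "l > 0"
    and X: "distributed M lborel X (\<lambda>x. ennreal (beta_density a b x))"
  shows "pearson_variable M (\<lambda>\<omega>. l * (X \<omega> - a / (a + b)))
    (l\<^sup>2 * a * b / (a + b) ^ 3) (l * (b - a) / (a + b)\<^sup>2) (1 / (a + b))"
proof -
  interpret prob_space M by fact
  define m where "m = a / (a + b)"
  define Y where "Y = (\<lambda>\<omega>. l * (X \<omega> - m))"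
  have X_meas [measurable]: "X \<in> borel_measurable M"
    using distributed_measurable[OF X] by simp
  have X01: "AE \<omega> in M. 0 < X \<omega> \<and> X \<omega> < 1"
    using \<open>prob_space M\<close> X by (rule beta_variable_in_unit_interval)
  show ?thesis unfolding m_def[symmetric] Y_def[symmetric]
  proof (unfold_locales)
    show "Y \<in> borel_measurable M" unfolding Y_def by simp
    show "\<exists>B. AE \<omega> in M. \<bar>Y \<omega>\<bar> \<le> B"
    proof (rule exI[of _ "l * (1 + \<bar>m\<bar>)"])
      show "AE \<omega> in M. \<bar>Y \<omega>\<bar> \<le> l * (1 + \<bar>m\<bar>)" using X01
      proof eventually_elim
        case (elim \<omega>)
        then have "\<bar>X \<omega> - m\<bar> \<le> 1 + \<bar>m\<bar>" by linarith
        then show ?case using l unfolding Y_def by (simp add: abs_mult)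
      qed
    qed
    fix h h' :: "real \<Rightarrow> real"
    assume h: "\<And>x. (h has_real_derivative h' x) (at x)" and h': "continuous_on UNIV h'"
    have ch: "continuous_on UNIV h"      by (intro continuous_at_imp_continuous_on ballI DERIV_isCont[OF h])
    have c1: "continuous_on UNIV (\<lambda>x. h' (l * (x - m)))"
      by (intro continuous_on_compose2[OF h'] continuous_intros) auto
    have c2: "continuous_on UNIV (\<lambda>x. h (l * (x - m)))"
      by (intro continuous_on_compose2[OF ch] continuous_intros) auto
    have int: "integrable M (\<lambda>\<omega>. g (X \<omega>))" if g: "continuous_on UNIV g" for g :: "real \<Rightarrow> real"
    proof -
      have [measurable]: "g \<in> borel_measurable borel"
        using g by (rule borel_measurable_continuous_onI)
      have "compact (g ` {0..1})"
        using g by (intro compact_continuous_image) (auto intro: continuous_on_subset)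
      then obtain C where C: "\<And>y. y \<in> {0..1} \<Longrightarrow> norm (g y) \<le> C"
        by (meson bounded_iff compact_imp_bounded image_eqI)
      show ?thesis
      proof (rule integrable_const_bound[of _ C])
        show "AE \<omega> in M. norm (g (X \<omega>)) \<le> C"
          using X01 by eventually_elim (rule C, simp)
      qed simp
    qed
    have "(\<integral>\<omega>. ((a + b) * X \<omega> - a) * h (l * (X \<omega> - m)) - X \<omega> * (1 - X \<omega>) * (l * h' (l * (X \<omega> - m))) \<partial>M) = 0"
    proof (rule beta_stein[OF ab X])
      show "((\<lambda>x. h (l * (x - m))) has_real_derivative l * h' (l * (x - m))) (at x)" for x
        by (rule DERIV_chain'[of "\<lambda>x. l * (x - m)" l x UNIV h, simplified, unfolded mult.commute[of _ l]])
          (auto intro!: derivative_eq_intros h)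
    qed (intro continuous_intros c1)
    then have "0 = l / (a + b) * (\<integral>\<omega>. ((a + b) * X \<omega> - a) * h (l * (X \<omega> - m)) - X \<omega> * (1 - X \<omega>) * (l * h' (l * (X \<omega> - m))) \<partial>M)"
      by simp
    also have "\<dots> = (\<integral>\<omega>. Y \<omega> * h (Y \<omega>) - (l\<^sup>2 / (a + b) * (X \<omega> * (1 - X \<omega>))) * h' (Y \<omega>) \<partial>M)"
      unfolding integral_mult_right_zero[symmetric]
    proof (intro Bochner_Integration.integral_cong refl)
      fix \<omega>
      have "l / (a + b) * ((a + b) * X \<omega> - a) = Y \<omega>"
        using ab by (simp add: Y_def m_def field_simps)
      moreover have "l / (a + b) * (A * H - Q * (l * K)) = (l / (a + b) * A) * H - (l\<^sup>2 / (a + b) * Q) * K"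
        for A H Q K by (simp add: right_diff_distrib power2_eq_square mult_ac)
      ultimately show "l / (a + b) * (((a + b) * X \<omega> - a) * h (l * (X \<omega> - m)) - X \<omega> * (1 - X \<omega>) * (l * h' (l * (X \<omega> - m))))
        = Y \<omega> * h (Y \<omega>) - (l\<^sup>2 / (a + b) * (X \<omega> * (1 - X \<omega>))) * h' (Y \<omega>)"
        by (simp only: Y_def)
    qed
    also have "\<dots> = expectation (\<lambda>\<omega>. Y \<omega> * h (Y \<omega>))
        - expectation (\<lambda>\<omega>. (l\<^sup>2 / (a + b) * (X \<omega> * (1 - X \<omega>))) * h' (Y \<omega>))"
      unfolding Y_def
      by (intro Bochner_Integration.integral_diff int[of "\<lambda>x. l * (x - m) * h (l * (x - m))"]
          int[of "\<lambda>x. (l\<^sup>2 / (a + b) * (x * (1 - x))) * h' (l * (x - m))"] continuous_intros c1 c2)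
    finally have "expectation (\<lambda>\<omega>. Y \<omega> * h (Y \<omega>))
        = expectation (\<lambda>\<omega>. (l\<^sup>2 / (a + b) * (X \<omega> * (1 - X \<omega>))) * h' (Y \<omega>))" by simp
    moreover have "l\<^sup>2 / (a + b) * (X \<omega> * (1 - X \<omega>)) = l\<^sup>2 * a * b / (a + b) ^ 3
        + l * (b - a) / (a + b)\<^sup>2 * Y \<omega> - 1 / (a + b) * (Y \<omega>)\<^sup>2" for \<omega>
    proof -
      define s where "s = a + b"
      have s: "s \<noteq> 0" "b = s - a" using ab by (simp_all add: s_def)
      have X: "X \<omega> = a / s + Y \<omega> / l" using l by (simp add: Y_def m_def s_def)
      show ?thesis unfolding s_def[symmetric] X s(2) using s(1) l
        by (simp add: field_simps power2_eq_square power3_eq_cube)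
    qed
    ultimately show "expectation (\<lambda>\<omega>. Y \<omega> * h (Y \<omega>)) = expectation (\<lambda>\<omega>. (l\<^sup>2 * a * b / (a + b) ^ 3
        + l * (b - a) / (a + b)\<^sup>2 * Y \<omega> - 1 / (a + b) * (Y \<omega>)\<^sup>2) * h' (Y \<omega>))" by (simp only:)
  qed (use ab in auto)
qed

section \<open>Bounded moments and arrays of Pearson variables\<close>

text \<open>Bounds are required only for large \<open>n\<close>, how large depending on the order of the moment. Even moments suffice
  to control products and absolute values.\<close>

definition moment_bounded :: "(nat \<Rightarrow> 'a measure) \<Rightarrow> (nat \<Rightarrow> 'a \<Rightarrow> real) \<Rightarrow> bool" where
  "moment_bounded M R \<longleftrightarrow> (\<forall>k. \<exists>C. \<forall>\<^sub>F n in sequentially. R n \<in> borel_measurable (M n) \<and>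
     integrable (M n) (\<lambda>\<omega>. R n \<omega> ^ (2 * k)) \<and> (\<integral>\<omega>. R n \<omega> ^ (2 * k) \<partial>M n) \<le> C)"

lemma moment_boundedE:
  assumes "moment_bounded M R"
  obtains C where "C \<ge> 0" "\<forall>\<^sub>F n in sequentially. R n \<in> borel_measurable (M n) \<and>
     integrable (M n) (\<lambda>\<omega>. R n \<omega> ^ (2 * k)) \<and> (\<integral>\<omega>. R n \<omega> ^ (2 * k) \<partial>M n) \<le> C"
proof -
  obtain C where C: "\<forall>\<^sub>F n in sequentially. R n \<in> borel_measurable (M n) \<and>
     integrable (M n) (\<lambda>\<omega>. R n \<omega> ^ (2 * k)) \<and> (\<integral>\<omega>. R n \<omega> ^ (2 * k) \<partial>M n) \<le> C"
    using assms unfolding moment_bounded_def by blast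
  have "\<forall>\<^sub>F n in sequentially. R n \<in> borel_measurable (M n) \<and>
     integrable (M n) (\<lambda>\<omega>. R n \<omega> ^ (2 * k)) \<and> (\<integral>\<omega>. R n \<omega> ^ (2 * k) \<partial>M n) \<le> max C 0"
    using C by eventually_elim auto
  then show ?thesis using that[of "max C 0"] by simp
qed

lemma moment_bounded_add:
  assumes "moment_bounded M R" "moment_bounded M S"
  shows "moment_bounded M (\<lambda>n \<omega>. R n \<omega> + S n \<omega>)"
  unfolding moment_bounded_def
proof
  fix k
  obtain C where C: "\<forall>\<^sub>F n in sequentially. R n \<in> borel_measurable (M n) \<and>
     integrable (M n) (\<lambda>\<omega>. R n \<omega> ^ (2 * k)) \<and> (\<integral>\<omega>. R n \<omega> ^ (2 * k) \<partial>M n) \<le> C"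
    using assms(1) by (rule moment_boundedE)
  obtain D where D: "\<forall>\<^sub>F n in sequentially. S n \<in> borel_measurable (M n) \<and>
     integrable (M n) (\<lambda>\<omega>. S n \<omega> ^ (2 * k)) \<and> (\<integral>\<omega>. S n \<omega> ^ (2 * k) \<partial>M n) \<le> D"
    using assms(2) by (rule moment_boundedE)
  have bound: "(r + s) ^ (2 * k) \<le> 2 ^ (2 * k) * (r ^ (2 * k) + s ^ (2 * k))" for r s :: real
  proof -
    have "(r + s) ^ (2 * k) = \<bar>r + s\<bar> ^ (2 * k)" by (simp add: power_mult)
    also have "\<dots> \<le> (2 * max \<bar>r\<bar> \<bar>s\<bar>) ^ (2 * k)" by (intro power_mono) auto
    also have "\<dots> = 2 ^ (2 * k) * max \<bar>r\<bar> \<bar>s\<bar> ^ (2 * k)" by (rule power_mult_distrib)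
    also have "max \<bar>r\<bar> \<bar>s\<bar> ^ (2 * k) \<le> r ^ (2 * k) + s ^ (2 * k)"
      by (simp add: max_def power_mult)
    finally show ?thesis by simp
  qed
  have "\<forall>\<^sub>F n in sequentially. (\<lambda>\<omega>. R n \<omega> + S n \<omega>) \<in> borel_measurable (M n) \<and>
     integrable (M n) (\<lambda>\<omega>. (R n \<omega> + S n \<omega>) ^ (2 * k)) \<and>
     (\<integral>\<omega>. (R n \<omega> + S n \<omega>) ^ (2 * k) \<partial>M n) \<le> 2 ^ (2 * k) * (C + D)"
    using C D
  proof eventually_elim
    case (elim n)
    then have [measurable]: "R n \<in> borel_measurable (M n)" "S n \<in> borel_measurable (M n)" by auto
    have int: "integrable (M n) (\<lambda>\<omega>. 2 ^ (2 * k) * (R n \<omega> ^ (2 * k) + S n \<omega> ^ (2 * k)))"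
      using elim by simp
    then have i: "integrable (M n) (\<lambda>\<omega>. (R n \<omega> + S n \<omega>) ^ (2 * k))"
      by (rule Bochner_Integration.integrable_bound) (use bound in \<open>auto simp: power_mult\<close>)
    from i int have "(\<integral>\<omega>. (R n \<omega> + S n \<omega>) ^ (2 * k) \<partial>M n)
        \<le> (\<integral>\<omega>. 2 ^ (2 * k) * (R n \<omega> ^ (2 * k) + S n \<omega> ^ (2 * k)) \<partial>M n)"
      using bound by (intro integral_mono) auto
    also have "(\<integral>\<omega>. 2 ^ (2 * k) * (R n \<omega> ^ (2 * k) + S n \<omega> ^ (2 * k)) \<partial>M n) \<le> 2 ^ (2 * k) * (C + D)"
      using elim by simp
    finally show ?case using i by simp
  qed
  then show "\<exists>C. \<forall>\<^sub>F n in sequentially. (\<lambda>\<omega>. R n \<omega> + S n \<omega>) \<in> borel_measurable (M n) \<and>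
     integrable (M n) (\<lambda>\<omega>. (R n \<omega> + S n \<omega>) ^ (2 * k)) \<and>
     (\<integral>\<omega>. (R n \<omega> + S n \<omega>) ^ (2 * k) \<partial>M n) \<le> C" by blast
qed

lemma moment_bounded_mult:
  assumes "moment_bounded M R" "moment_bounded M S"
  shows "moment_bounded M (\<lambda>n \<omega>. R n \<omega> * S n \<omega>)"
  unfolding moment_bounded_def
proof
  fix k
  obtain C where C: "\<forall>\<^sub>F n in sequentially. R n \<in> borel_measurable (M n) \<and>
     integrable (M n) (\<lambda>\<omega>. R n \<omega> ^ (2 * (2 * k))) \<and> (\<integral>\<omega>. R n \<omega> ^ (2 * (2 * k)) \<partial>M n) \<le> C"
    using assms(1) by (rule moment_boundedE)
  obtain D where D: "\<forall>\<^sub>F n in sequentially. S n \<in> borel_measurable (M n) \<and>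
     integrable (M n) (\<lambda>\<omega>. S n \<omega> ^ (2 * (2 * k))) \<and> (\<integral>\<omega>. S n \<omega> ^ (2 * (2 * k)) \<partial>M n) \<le> D"
    using assms(2) by (rule moment_boundedE)
  have bound: "(r * s) ^ (2 * k) \<le> r ^ (2 * (2 * k)) + s ^ (2 * (2 * k))" for r s :: real
  proof -
    have "2 * (r ^ (2 * k) * s ^ (2 * k)) \<le> (r ^ (2 * k))\<^sup>2 + (s ^ (2 * k))\<^sup>2"
      using sum_squares_bound[of "r ^ (2 * k)" "s ^ (2 * k)"] by (simp add: mult.assoc)
    moreover have "0 \<le> r ^ (2 * k) * s ^ (2 * k)" by simp
    ultimately show ?thesis by (simp add: power_mult_distrib mult.commute flip: power_mult)
  qed
  have "\<forall>\<^sub>F n in sequentially. (\<lambda>\<omega>. R n \<omega> * S n \<omega>) \<in> borel_measurable (M n) \<and>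
     integrable (M n) (\<lambda>\<omega>. (R n \<omega> * S n \<omega>) ^ (2 * k)) \<and>
     (\<integral>\<omega>. (R n \<omega> * S n \<omega>) ^ (2 * k) \<partial>M n) \<le> C + D"
    using C D
  proof eventually_elim
    case (elim n)
    then have [measurable]: "R n \<in> borel_measurable (M n)" "S n \<in> borel_measurable (M n)" by auto
    have int: "integrable (M n) (\<lambda>\<omega>. R n \<omega> ^ (2 * (2 * k)) + S n \<omega> ^ (2 * (2 * k)))"
      using elim by simp
    then have "integrable (M n) (\<lambda>\<omega>. (R n \<omega> * S n \<omega>) ^ (2 * k))"
      by (rule Bochner_Integration.integrable_bound) (use bound in \<open>auto simp: power_mult\<close>)
    moreover from this int have "(\<integral>\<omega>. (R n \<omega> * S n \<omega>) ^ (2 * k) \<partial>M n)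
        \<le> (\<integral>\<omega>. R n \<omega> ^ (2 * (2 * k)) + S n \<omega> ^ (2 * (2 * k)) \<partial>M n)"
      using bound by (intro integral_mono) auto
    moreover have "(\<integral>\<omega>. R n \<omega> ^ (2 * (2 * k)) + S n \<omega> ^ (2 * (2 * k)) \<partial>M n) \<le> C + D"
      using elim by simp
    ultimately show ?case by auto
  qed
  then show "\<exists>C. \<forall>\<^sub>F n in sequentially. (\<lambda>\<omega>. R n \<omega> * S n \<omega>) \<in> borel_measurable (M n) \<and>
     integrable (M n) (\<lambda>\<omega>. (R n \<omega> * S n \<omega>) ^ (2 * k)) \<and>
     (\<integral>\<omega>. (R n \<omega> * S n \<omega>) ^ (2 * k) \<partial>M n) \<le> C" by blast
qed

lemma moment_bounded_const:
  assumes "\<forall>\<^sub>F n in sequentially. prob_space (M n)" "convergent x"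
  shows "moment_bounded M (\<lambda>n \<omega>. x n)"
  unfolding moment_bounded_def
proof
  fix k
  obtain B where B: "\<And>n. \<bar>x n\<bar> \<le> B"
    using convergent_imp_Bseq[OF assms(2)] by (auto simp: Bseq_def)
  have "\<forall>\<^sub>F n in sequentially. (\<lambda>\<omega>. x n) \<in> borel_measurable (M n) \<and>
     integrable (M n) (\<lambda>\<omega>. x n ^ (2 * k)) \<and> (\<integral>\<omega>. x n ^ (2 * k) \<partial>M n) \<le> B ^ (2 * k)"
    using assms(1)
  proof eventually_elim
    case (elim n)
    interpret prob_space "M n" by fact
    have "x n ^ (2 * k) = \<bar>x n\<bar> ^ (2 * k)" by (simp add: power_mult)
    also have "\<dots> \<le> B ^ (2 * k)" by (intro power_mono B) auto
    finally show ?case by (simp add: prob_space)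
  qed
  then show "\<exists>C. \<forall>\<^sub>F n in sequentially. (\<lambda>\<omega>. x n) \<in> borel_measurable (M n) \<and>
     integrable (M n) (\<lambda>\<omega>. x n ^ (2 * k)) \<and> (\<integral>\<omega>. x n ^ (2 * k) \<partial>M n) \<le> C" by blast
qed

lemma moment_bounded_sum:
  assumes "\<forall>\<^sub>F n in sequentially. prob_space (M n)" "\<And>i. i \<in> I \<Longrightarrow> moment_bounded M (R i)"
  shows "moment_bounded M (\<lambda>n \<omega>. \<Sum>i\<in>I. R i n \<omega>)"
  using assms(2)
proof (induction I rule: infinite_finite_induct)
  case (insert i I)
  then show ?case using moment_bounded_add[of M "R i"] by simp
qed (use moment_bounded_const[OF assms(1), of "\<lambda>_. 0"] in \<open>simp_all add: convergent_const\<close>)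

lemma moment_bounded_integrable:
  assumes "\<forall>\<^sub>F n in sequentially. prob_space (M n)" "moment_bounded M R"
  obtains C where "C \<ge> 0" "\<forall>\<^sub>F n in sequentially. R n \<in> borel_measurable (M n) \<and>
    integrable (M n) (R n) \<and> (\<integral>\<omega>. \<bar>R n \<omega>\<bar> \<partial>M n) \<le> C"
proof -
  obtain C where "C \<ge> 0" and C: "\<forall>\<^sub>F n in sequentially. R n \<in> borel_measurable (M n) \<and>
     integrable (M n) (\<lambda>\<omega>. R n \<omega> ^ (2 * 1)) \<and> (\<integral>\<omega>. R n \<omega> ^ (2 * 1) \<partial>M n) \<le> C"
    using assms(2) by (rule moment_boundedE)
  have "\<forall>\<^sub>F n in sequentially. R n \<in> borel_measurable (M n) \<and>
    integrable (M n) (R n) \<and> (\<integral>\<omega>. \<bar>R n \<omega>\<bar> \<partial>M n) \<le> 1 + C"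
    using C assms(1)
  proof eventually_elim
    case (elim n)
    interpret prob_space "M n" by fact
    have [measurable]: "R n \<in> borel_measurable (M n)" and sq: "integrable (M n) (\<lambda>\<omega>. (R n \<omega>)\<^sup>2)"
      using elim by simp_all
    have bound: "\<bar>r\<bar> \<le> 1 + r\<^sup>2" for r :: real
      using zero_le_power2[of "\<bar>r\<bar> - 1"] zero_le_power2[of r] by (simp add: power2_eq_square algebra_simps)
    have int: "integrable (M n) (\<lambda>\<omega>. 1 + (R n \<omega>)\<^sup>2)" using sq by simp
    then have "integrable (M n) (R n)"
      by (rule Bochner_Integration.integrable_bound) (use bound in \<open>auto\<close>)
    moreover from this int have "(\<integral>\<omega>. \<bar>R n \<omega>\<bar> \<partial>M n) \<le> (\<integral>\<omega>. 1 + (R n \<omega>)\<^sup>2 \<partial>M n)"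
      using bound by (intro integral_mono) auto
    moreover have "(\<integral>\<omega>. 1 + (R n \<omega>)\<^sup>2 \<partial>M n) \<le> 1 + C"
      using sq elim by (simp add: prob_space)
    ultimately show ?case by auto
  qed
  then show ?thesis using that[of "1 + C"] \<open>C \<ge> 0\<close> by simp
qed

text \<open>The hypotheses of a central limit theorem for one Pearson variable: the Stein coefficient converges to the
  constant \<open>v\<close>.\<close>

locale pearson_array =
  fixes M :: "nat \<Rightarrow> 'a measure" and Y :: "nat \<Rightarrow> 'a \<Rightarrow> real" and \<kappa> \<theta> \<delta> :: "nat \<Rightarrow> real" and v :: real
  assumes pearson: "\<forall>\<^sub>F n in sequentially. pearson_variable (M n) (Y n) (\<kappa> n) (\<theta> n) (\<delta> n)"
    and \<kappa>_lim: "\<kappa> \<longlonglongrightarrow> v" and \<theta>_lim: "\<theta> \<longlonglongrightarrow> 0" and \<delta>_lim: "\<delta> \<longlonglongrightarrow> 0"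
begin

lemma eventually_prob_space: "\<forall>\<^sub>F n in sequentially. prob_space (M n)"
  using pearson by eventually_elim (simp add: pearson_variable_def)

lemma limit_nonneg: "v \<ge> 0"
  using \<kappa>_lim by (rule tendsto_lowerbound)
    (use pearson in \<open>auto elim!: eventually_mono simp: pearson_variable.\<kappa>_nonneg\<close>)

lemma eventually_centered: "\<forall>\<^sub>F n in sequentially. (\<integral>\<omega>. Y n \<omega> \<partial>M n) = 0"
  using pearson by eventually_elim (rule pearson_variable.expectation_eq_0)

lemma moment_bounded: "moment_bounded M Y"
  unfolding moment_bounded_def
proof
  fix k
  have "\<exists>C. C \<ge> 0 \<and> (\<forall>\<^sub>F n in sequentially. (\<integral>\<omega>. Y n \<omega> ^ (2 * k) \<partial>M n) \<le> C)"
  proof (induction k)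
    case 0
    have "\<forall>\<^sub>F n in sequentially. (\<integral>\<omega>. Y n \<omega> ^ (2 * 0) \<partial>M n) \<le> 1"
      using eventually_prob_space by eventually_elim (simp add: prob_space.prob_space)
    then show ?case by (intro exI[of _ 1]) simp
  next
    case (Suc k)
    then obtain C where "C \<ge> 0" and C: "\<forall>\<^sub>F n in sequentially. (\<integral>\<omega>. Y n \<omega> ^ (2 * k) \<partial>M n) \<le> C"
      by blast
    define K where "K = 2 * real k + 1"
    have "K > 0" by (simp add: K_def)
    have "(\<lambda>n. K * \<bar>\<theta> n\<bar>) \<longlonglongrightarrow> 0" using \<theta>_lim by (auto intro!: tendsto_eq_intros)
    then have "\<forall>\<^sub>F n in sequentially. K * \<bar>\<theta> n\<bar> < 1" by (rule order_tendstoD) simp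
    moreover have "\<forall>\<^sub>F n in sequentially. \<kappa> n < v + 1" using \<kappa>_lim by (rule order_tendstoD) simp
    ultimately have "\<forall>\<^sub>F n in sequentially. (\<integral>\<omega>. Y n \<omega> ^ (2 * Suc k) \<partial>M n) \<le> 2 * K * (v + 2) * C"
      using C pearson
    proof eventually_elim
      case (elim n)
      interpret pearson_variable "M n" "Y n" "\<kappa> n" "\<theta> n" "\<delta> n" by fact
      have "(\<integral>\<omega>. Y n \<omega> ^ (2 * Suc k) \<partial>M n) \<le> 2 * K * (\<kappa> n + 1) * (\<integral>\<omega>. Y n \<omega> ^ (2 * k) \<partial>M n)"
        using even_moment_step[of k] elim by (simp add: K_def)
      also have "\<dots> \<le> 2 * K * (v + 2) * C"
        using elim \<open>C \<ge> 0\<close> \<open>K > 0\<close> \<kappa>_nonneg limit_nonneg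
        by (intro mult_mono mult_left_mono integral_nonneg_AE) auto
      finally show ?case .
    qed
    moreover have "2 * K * (v + 2) * C \<ge> 0" using \<open>C \<ge> 0\<close> \<open>K > 0\<close> limit_nonneg by simp
    ultimately show ?case by blast
  qed
  then obtain C where "\<forall>\<^sub>F n in sequentially. (\<integral>\<omega>. Y n \<omega> ^ (2 * k) \<partial>M n) \<le> C" by blast
  then have "\<forall>\<^sub>F n in sequentially. Y n \<in> borel_measurable (M n) \<and>
     integrable (M n) (\<lambda>\<omega>. Y n \<omega> ^ (2 * k)) \<and> (\<integral>\<omega>. Y n \<omega> ^ (2 * k) \<partial>M n) \<le> C"
    using pearson
  proof eventually_elim
    case (elim n)
    interpret pearson_variable "M n" "Y n" "\<kappa> n" "\<theta> n" "\<delta> n" by fact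
    have "integrable (M n) (\<lambda>\<omega>. Y n \<omega> ^ (2 * k))"
      by (rule integrable_continuous[of "\<lambda>y. y ^ (2 * k)"]) (intro continuous_intros)
    with elim show ?case by simp
  qed
  then show "\<exists>C. \<forall>\<^sub>F n in sequentially. Y n \<in> borel_measurable (M n) \<and>
     integrable (M n) (\<lambda>\<omega>. Y n \<omega> ^ (2 * k)) \<and> (\<integral>\<omega>. Y n \<omega> ^ (2 * k) \<partial>M n) \<le> C" by blast
qed

text \<open>The argument \<open>t n\<close> varies with \<open>n\<close> because the coefficients in a linear combination of fluctuations
  do.\<close>

lemma char_tendsto:
  assumes t: "t \<longlonglongrightarrow> t0"
  shows "(\<lambda>n. char (distr (M n) borel (Y n)) (t n)) \<longlonglongrightarrow> complex_of_real (exp (- v * t0\<^sup>2 / 2))"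
proof -
  obtain C where C: "\<forall>\<^sub>F n in sequentially. Y n \<in> borel_measurable (M n) \<and>
    integrable (M n) (Y n) \<and> (\<integral>\<omega>. \<bar>Y n \<omega>\<bar> \<partial>M n) \<le> C"
    using eventually_prob_space moment_bounded by (rule moment_bounded_integrable)
  obtain D where D: "\<forall>\<^sub>F n in sequentially. Y n \<in> borel_measurable (M n) \<and>
    integrable (M n) (\<lambda>\<omega>. Y n \<omega> ^ (2 * 1)) \<and> (\<integral>\<omega>. Y n \<omega> ^ (2 * 1) \<partial>M n) \<le> D"
    using moment_bounded by (rule moment_boundedE)
  have "\<forall>\<^sub>F n in sequentially. norm (char (distr (M n) borel (Y n)) (t n)
      - complex_of_real (exp (- \<kappa> n * (t n)\<^sup>2 / 2))) \<le> 2 * (\<bar>\<theta> n\<bar> * C + \<delta> n * D) * (t n)\<^sup>2"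
    using C D pearson
  proof eventually_elim
    case (elim n)
    interpret pearson_variable "M n" "Y n" "\<kappa> n" "\<theta> n" "\<delta> n" by fact
    show ?case
      using elim by (intro order_trans[OF char_bound] mult_right_mono mult_left_mono add_mono)
        (auto simp: \<delta>_nonneg)
  qed
  moreover have "(\<lambda>n. 2 * (\<bar>\<theta> n\<bar> * C + \<delta> n * D) * (t n)\<^sup>2) \<longlonglongrightarrow> 0"
    using \<theta>_lim \<delta>_lim t by (auto intro!: tendsto_eq_intros)
  ultimately have "(\<lambda>n. char (distr (M n) borel (Y n)) (t n)
      - complex_of_real (exp (- \<kappa> n * (t n)\<^sup>2 / 2))) \<longlonglongrightarrow> 0"
    by (rule Lim_null_comparison)
  moreover have "(\<lambda>n. complex_of_real (exp (- \<kappa> n * (t n)\<^sup>2 / 2)))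
      \<longlonglongrightarrow> complex_of_real (exp (- v * t0\<^sup>2 / 2))"
    by (intro tendsto_intros t \<kappa>_lim) auto
  ultimately show ?thesis using tendsto_add by fastforce
qed

end

section \<open>A central limit theorem for asymptotically linear statistics\<close>

text \<open>Degenerate and nondegenerate normal laws are treated alike as the image of the standard normal law under
  multiplication by \<open>sqrt v\<close>.\<close>

lemma real_distribution_normal_law: "v \<ge> 0 \<Longrightarrow> real_distribution (normal_law 0 v)"
  and char_normal_law: "v \<ge> 0 \<Longrightarrow> char (normal_law 0 v) t = complex_of_real (exp (- v * t\<^sup>2 / 2))"
proof -
  assume "v \<ge> 0"
  have "normal_law 0 v = distr std_normal_distribution borel (\<lambda>x. sqrt v * x)"
  proof (cases "v = 0")
    case True
    interpret prob_space std_normal_distribution by (rule prob_space_normal_density) simp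
    have "distr std_normal_distribution borel (\<lambda>x. 0) = return borel (0::real)"
    proof (rule measure_eqI)
      fix A :: "real set" assume "A \<in> sets (distr std_normal_distribution borel (\<lambda>x. 0))"
      then have A: "A \<in> sets borel" by simp
      have "(\<lambda>x. 0) -` A \<inter> space std_normal_distribution = (if 0 \<in> A then space std_normal_distribution else {})"
        by auto
      then show "emeasure (distr std_normal_distribution borel (\<lambda>x. 0)) A = emeasure (return borel 0) A"
        using A emeasure_space_1 by (simp add: emeasure_distr)
    qed simp
    then show ?thesis using True by (simp add: normal_law_def)
  next
    case False
    interpret prob_space std_normal_distribution by (rule prob_space_normal_density) simp
    have "distributed std_normal_distribution lborel (\<lambda>x. x) (\<lambda>x. ennreal (std_normal_density x))"
      by (simp add: distributed_def distr_id2)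
    from normal_density_affine[OF this, of "sqrt v" 0]
    have "distributed std_normal_distribution lborel (\<lambda>x. sqrt v * x) (\<lambda>x. ennreal (normal_density 0 (sqrt v) x))"
      using \<open>v \<ge> 0\<close> False by simp
    then have "distr std_normal_distribution lborel (\<lambda>x. sqrt v * x) = normal_law 0 v"
      using False by (simp add: distributed_distr_eq_density normal_law_def)
    then show ?thesis
      by (metis distr_cong sets_lborel)
  qed
  note eq = this
  interpret real_distribution std_normal_distribution by (rule real_dist_normal_dist)
  show "real_distribution (normal_law 0 v)" unfolding eq by (rule real_distribution_distr) simp
  have "char (normal_law 0 v) t = (CLINT x|std_normal_distribution. iexp (t * (sqrt v * x)))"
    unfolding eq char_def by (subst integral_distr) auto
  also have "\<dots> = char std_normal_distribution (t * sqrt v)"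
    unfolding char_def by (simp add: mult.assoc)
  finally show "char (normal_law 0 v) t = complex_of_real (exp (- v * t\<^sup>2 / 2))"
    using \<open>v \<ge> 0\<close> by (simp add: char_std_normal_distribution power_mult_distrib mult.commute)
qed

lemma norm_iexp_diff_le: "norm (iexp (x + y) - iexp x) \<le> \<bar>y\<bar>"
proof -
  have "iexp (x + y) - iexp x = iexp x * (iexp y - 1)"
    by (simp add: exp_add[symmetric] algebra_simps)
  moreover have "norm (iexp y - 1) \<le> \<bar>y\<bar>" using iexp_approx1[of y 0] by simp
  ultimately show ?thesis by (simp add: norm_mult)
qed

text \<open>Slutsky's theorem in quantitative form: an \<open>L\<^sup>1\<close>-small perturbation moves the characteristic function
  little.\<close>

lemma (in prob_space) char_perturbation:
  assumes Z: "Z \<in> borel_measurable M" and T: "integrable M T"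
  shows "norm (char (distr M borel (\<lambda>\<omega>. Z \<omega> + T \<omega>)) t - char (distr M borel Z) t)
    \<le> \<bar>t\<bar> * expectation (\<lambda>\<omega>. \<bar>T \<omega>\<bar>)"
proof -
  note [measurable] = Z borel_measurable_integrable[OF T]
  have int: "integrable M (\<lambda>\<omega>. iexp (t * (Z \<omega> + T \<omega>)))" "integrable M (\<lambda>\<omega>. iexp (t * Z \<omega>))"
    by (auto intro!: integrable_iexp)
  have "char (distr M borel (\<lambda>\<omega>. Z \<omega> + T \<omega>)) t - char (distr M borel Z) t
      = (CLINT \<omega>|M. iexp (t * (Z \<omega> + T \<omega>)) - iexp (t * Z \<omega>))"
    unfolding char_def using int by (simp add: integral_distr Bochner_Integration.integral_diff)
  also have "norm \<dots> \<le> expectation (\<lambda>\<omega>. norm (iexp (t * (Z \<omega> + T \<omega>)) - iexp (t * Z \<omega>)))"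
    by (rule integral_norm_bound)
  also have "\<dots> \<le> expectation (\<lambda>\<omega>. \<bar>t\<bar> * \<bar>T \<omega>\<bar>)"
  proof (rule integral_mono)
    show "integrable M (\<lambda>\<omega>. norm (iexp (t * (Z \<omega> + T \<omega>)) - iexp (t * Z \<omega>)))"
      using int by (intro integrable_norm Bochner_Integration.integrable_diff)
    show "integrable M (\<lambda>\<omega>. \<bar>t\<bar> * \<bar>T \<omega>\<bar>)" using T by simp
    show "norm (iexp (t * (Z \<omega> + T \<omega>)) - iexp (t * Z \<omega>)) \<le> \<bar>t\<bar> * \<bar>T \<omega>\<bar>" for \<omega>
      using norm_iexp_diff_le[of "t * Z \<omega>" "t * T \<omega>"] by (simp only: distrib_left abs_mult)
  qed
  finally show ?thesis by simp
qed

text \<open>Levy's continuity theorem for sequences that consist of random variables only from some index on.\<close>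

lemma weak_conv_normal_law:
  assumes "v \<ge> 0"
    and meas: "\<forall>\<^sub>F n in sequentially. prob_space (M n) \<and> X n \<in> borel_measurable (M n)"
    and lim: "\<And>t. (\<lambda>n. char (distr (M n) borel (X n)) t) \<longlonglongrightarrow> complex_of_real (exp (- v * t\<^sup>2 / 2))"
  shows "weak_conv_m (\<lambda>n. distr (M n) borel (X n)) (normal_law 0 v)"
proof -
  obtain k where k: "\<And>n. n \<ge> k \<Longrightarrow> prob_space (M n) \<and> X n \<in> borel_measurable (M n)"
    using meas by (auto simp: eventually_sequentially)
  have "weak_conv_m (\<lambda>n. distr (M (n + k)) borel (X (n + k))) (normal_law 0 v)"
  proof (rule levy_continuity)
    show "real_distribution (distr (M (n + k)) borel (X (n + k)))" for n
      using k[of "n + k"] by (intro prob_space.real_distribution_distr) auto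
    show "real_distribution (normal_law 0 v)" using assms(1) by (rule real_distribution_normal_law)
    show "(\<lambda>n. char (distr (M (n + k)) borel (X (n + k))) t) \<longlonglongrightarrow> char (normal_law 0 v) t" for t
      using LIMSEQ_ignore_initial_segment[OF lim, of k t] assms(1) by (simp add: char_normal_law)
  qed
  then show ?thesis unfolding weak_conv_m_def weak_conv_def
    by (auto intro: LIMSEQ_offset[of _ k])
qed

text \<open>Asymptotically Gaussian independent noise \<open>W n i\<close> and the large parameter \<open>N n\<close> whose inverse square
  root is the size of the noise.\<close>

locale fluctuation_array =
  fixes M :: "nat \<Rightarrow> 'a measure" and W :: "nat \<Rightarrow> 'i \<Rightarrow> 'a \<Rightarrow> real"
    and v :: "'i \<Rightarrow> real" and N :: "nat \<Rightarrow> real"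
  assumes eventually_prob: "\<forall>\<^sub>F n in sequentially. prob_space (M n)"
    and N_top: "filterlim N at_top sequentially"
    and W_moments: "\<And>i. moment_bounded M (\<lambda>n. W n i)"
    and W_centered: "\<And>i. \<forall>\<^sub>F n in sequentially. (\<integral>\<omega>. W n i \<omega> \<partial>M n) = 0"
    and W_char: "\<And>i t t0. t \<longlonglongrightarrow> t0 \<Longrightarrow>
      (\<lambda>n. char (distr (M n) borel (W n i)) (t n)) \<longlonglongrightarrow> complex_of_real (exp (- v i * t0\<^sup>2 / 2))"
    and W_indep: "\<And>I. finite I \<Longrightarrow>
      \<forall>\<^sub>F n in sequentially. prob_space.indep_vars (M n) (\<lambda>_. borel) (W n) I"
    and v_nonneg: "\<And>i. v i \<ge> 0"
begin

text \<open>The first-order expansion of a statistic in the small noise. Demanding that the remainder be bounded in all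
  moments, rather than in probability, is what makes products stay in the class and what allows expectations to
  be expanded together with the statistic.\<close>

definition asymp_linear :: "(nat \<Rightarrow> 'a \<Rightarrow> real) \<Rightarrow> bool" where
  "asymp_linear X \<longleftrightarrow> (\<exists>I x u R. finite I \<and> convergent x \<and> (\<forall>i. convergent (\<lambda>n. u n i)) \<and>
     moment_bounded M R \<and> (\<forall>\<^sub>F n in sequentially. \<forall>\<omega>.
       X n \<omega> = x n + (\<Sum>i\<in>I. u n i * W n i \<omega>) / sqrt (N n) + R n \<omega> / N n))"

lemma asymp_linearI:
  assumes "finite I" "convergent x" "\<And>i. convergent (\<lambda>n. u n i)" "moment_bounded M R"
    "\<forall>\<^sub>F n in sequentially. \<forall>\<omega>. X n \<omega> = x n + (\<Sum>i\<in>I. u n i * W n i \<omega>) / sqrt (N n) + R n \<omega> / N n"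
  shows "asymp_linear X"
  using assms unfolding asymp_linear_def by blast

lemma moment_bounded_deterministic: "convergent x \<Longrightarrow> moment_bounded M (\<lambda>n \<omega>. x n)"
  using eventually_prob by (rule moment_bounded_const)

lemma asymp_linear_deterministic:
  assumes "convergent x"
  shows "asymp_linear (\<lambda>n \<omega>. x n)"
  using assms moment_bounded_deterministic[of "\<lambda>_. 0"]
  by (intro asymp_linearI[of "{}" x "\<lambda>_ _. 0" "\<lambda>_ _. 0"]) (auto simp: convergent_const)

lemma asymp_linear_fluctuation:
  assumes "convergent x"
  shows "asymp_linear (\<lambda>n \<omega>. x n + W n i \<omega> / sqrt (N n))"
  using assms moment_bounded_deterministic[of "\<lambda>_. 0"]
  by (intro asymp_linearI[of "{i}" x "\<lambda>_ _. 1" "\<lambda>_ _. 0"]) (auto simp: convergent_const)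

lemma asymp_linear_cong:
  assumes "asymp_linear X" "\<forall>\<^sub>F n in sequentially. \<forall>\<omega>. X' n \<omega> = X n \<omega>"
  shows "asymp_linear X'"
proof -
  obtain I x u R where *: "finite I" "convergent x" "\<And>i. convergent (\<lambda>n. u n i)" "moment_bounded M R"
    and eq: "\<forall>\<^sub>F n in sequentially. \<forall>\<omega>. X n \<omega> = x n + (\<Sum>i\<in>I. u n i * W n i \<omega>) / sqrt (N n) + R n \<omega> / N n"
    using assms(1) unfolding asymp_linear_def by blast
  show ?thesis
  proof (rule asymp_linearI[of I x u R])
    show "\<forall>\<^sub>F n in sequentially. \<forall>\<omega>. X' n \<omega> = x n + (\<Sum>i\<in>I. u n i * W n i \<omega>) / sqrt (N n) + R n \<omega> / N n"
      using eq assms(2) by eventually_elim simp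
  qed (use * in auto)
qed

text \<open>Two expansions can be written over the same finite set of noise variables by padding with zero
  coefficients.\<close>

lemma common_fluctuations:
  assumes "asymp_linear X" "asymp_linear Y"
  obtains I x y u w R S where "finite I" "convergent x" "convergent y"
    "\<And>i. convergent (\<lambda>n. u n i)" "\<And>i. convergent (\<lambda>n. w n i)" "moment_bounded M R" "moment_bounded M S"
    "\<forall>\<^sub>F n in sequentially. (\<forall>\<omega>. X n \<omega> = x n + (\<Sum>i\<in>I. u n i * W n i \<omega>) / sqrt (N n) + R n \<omega> / N n) \<and>
      (\<forall>\<omega>. Y n \<omega> = y n + (\<Sum>i\<in>I. w n i * W n i \<omega>) / sqrt (N n) + S n \<omega> / N n)"
proof -
  obtain I x u R where X: "finite I" "convergent x" "\<And>i. convergent (\<lambda>n. u n i)" "moment_bounded M R"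
    "\<forall>\<^sub>F n in sequentially. \<forall>\<omega>. X n \<omega> = x n + (\<Sum>i\<in>I. u n i * W n i \<omega>) / sqrt (N n) + R n \<omega> / N n"
    using assms(1) unfolding asymp_linear_def by blast
  obtain J y w S where Y: "finite J" "convergent y" "\<And>i. convergent (\<lambda>n. w n i)" "moment_bounded M S"
    "\<forall>\<^sub>F n in sequentially. \<forall>\<omega>. Y n \<omega> = y n + (\<Sum>i\<in>J. w n i * W n i \<omega>) / sqrt (N n) + S n \<omega> / N n"
    using assms(2) unfolding asymp_linear_def by blast
  define u' where "u' n i = (if i \<in> I then u n i else 0)" for n i
  define w' where "w' n i = (if i \<in> J then w n i else 0)" for n i
  have "convergent (\<lambda>n. u' n i)" "convergent (\<lambda>n. w' n i)" for i
    using X(3)[of i] Y(3)[of i] by (cases "i \<in> I"; cases "i \<in> J"; simp add: u'_def w'_def convergent_const)+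
  moreover have "(\<Sum>i\<in>I. u n i * W n i \<omega>) = (\<Sum>i\<in>I \<union> J. u' n i * W n i \<omega>)" for n \<omega>
    using X(1) Y(1) by (intro sum.mono_neutral_cong_left) (auto simp: u'_def)
  moreover have "(\<Sum>i\<in>J. w n i * W n i \<omega>) = (\<Sum>i\<in>I \<union> J. w' n i * W n i \<omega>)" for n \<omega>
    using X(1) Y(1) by (intro sum.mono_neutral_cong_left) (auto simp: w'_def)
  ultimately show ?thesis
    using X Y eventually_conj[OF X(5) Y(5)] by (intro that[of "I \<union> J" x y u' w' R S]) auto
qed

lemma asymp_linear_add:
  assumes "asymp_linear X" "asymp_linear Y"
  shows "asymp_linear (\<lambda>n \<omega>. X n \<omega> + Y n \<omega>)"
proof -
  obtain I x y u w R S where *: "finite I" "convergent x" "convergent y"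
    "\<And>i. convergent (\<lambda>n. u n i)" "\<And>i. convergent (\<lambda>n. w n i)" "moment_bounded M R" "moment_bounded M S"
    and eq: "\<forall>\<^sub>F n in sequentially. (\<forall>\<omega>. X n \<omega> = x n + (\<Sum>i\<in>I. u n i * W n i \<omega>) / sqrt (N n) + R n \<omega> / N n) \<and>
      (\<forall>\<omega>. Y n \<omega> = y n + (\<Sum>i\<in>I. w n i * W n i \<omega>) / sqrt (N n) + S n \<omega> / N n)"
    using assms by (rule common_fluctuations) blast
  show ?thesis
  proof (rule asymp_linearI)
    show "\<forall>\<^sub>F n in sequentially. \<forall>\<omega>. X n \<omega> + Y n \<omega> = (x n + y n)
        + (\<Sum>i\<in>I. (u n i + w n i) * W n i \<omega>) / sqrt (N n) + (R n \<omega> + S n \<omega>) / N n"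
      using eq by eventually_elim (simp add: distrib_right sum.distrib add_divide_distrib)
  qed (use * in \<open>auto intro!: convergent_add moment_bounded_add\<close>)
qed

text \<open>The product rule: the linear parts combine as for derivatives, and every other term of the product carries a
  factor \<open>1 / N\<close>.\<close>

lemma asymp_linear_mult:
  assumes "asymp_linear X" "asymp_linear Y"
  shows "asymp_linear (\<lambda>n \<omega>. X n \<omega> * Y n \<omega>)"
proof -
  obtain I x y u w R S where *: "finite I" "convergent x" "convergent y"
    "\<And>i. convergent (\<lambda>n. u n i)" "\<And>i. convergent (\<lambda>n. w n i)" "moment_bounded M R" "moment_bounded M S"
    and eq: "\<forall>\<^sub>F n in sequentially. (\<forall>\<omega>. X n \<omega> = x n + (\<Sum>i\<in>I. u n i * W n i \<omega>) / sqrt (N n) + R n \<omega> / N n) \<and>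
      (\<forall>\<omega>. Y n \<omega> = y n + (\<Sum>i\<in>I. w n i * W n i \<omega>) / sqrt (N n) + S n \<omega> / N n)"
    using assms by (rule common_fluctuations) blast
  define L where "L n \<omega> = (\<Sum>i\<in>I. u n i * W n i \<omega>)" for n \<omega>
  define K where "K n \<omega> = (\<Sum>i\<in>I. w n i * W n i \<omega>)" for n \<omega>
  define e where "e n = 1 / sqrt (N n)" for n
  have "e \<longlonglongrightarrow> 0" unfolding e_def
    by (intro tendsto_divide_0[OF tendsto_const] filterlim_at_top_imp_at_infinity
        filterlim_compose[OF sqrt_at_top N_top])
  then have ce: "convergent e" by (auto simp: convergent_def)
  have N_pos: "\<forall>\<^sub>F n in sequentially. N n > 0"
    using N_top by (simp add: filterlim_at_top_dense)
  note mb = moment_bounded_add moment_bounded_mult moment_bounded_deterministic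
    moment_bounded_sum[OF eventually_prob] W_moments
  have LK: "moment_bounded M L" "moment_bounded M K"
    unfolding L_def[abs_def] K_def[abs_def] by (intro mb *)+
  show ?thesis
  proof (rule asymp_linearI)
    show "moment_bounded M (\<lambda>n \<omega>. L n \<omega> * K n \<omega> + x n * S n \<omega> + y n * R n \<omega>
        + e n * (L n \<omega> * S n \<omega> + K n \<omega> * R n \<omega>) + (e n * e n) * (R n \<omega> * S n \<omega>))"
      by (intro mb LK ce * convergent_mult)
    show "\<forall>\<^sub>F n in sequentially. \<forall>\<omega>. X n \<omega> * Y n \<omega> = x n * y n
        + (\<Sum>i\<in>I. (x n * w n i + y n * u n i) * W n i \<omega>) / sqrt (N n)
        + (L n \<omega> * K n \<omega> + x n * S n \<omega> + y n * R n \<omega>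
        + e n * (L n \<omega> * S n \<omega> + K n \<omega> * R n \<omega>) + (e n * e n) * (R n \<omega> * S n \<omega>)) / N n"
      using eq N_pos
    proof eventually_elim
      case (elim n)
      have N: "1 / N n = e n * e n" using elim by (simp add: e_def)
      show ?case
      proof
        fix \<omega>
        have s: "(\<Sum>i\<in>I. (x n * w n i + y n * u n i) * W n i \<omega>) = x n * K n \<omega> + y n * L n \<omega>"
          by (simp add: K_def L_def sum_distrib_left sum.distrib distrib_right mult.assoc)
        have d: "a / N n = a * (e n * e n)" "a / sqrt (N n) = a * e n" for a
          using N by (simp_all add: e_def divide_inverse)
        have XY: "X n \<omega> = x n + L n \<omega> * e n + R n \<omega> * (e n * e n)"
          "Y n \<omega> = y n + K n \<omega> * e n + S n \<omega> * (e n * e n)"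
          using elim by (simp_all add: L_def K_def flip: d)
        show "X n \<omega> * Y n \<omega> = x n * y n
          + (\<Sum>i\<in>I. (x n * w n i + y n * u n i) * W n i \<omega>) / sqrt (N n)
          + (L n \<omega> * K n \<omega> + x n * S n \<omega> + y n * R n \<omega>
          + e n * (L n \<omega> * S n \<omega> + K n \<omega> * R n \<omega>) + (e n * e n) * (R n \<omega> * S n \<omega>)) / N n"
          unfolding s d XY by (simp add: algebra_simps)
      qed
    qed
  qed (use * in \<open>auto intro!: convergent_add convergent_mult\<close>)
qed

lemma asymp_linear_diff:
  assumes "asymp_linear X" "asymp_linear Y"
  shows "asymp_linear (\<lambda>n \<omega>. X n \<omega> - Y n \<omega>)"
  using asymp_linear_add[OF assms(1) asymp_linear_mult[OF asymp_linear_deterministic[of "\<lambda>_. - 1"] assms(2)]]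
  by (simp add: convergent_const)

lemma asymp_linear_sum:
  "(\<And>j. j \<in> J \<Longrightarrow> asymp_linear (X j)) \<Longrightarrow> asymp_linear (\<lambda>n \<omega>. \<Sum>j\<in>J. X j n \<omega>)"
  by (induction J rule: infinite_finite_induct)
    (auto intro: asymp_linear_add asymp_linear_deterministic simp: convergent_const)

text \<open>After centring by the expectation, only the linear part survives at scale \<open>1 / sqrt N\<close>; the constant cancels
  and the remainder is of size \<open>1 / sqrt N\<close> in \<open>L\<^sup>1\<close> after rescaling. The statistic \<open>Y\<close> may differ from
  the expanded one on null sets.\<close>

lemma asymp_linear_clt:
  assumes "asymp_linear X"
    and Y: "\<forall>\<^sub>F n in sequentially. Y n \<in> borel_measurable (M n) \<and> (AE \<omega> in M n. Y n \<omega> = X n \<omega>)"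
  shows "\<exists>v\<ge>0. weak_conv_m
    (\<lambda>n. distr (M n) borel (\<lambda>\<omega>. sqrt (N n) * (Y n \<omega> - (\<integral>\<omega>. Y n \<omega> \<partial>M n)))) (normal_law 0 v)"
proof -
  obtain I x u R where I: "finite I" and x: "convergent x" and u: "\<And>i. convergent (\<lambda>n. u n i)"
    and R: "moment_bounded M R"
    and eq: "\<forall>\<^sub>F n in sequentially. \<forall>\<omega>. X n \<omega> = x n + (\<Sum>i\<in>I. u n i * W n i \<omega>) / sqrt (N n) + R n \<omega> / N n"
    using assms(1) unfolding asymp_linear_def by blast
  define u0 where "u0 i = lim (\<lambda>n. u n i)" for i
  have u0: "(\<lambda>n. u n i) \<longlonglongrightarrow> u0 i" for i using u unfolding u0_def by (simp add: convergent_LIMSEQ_iff)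
  define V where "V = (\<Sum>i\<in>I. v i * (u0 i)\<^sup>2)"
  have "V \<ge> 0" unfolding V_def by (intro sum_nonneg mult_nonneg_nonneg v_nonneg) auto
  define Z where "Z n \<omega> = (\<Sum>i\<in>I. u n i * W n i \<omega>)" for n \<omega>
  define T where "T n \<omega> = (R n \<omega> - (\<integral>\<omega>. R n \<omega> \<partial>M n)) / sqrt (N n)" for n \<omega>
  define F where "F n \<omega> = sqrt (N n) * (Y n \<omega> - (\<integral>\<omega>. Y n \<omega> \<partial>M n))" for n \<omega>
  have N_pos: "\<forall>\<^sub>F n in sequentially. N n > 0"
    using N_top by (simp add: filterlim_at_top_dense)
  obtain C where C: "\<forall>\<^sub>F n in sequentially. R n \<in> borel_measurable (M n) \<and>
    integrable (M n) (R n) \<and> (\<integral>\<omega>. \<bar>R n \<omega>\<bar> \<partial>M n) \<le> C"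
    using eventually_prob R by (rule moment_bounded_integrable)
  have W: "\<forall>\<^sub>F n in sequentially. \<forall>i\<in>I. W n i \<in> borel_measurable (M n) \<and>
     integrable (M n) (W n i) \<and> (\<integral>\<omega>. W n i \<omega> \<partial>M n) = 0"
  proof (intro eventually_ball_finite I ballI)
    fix i
    obtain C where "\<forall>\<^sub>F n in sequentially. W n i \<in> borel_measurable (M n) \<and>
      integrable (M n) (W n i) \<and> (\<integral>\<omega>. \<bar>W n i \<omega>\<bar> \<partial>M n) \<le> C"
      using eventually_prob W_moments by (rule moment_bounded_integrable)
    then show "\<forall>\<^sub>F n in sequentially. W n i \<in> borel_measurable (M n) \<and>
       integrable (M n) (W n i) \<and> (\<integral>\<omega>. W n i \<omega> \<partial>M n) = 0"
      using W_centered[of i] by eventually_elim simp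
  qed
  have F: "\<forall>\<^sub>F n in sequentially. F n \<in> borel_measurable (M n) \<and> Z n \<in> borel_measurable (M n) \<and>
     integrable (M n) (T n) \<and> (\<integral>\<omega>. \<bar>T n \<omega>\<bar> \<partial>M n) \<le> 2 * C / sqrt (N n) \<and>
     distr (M n) borel (F n) = distr (M n) borel (\<lambda>\<omega>. Z n \<omega> + T n \<omega>)"
    using eventually_prob N_pos C W eq Y
  proof eventually_elim
    case (elim n)
    interpret prob_space "M n" by fact
    define r where "r = expectation (R n)"
    have [measurable]: "Y n \<in> borel_measurable (M n)" "R n \<in> borel_measurable (M n)"
      "\<And>i. i \<in> I \<Longrightarrow> W n i \<in> borel_measurable (M n)" using elim by auto
    have intR: "integrable (M n) (R n)" using elim by simp
    have intT: "integrable (M n) (T n)" unfolding T_def[abs_def] using intR by simp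
    have intZ: "integrable (M n) (Z n)" unfolding Z_def[abs_def] using elim by auto
    have Z0: "expectation (Z n) = 0" unfolding Z_def[abs_def]
      using elim by (subst Bochner_Integration.integral_sum) auto
    have X: "X n = (\<lambda>\<omega>. x n + Z n \<omega> / sqrt (N n) + R n \<omega> / N n)"
      using elim by (auto simp: Z_def)
    have Xm [measurable]: "X n \<in> borel_measurable (M n)"
      unfolding X using intZ intR by measurable
    have "expectation (Y n) = expectation (X n)"
      using elim by (intro integral_cong_AE) auto
    also have "\<dots> = x n + r / N n"
      unfolding X r_def using intZ intR Z0 by (simp add: prob_space)
    finally have EY: "expectation (Y n) = x n + r / N n" .
    have "sqrt (N n) * (X n \<omega> - (x n + r / N n)) = Z n \<omega> + T n \<omega>" for \<omega>
    proof -
      have "sqrt (N n) * (X n \<omega> - (x n + r / N n))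
          = sqrt (N n) * (Z n \<omega> / sqrt (N n)) + sqrt (N n) * ((R n \<omega> - r) / N n)"
        by (simp add: X algebra_simps diff_divide_distrib)
      also have "sqrt (N n) * ((R n \<omega> - r) / N n) = T n \<omega>"
        unfolding T_def r_def[symmetric] using elim by (simp add: real_div_sqrt field_simps)
      finally show ?thesis using elim by simp
    qed
    then have "AE \<omega> in M n. F n \<omega> = Z n \<omega> + T n \<omega>"
      using elim by (auto simp: F_def EY elim!: eventually_mono)
    moreover have Fm: "F n \<in> borel_measurable (M n)" unfolding F_def[abs_def] by simp
    ultimately have "distr (M n) borel (F n) = distr (M n) borel (\<lambda>\<omega>. Z n \<omega> + T n \<omega>)"
      using intZ intT by (intro distr_cong_AE) auto
    moreover have "expectation (\<lambda>\<omega>. \<bar>T n \<omega>\<bar>) \<le> 2 * C / sqrt (N n)"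
    proof -
      have "\<bar>r\<bar> \<le> C" unfolding r_def using integral_abs_bound[of "M n" "R n"] elim by linarith
      have "expectation (\<lambda>\<omega>. \<bar>T n \<omega>\<bar>) \<le> expectation (\<lambda>\<omega>. (\<bar>R n \<omega>\<bar> + \<bar>r\<bar>) / sqrt (N n))"
        using intR intT elim by (intro integral_mono)
          (auto simp: T_def r_def[symmetric] abs_divide divide_right_mono abs_triangle_ineq4)
      also have "\<dots> = (expectation (\<lambda>\<omega>. \<bar>R n \<omega>\<bar>) + \<bar>r\<bar>) / sqrt (N n)"
        using intR by (simp add: prob_space)
      also have "\<dots> \<le> (C + C) / sqrt (N n)"
        using elim \<open>\<bar>r\<bar> \<le> C\<close> by (intro divide_right_mono add_mono) auto
      finally show ?thesis by simp
    qed
    ultimately show ?case using Fm intZ intT by auto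
  qed
  have char_Z: "(\<lambda>n. char (distr (M n) borel (Z n)) t) \<longlonglongrightarrow> complex_of_real (exp (- V * t\<^sup>2 / 2))" for t
  proof -
    have "(\<lambda>n. \<Prod>i\<in>I. char (distr (M n) borel (W n i)) (t * u n i))
        \<longlonglongrightarrow> (\<Prod>i\<in>I. complex_of_real (exp (- v i * (t * u0 i)\<^sup>2 / 2)))"
      by (intro tendsto_prod W_char tendsto_mult tendsto_const u0)
    also have "(\<Prod>i\<in>I. complex_of_real (exp (- v i * (t * u0 i)\<^sup>2 / 2))) = complex_of_real (exp (- V * t\<^sup>2 / 2))"
    proof -
      have "(\<Sum>i\<in>I. - v i * (t * u0 i)\<^sup>2 / 2) = (\<Sum>i\<in>I. (v i * (u0 i)\<^sup>2) * (- (t\<^sup>2 / 2)))"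
        by (intro sum.cong) (auto simp: power_mult_distrib)
      also have "\<dots> = V * (- (t\<^sup>2 / 2))" unfolding V_def by (rule sum_distrib_right[symmetric])
      finally have "- V * t\<^sup>2 / 2 = (\<Sum>i\<in>I. - v i * (t * u0 i)\<^sup>2 / 2)" by simp
      then show ?thesis by (simp add: exp_sum[OF I])
    qed
    finally have lim: "(\<lambda>n. \<Prod>i\<in>I. char (distr (M n) borel (W n i)) (t * u n i))
        \<longlonglongrightarrow> complex_of_real (exp (- V * t\<^sup>2 / 2))" .
    have ev: "\<forall>\<^sub>F n in sequentially. (\<Prod>i\<in>I. char (distr (M n) borel (W n i)) (t * u n i)) = char (distr (M n) borel (Z n)) t"
      using eventually_prob W W_indep[OF I]
    proof eventually_elim
      case (elim n)
      interpret prob_space "M n" by fact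
      have "indep_vars (\<lambda>_. borel) (\<lambda>i \<omega>. u n i * W n i \<omega>) I"
      proof (rule indep_vars_compose2[where X = "W n" and Y = "\<lambda>i x. u n i * x" and M' = "\<lambda>_. borel"])
        show "indep_vars (\<lambda>_. borel) (W n) I" by fact
      qed simp
      then have "char (distr (M n) borel (Z n)) t = (\<Prod>i\<in>I. char (distr (M n) borel (\<lambda>\<omega>. u n i * W n i \<omega>)) t)"
        unfolding Z_def[abs_def] by (rule char_distr_sum)
      also have "\<dots> = (\<Prod>i\<in>I. char (distr (M n) borel (W n i)) (t * u n i))"
      proof (intro prod.cong refl)
        fix i assume "i \<in> I"
        then have [measurable]: "W n i \<in> borel_measurable (M n)" using elim by simp
        show "char (distr (M n) borel (\<lambda>\<omega>. u n i * W n i \<omega>)) t = char (distr (M n) borel (W n i)) (t * u n i)"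
          unfolding char_def by (simp add: integral_distr mult.assoc)
      qed
      finally show ?case by simp
    qed
    from lim show ?thesis by (rule Lim_transform_eventually) (rule ev)
  qed
  have "weak_conv_m (\<lambda>n. distr (M n) borel (F n)) (normal_law 0 V)"
  proof (rule weak_conv_normal_law[OF \<open>V \<ge> 0\<close>])
    show "\<forall>\<^sub>F n in sequentially. prob_space (M n) \<and> F n \<in> borel_measurable (M n)"
      using eventually_prob F by eventually_elim simp
    fix t
    have "\<forall>\<^sub>F n in sequentially. norm (char (distr (M n) borel (F n)) t - char (distr (M n) borel (Z n)) t)
        \<le> \<bar>t\<bar> * (2 * C / sqrt (N n))"
      using eventually_prob F
    proof eventually_elim
      case (elim n)
      interpret prob_space "M n" by fact
      have "norm (char (distr (M n) borel (\<lambda>\<omega>. Z n \<omega> + T n \<omega>)) t - char (distr (M n) borel (Z n)) t)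
          \<le> \<bar>t\<bar> * expectation (\<lambda>\<omega>. \<bar>T n \<omega>\<bar>)"
        using elim by (intro char_perturbation) auto
      also have "\<dots> \<le> \<bar>t\<bar> * (2 * C / sqrt (N n))" using elim by (intro mult_left_mono) auto
      finally show ?case using elim by simp
    qed
    moreover have "(\<lambda>n. \<bar>t\<bar> * (2 * C / sqrt (N n))) \<longlonglongrightarrow> 0"
      by (intro tendsto_mult_right_zero tendsto_divide_0[OF tendsto_const]
          filterlim_at_top_imp_at_infinity filterlim_compose[OF sqrt_at_top N_top])
    ultimately have "(\<lambda>n. char (distr (M n) borel (F n)) t - char (distr (M n) borel (Z n)) t) \<longlonglongrightarrow> 0"
      by (rule Lim_null_comparison)
    from tendsto_add[OF this char_Z[of t]]
    show "(\<lambda>n. char (distr (M n) borel (F n)) t) \<longlonglongrightarrow> complex_of_real (exp (- V * t\<^sup>2 / 2))"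
      by simp
  qed
  then show ?thesis using \<open>V \<ge> 0\<close> unfolding F_def[abs_def] by blast
qed

end

lemma (in fluctuation_array) asymp_linear_jacobi_walk:
  assumes "\<And>k. asymp_linear (\<lambda>n \<omega>. a n \<omega> (Suc k))" "\<And>k. asymp_linear (\<lambda>n \<omega>. q n \<omega> (Suc k))"
  shows "asymp_linear (\<lambda>n \<omega>. jacobi_walk (a n \<omega>) (q n \<omega>) m i)"
proof (induction m arbitrary: i)
  case 0
  then show ?case by (cases "i = 0") (auto intro: asymp_linear_deterministic simp: convergent_const)
next
  case (Suc m)
  have "asymp_linear (\<lambda>n \<omega>. if i = 0 then 0 else jacobi_walk (a n \<omega>) (q n \<omega>) m (i - 1))"
    using Suc by (cases "i = 0") (auto intro: asymp_linear_deterministic simp: convergent_const)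
  then show ?case unfolding jacobi_walk.simps
    by (intro asymp_linear_add asymp_linear_mult Suc assms)
qed

section \<open>The Jacobi ensemble\<close>

text \<open>Needed to number the noise variables from \<open>0\<close>, while those of the model are numbered from \<open>1\<close>.\<close>

lemma (in prob_space) indep_vars_reindex:
  assumes inj: "inj_on h I" and indep: "indep_vars M' X (h ` I)"
  shows "indep_vars (\<lambda>i. M' (h i)) (\<lambda>i. X (h i)) I"
  unfolding indep_vars_def2 indep_sets_def
proof (intro conjI ballI allI impI)
  show "random_variable (M' (h i)) (X (h i))" if "i \<in> I" for i
    using indep that by (auto simp: indep_vars_def2)
  show "{X (h i) -` A \<inter> space M |A. A \<in> sets (M' (h i))} \<subseteq> events" if "i \<in> I" for i
    using indep that by (force simp: indep_vars_def2 indep_sets_def)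
  fix J A
  assume J: "J \<subseteq> I" "J \<noteq> {}" "finite J"
    and A: "A \<in> (\<Pi> i\<in>J. {X (h i) -` A \<inter> space M |A. A \<in> sets (M' (h i))})"
  have inj': "inj_on h J" using inj J by (auto intro: inj_on_subset)
  define A' where "A' k = A (the_inv_into J h k)" for k
  have A': "A' (h i) = A i" if "i \<in> J" for i
    using that inj' by (simp add: A'_def the_inv_into_f_f)
  have "indep_sets (\<lambda>k. {X k -` A \<inter> space M |A. A \<in> sets (M' k)}) (h ` I)"
    using indep by (simp add: indep_vars_def2)
  then have "prob (\<Inter>k\<in>h ` J. A' k) = (\<Prod>k\<in>h ` J. prob (A' k))"
    using J A by (intro indep_setsD) (auto simp: A')
  then show "prob (\<Inter>i\<in>J. A i) = (\<Prod>i\<in>J. prob (A i))"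
    by (simp add: prod.reindex[OF inj'] A' cong: INF_cong_simp)
qed

locale beta_jacobi_limit =
  fixes \<beta> p1 p2 :: "nat \<Rightarrow> real"
    and \<gamma> \<sigma> :: real
    and M :: "nat \<Rightarrow> 'a measure"
    and c s :: "nat \<Rightarrow> nat \<Rightarrow> 'a \<Rightarrow> real"
  assumes \<beta>_pos: "\<And>n. n \<ge> 1 \<Longrightarrow> \<beta> n > 0"
    and p1_ge: "\<And>n. n \<ge> 1 \<Longrightarrow> p1 n \<ge> real n"
    and p2_ge: "\<And>n. n \<ge> 1 \<Longrightarrow> p2 n \<ge> real n"
    and model: "\<And>n. n \<ge> 1 \<Longrightarrow> beta_jacobi_model n (\<beta> n) (p1 n) (p2 n) (M n) (c n) (s n)"
    and \<sigma>_nonneg: "0 \<le> \<sigma>"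
    and \<gamma>_lim: "(\<lambda>n. real n / p1 n) \<longlonglongrightarrow> \<gamma>"
    and \<sigma>_lim: "(\<lambda>n. p1 n / p2 n) \<longlonglongrightarrow> \<sigma>"
    and \<beta>n_top: "filterlim (\<lambda>n. \<beta> n * real n) at_top sequentially"
begin

text \<open>The limit of \<open>r\<close>, the proportion of \<open>p\<^sub>1\<close> in \<open>p\<^sub>1 + p\<^sub>2\<close>.\<close>

definition "\<rho> = \<sigma> / (1 + \<sigma>)"
definition "P n = p1 n + p2 n"
definition "N n = \<beta> n / 2 * real n"
definition "g n = sqrt (real n / p1 n)"
definition "r n = p1 n / P n"

lemma pos: "n \<ge> 1 \<Longrightarrow> p1 n > 0" "n \<ge> 1 \<Longrightarrow> p2 n > 0" "n \<ge> 1 \<Longrightarrow> P n > 0" "n \<ge> 1 \<Longrightarrow> N n > 0"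
  using p1_ge[of n] p2_ge[of n] \<beta>_pos[of n] by (auto simp: P_def N_def)

lemma N_top: "filterlim N at_top sequentially"
proof -
  have "filterlim (\<lambda>n. (1 / 2) * (\<beta> n * real n)) at_top sequentially"
    by (rule filterlim_tendsto_pos_mult_at_top[OF tendsto_const _ \<beta>n_top]) simp
  then show ?thesis by (simp add: N_def[abs_def])
qed

lemma inverse_N_lim: "(\<lambda>n. 1 / N n) \<longlonglongrightarrow> 0"
  by (intro tendsto_divide_0[OF tendsto_const] filterlim_at_top_imp_at_infinity N_top)

lemma inverse_sqrt_N_lim: "(\<lambda>n. 1 / sqrt (N n)) \<longlonglongrightarrow> 0"
  by (intro tendsto_divide_0[OF tendsto_const] filterlim_at_top_imp_at_infinity
      filterlim_compose[OF sqrt_at_top N_top])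

lemma g_lim: "g \<longlonglongrightarrow> sqrt \<gamma>"
  unfolding g_def[abs_def] by (intro tendsto_intros \<gamma>_lim)

lemma r_lim: "r \<longlonglongrightarrow> \<rho>"
proof -
  have "(\<lambda>n. (p1 n / p2 n) / (1 + p1 n / p2 n)) \<longlonglongrightarrow> \<rho>"
    unfolding \<rho>_def using \<sigma>_nonneg by (intro tendsto_intros \<sigma>_lim) auto
  then show ?thesis
  proof (rule Lim_transform_eventually)
    show "\<forall>\<^sub>F n in sequentially. p1 n / p2 n / (1 + p1 n / p2 n) = r n"
      using eventually_ge_at_top[of 1]
    proof eventually_elim
      case (elim n)
      show ?case using pos[OF elim] by (simp add: r_def P_def field_simps)
    qed
  qed
qed

lemma p2_lim: "(\<lambda>n. p2 n / P n) \<longlonglongrightarrow> 1 - \<rho>"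
proof -
  have "(\<lambda>n. 1 - r n) \<longlonglongrightarrow> 1 - \<rho>" by (intro tendsto_intros r_lim)
  then show ?thesis
  proof (rule Lim_transform_eventually)
    show "\<forall>\<^sub>F n in sequentially. 1 - r n = p2 n / P n"
      using eventually_ge_at_top[of 1]
    proof eventually_elim
      case (elim n)
      show ?case using pos[OF elim] by (simp add: r_def P_def diff_divide_eq_iff)
    qed
  qed
qed

lemma over_n_lim: "(\<lambda>n. x / real n) \<longlonglongrightarrow> 0"
  by (intro tendsto_divide_0[OF tendsto_const] filterlim_at_top_imp_at_infinity filterlim_real_sequentially)

lemma over_p1_lim: "(\<lambda>n. x / p1 n) \<longlonglongrightarrow> 0"
proof -
  have "(\<lambda>n. x / real n * (real n / p1 n)) \<longlonglongrightarrow> 0 * \<gamma>" by (intro tendsto_mult over_n_lim \<gamma>_lim)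
  then have "(\<lambda>n. x / real n * (real n / p1 n)) \<longlonglongrightarrow> 0" by simp
  then show ?thesis
    by (rule Lim_transform_eventually) (auto simp: eventually_sequentially intro!: exI[of _ 1])
qed

lemma over_P_lim: "(\<lambda>n. x / P n) \<longlonglongrightarrow> 0"
proof -
  have "(\<lambda>n. x / p1 n * r n) \<longlonglongrightarrow> 0 * \<rho>" by (intro tendsto_mult over_p1_lim r_lim)
  then have "(\<lambda>n. x / p1 n * r n) \<longlonglongrightarrow> 0" by simp
  then show ?thesis
  proof (rule Lim_transform_eventually)
    show "\<forall>\<^sub>F n in sequentially. x / p1 n * r n = x / P n"
      using eventually_ge_at_top[of 1]
    proof eventually_elim
      case (elim n)
      show ?case using pos[OF elim] by (simp add: r_def)
    qed
  qed
qed

lemma n_over_P_lim: "(\<lambda>n. real n / P n) \<longlonglongrightarrow> \<gamma> * \<rho>"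
proof -
  have "(\<lambda>n. real n / p1 n * r n) \<longlonglongrightarrow> \<gamma> * \<rho>" by (intro tendsto_mult \<gamma>_lim r_lim)
  then show ?thesis
  proof (rule Lim_transform_eventually)
    show "\<forall>\<^sub>F n in sequentially. real n / p1 n * r n = real n / P n"
      using eventually_ge_at_top[of 1]
    proof eventually_elim
      case (elim n)
      show ?case using pos[OF elim] by (simp add: r_def)
    qed
  qed
qed

lemma eventually_prob_space: "\<forall>\<^sub>F n in sequentially. prob_space (M n)"
  using eventually_ge_at_top[of 1]
  by eventually_elim (use model in \<open>auto simp: beta_jacobi_model_def\<close>)

text \<open>Since \<open>p\<^sub>1\<close> and \<open>p\<^sub>2\<close> are at least \<open>n\<close>, a lower bound for the parameters of all Beta variables of
  fixed index; above \<open>1\<close> the densities are continuous and the Stein identity applies.\<close>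

lemma eventually_N_large: "\<forall>\<^sub>F n in sequentially. \<beta> n / 2 * (real n - x) > 1"
proof -
  have "filterlim (\<lambda>n. (1 - x / real n) * N n) at_top sequentially"
    by (rule filterlim_tendsto_pos_mult_at_top[OF tendsto_diff[OF tendsto_const over_n_lim] _ N_top]) simp
  then have "\<forall>\<^sub>F n in sequentially. (1 - x / real n) * N n > 1"
    by (simp add: filterlim_at_top_dense)
  then show ?thesis using eventually_ge_at_top[of 1]
  proof eventually_elim
    case (elim n)
    have "(1 - x / real n) * N n = \<beta> n / 2 * (real n - x)"
      using elim by (simp add: N_def field_simps)
    then show ?case using elim(1) by (simp only:)
  qed
qed

text \<open>The parameters of the Beta variables of index \<open>Suc j\<close>, and the factors by which the centred variables are
  multiplied to give fluctuations of order \<open>1\<close>. The factors are \<open>sqrt N\<close> times the coefficients of \<open>c\<close>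
  and \<open>s\<close> in \<open>c_scaled\<close> and \<open>s_scaled\<close> below.\<close>

definition "c_par1 n j = \<beta> n / 2 * (p1 n - real (Suc j) + 1)"
definition "c_par2 n j = \<beta> n / 2 * (p2 n - real (Suc j) + 1)"
definition "s_par1 n j = \<beta> n / 2 * (real n - real (Suc j))"
definition "s_par2 n j = \<beta> n / 2 * (p1 n + p2 n - real n - real (Suc j) + 1)"
definition "c_scale n = sqrt (\<beta> n / 2) * P n / sqrt (p1 n)"
definition "s_scale n = sqrt (N n) * P n / real n"

fun W :: "nat \<Rightarrow> nat + nat \<Rightarrow> 'a \<Rightarrow> real" where
  "W n (Inl j) \<omega> = c_scale n * (c n (Suc j) \<omega> - c_par1 n j / (c_par1 n j + c_par2 n j))"
| "W n (Inr j) \<omega> = s_scale n * (s n (Suc j) \<omega> - s_par1 n j / (s_par1 n j + s_par2 n j))"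

lemma P_factor: "\<forall>\<^sub>F n in sequentially. 1 - x / P n > 0"
proof -
  have "(\<lambda>n. 1 - x / P n) \<longlonglongrightarrow> 1 - 0" by (intro tendsto_intros over_P_lim)
  then show ?thesis by (rule order_tendstoD) simp
qed

text \<open>Written in terms of ratios that converge, the variance parameter is
  \<open>(1 - j/p\<^sub>1) (p\<^sub>2/P - j/P) / (1 - 2j/P)^3\<close>, which tends to \<open>1 - \<rho>\<close>; the other two Stein coefficients contain
  a factor \<open>1 / sqrt N\<close> or \<open>1 / N\<close>.\<close>

lemma pearson_array_c:
  "pearson_array M (\<lambda>n. W n (Inl j)) (\<lambda>n. (c_scale n)\<^sup>2 * c_par1 n j * c_par2 n j / (c_par1 n j + c_par2 n j) ^ 3)
    (\<lambda>n. c_scale n * (c_par2 n j - c_par1 n j) / (c_par1 n j + c_par2 n j)\<^sup>2) (\<lambda>n. 1 / (c_par1 n j + c_par2 n j)) (1 - \<rho>)"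
proof
  show "\<forall>\<^sub>F n in sequentially. pearson_variable (M n) (W n (Inl j)) ((c_scale n)\<^sup>2 * c_par1 n j * c_par2 n j / (c_par1 n j + c_par2 n j) ^ 3)
    (c_scale n * (c_par2 n j - c_par1 n j) / (c_par1 n j + c_par2 n j)\<^sup>2) (1 / (c_par1 n j + c_par2 n j))"
    using eventually_N_large[of "real j"] eventually_gt_at_top[of j]
  proof eventually_elim
    case (elim n)
    then have n: "n \<ge> 1" by simp
    have "\<beta> n / 2 * (real n - real j) \<le> c_par1 n j" "\<beta> n / 2 * (real n - real j) \<le> c_par2 n j"
      unfolding c_par1_def c_par2_def using \<beta>_pos[OF n] p1_ge[OF n] p2_ge[OF n] by (auto intro!: mult_left_mono)
    then have "c_par1 n j > 1" "c_par2 n j > 1" using elim by auto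
    moreover have "c_scale n > 0" unfolding c_scale_def using \<beta>_pos[OF n] pos[OF n] by simp
    moreover have "distributed (M n) lborel (c n (Suc j)) (\<lambda>x. ennreal (beta_density (c_par1 n j) (c_par2 n j) x))"
      using model[OF n] elim unfolding beta_jacobi_model_def c_par1_def c_par2_def by force
    moreover have "prob_space (M n)" using model[OF n] by (simp add: beta_jacobi_model_def)
    ultimately show ?case
      using beta_pearson_variable[of "M n" "c_par1 n j" "c_par2 n j" "c_scale n" "c n (Suc j)"] by (simp add: W.simps[abs_def])
  qed
  have forms: "\<forall>\<^sub>F n in sequentially. (c_scale n)\<^sup>2 * c_par1 n j * c_par2 n j / (c_par1 n j + c_par2 n j) ^ 3
      = (1 - real j / p1 n) * (p2 n / P n - real j / P n) / (1 - (2 * real j) / P n) ^ 3 \<and>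
    c_scale n * (c_par2 n j - c_par1 n j) / (c_par1 n j + c_par2 n j)\<^sup>2
      = g n * (1 / sqrt (N n)) * (p2 n / P n - r n) / (1 - (2 * real j) / P n)\<^sup>2 \<and>
    1 / (c_par1 n j + c_par2 n j) = 1 / N n * (real n / P n) / (1 - (2 * real j) / P n)"
    using P_factor[of "2 * real j"] eventually_ge_at_top[of 1]
  proof eventually_elim
    case (elim n)
    define b where "b = \<beta> n / 2"
    define D where "D = 1 - (2 * real j) / P n"
    define A where "A = 1 - real j / p1 n"
    define B where "B = p2 n / P n - real j / P n"
    define sn where "sn = sqrt (real n)"
    define rb where "rb = sqrt b"
    define sp where "sp = sqrt (p1 n)"
    have b: "b > 0" using \<beta>_pos elim by (simp add: b_def)
    note p = pos[OF elim(2)]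
    have nz: "D \<noteq> 0" "sn > 0" "rb > 0" "sp > 0" using elim b p by (auto simp: D_def sn_def rb_def sp_def)
    have sq: "b = rb\<^sup>2" "p1 n = sp\<^sup>2" "real n = sn\<^sup>2" using b p by (simp_all add: rb_def sp_def sn_def)
    have ca: "c_par1 n j = b * p1 n * A" using p by (simp add: c_par1_def b_def A_def field_simps)
    have cb: "c_par2 n j = b * P n * B" using p by (simp add: c_par2_def b_def B_def field_simps)
    have sum: "c_par1 n j + c_par2 n j = b * P n * D" using p by (simp add: c_par1_def c_par2_def b_def D_def P_def field_simps)
    have diff: "c_par2 n j - c_par1 n j = b * P n * (p2 n / P n - r n)"
      using p by (simp add: c_par1_def c_par2_def b_def r_def field_simps)
    have cl: "c_scale n = rb * P n / sp" by (simp add: c_scale_def b_def rb_def sp_def)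
    have N: "N n = b * real n" by (simp add: N_def b_def)
    have sN: "sqrt (N n) = rb * sn" by (simp add: N real_sqrt_mult rb_def sn_def)
    have g: "g n = sn / sp" by (simp add: g_def real_sqrt_divide sn_def sp_def)
    show ?case
      unfolding D_def[symmetric] A_def[symmetric] B_def[symmetric]
    proof (intro conjI)
      show "(c_scale n)\<^sup>2 * c_par1 n j * c_par2 n j / (c_par1 n j + c_par2 n j) ^ 3 = A * B / D ^ 3"
        unfolding sum unfolding ca cb cl sq(1,2) using nz p
        by (simp add: field_simps power2_eq_square power3_eq_cube)
      show "c_scale n * (c_par2 n j - c_par1 n j) / (c_par1 n j + c_par2 n j)\<^sup>2 = g n * (1 / sqrt (N n)) * (p2 n / P n - r n) / D\<^sup>2"
      proof -
        define E where "E = p2 n / P n - r n"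
        show ?thesis unfolding sum diff E_def[symmetric] unfolding cl sN g sq(1) using nz p
          by (simp add: field_simps power2_eq_square)
      qed
      show "1 / (c_par1 n j + c_par2 n j) = 1 / N n * (real n / P n) / D"
        unfolding sum N using nz p b elim by (simp add: field_simps)
    qed
  qed
  have "(\<lambda>n. (1 - real j / p1 n) * (p2 n / P n - real j / P n) / (1 - (2 * real j) / P n) ^ 3)
      \<longlonglongrightarrow> (1 - 0) * ((1 - \<rho>) - 0) / (1 - 0) ^ 3"
    by (intro tendsto_intros over_P_lim over_p1_lim p2_lim) simp
  then have "(\<lambda>n. (1 - real j / p1 n) * (p2 n / P n - real j / P n) / (1 - (2 * real j) / P n) ^ 3)
      \<longlonglongrightarrow> 1 - \<rho>" by simp
  then show "(\<lambda>n. (c_scale n)\<^sup>2 * c_par1 n j * c_par2 n j / (c_par1 n j + c_par2 n j) ^ 3) \<longlonglongrightarrow> 1 - \<rho>"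
    by (rule Lim_transform_eventually) (use forms in eventually_elim, simp)
  have "(\<lambda>n. g n * (1 / sqrt (N n)) * (p2 n / P n - r n) / (1 - (2 * real j) / P n)\<^sup>2)
      \<longlonglongrightarrow> sqrt \<gamma> * 0 * ((1 - \<rho>) - \<rho>) / (1 - 0)\<^sup>2"
    by (intro tendsto_intros over_P_lim p2_lim r_lim g_lim inverse_sqrt_N_lim) simp
  then have "(\<lambda>n. g n * (1 / sqrt (N n)) * (p2 n / P n - r n) / (1 - (2 * real j) / P n)\<^sup>2) \<longlonglongrightarrow> 0"
    by simp
  then show "(\<lambda>n. c_scale n * (c_par2 n j - c_par1 n j) / (c_par1 n j + c_par2 n j)\<^sup>2) \<longlonglongrightarrow> 0"
    by (rule Lim_transform_eventually) (use forms in eventually_elim, simp)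
  have "(\<lambda>n. 1 / N n * (real n / P n) / (1 - (2 * real j) / P n)) \<longlonglongrightarrow> 0 * (\<gamma> * \<rho>) / (1 - 0)"
    by (intro tendsto_intros over_P_lim n_over_P_lim inverse_N_lim) simp
  then have "(\<lambda>n. 1 / N n * (real n / P n) / (1 - (2 * real j) / P n)) \<longlonglongrightarrow> 0" by simp
  then show "(\<lambda>n. 1 / (c_par1 n j + c_par2 n j)) \<longlonglongrightarrow> 0"
    by (rule Lim_transform_eventually) (use forms in eventually_elim, simp)
qed

text \<open>The same computation for \<open>s\<close>. Here the variance parameter tends to \<open>1 - \<gamma> \<rho>\<close>, where \<open>\<gamma> \<rho>\<close> is the limit
  of \<open>n / P\<close>.\<close>

lemma pearson_array_s:
  "pearson_array M (\<lambda>n. W n (Inr j)) (\<lambda>n. (s_scale n)\<^sup>2 * s_par1 n j * s_par2 n j / (s_par1 n j + s_par2 n j) ^ 3)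
    (\<lambda>n. s_scale n * (s_par2 n j - s_par1 n j) / (s_par1 n j + s_par2 n j)\<^sup>2) (\<lambda>n. 1 / (s_par1 n j + s_par2 n j)) (1 - \<gamma> * \<rho>)"
proof
  show "\<forall>\<^sub>F n in sequentially. pearson_variable (M n) (W n (Inr j)) ((s_scale n)\<^sup>2 * s_par1 n j * s_par2 n j / (s_par1 n j + s_par2 n j) ^ 3)
    (s_scale n * (s_par2 n j - s_par1 n j) / (s_par1 n j + s_par2 n j)\<^sup>2) (1 / (s_par1 n j + s_par2 n j))"
    using eventually_N_large[of "real (Suc j)"] eventually_gt_at_top[of "Suc j"]
  proof eventually_elim
    case (elim n)
    then have n: "n \<ge> 1" by simp
    have "s_par1 n j > 1" using elim by (simp add: s_par1_def)
    have "\<beta> n / 2 * (real n - real (Suc j)) \<le> s_par2 n j"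
      unfolding s_par2_def using \<beta>_pos[OF n] p1_ge[OF n] p2_ge[OF n] by (intro mult_left_mono) auto
    then have "s_par2 n j > 1" using elim by auto
    moreover have "s_scale n > 0" unfolding s_scale_def using n pos[OF n] by simp
    moreover have "distributed (M n) lborel (s n (Suc j)) (\<lambda>x. ennreal (beta_density (s_par1 n j) (s_par2 n j) x))"
      using model[OF n] elim unfolding beta_jacobi_model_def s_par1_def s_par2_def by force
    moreover have "prob_space (M n)" using model[OF n] by (simp add: beta_jacobi_model_def)
    ultimately show ?case using \<open>s_par1 n j > 1\<close>
      using beta_pearson_variable[of "M n" "s_par1 n j" "s_par2 n j" "s_scale n" "s n (Suc j)"] by (simp add: W.simps[abs_def])
  qed
  define k where "k = 2 * real j + 1"
  have forms: "\<forall>\<^sub>F n in sequentially. (s_scale n)\<^sup>2 * s_par1 n j * s_par2 n j / (s_par1 n j + s_par2 n j) ^ 3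
      = (1 - real (Suc j) / real n) * (1 - real n / P n - real j / P n) / (1 - k / P n) ^ 3 \<and>
    s_scale n * (s_par2 n j - s_par1 n j) / (s_par1 n j + s_par2 n j)\<^sup>2
      = 1 / sqrt (N n) * (1 - 2 * (real n / P n) + 1 / P n) / (1 - k / P n)\<^sup>2 \<and>
    1 / (s_par1 n j + s_par2 n j) = 1 / N n * (real n / P n) / (1 - k / P n)"
    using P_factor[of k] eventually_ge_at_top[of 1]
  proof eventually_elim
    case (elim n)
    define b where "b = \<beta> n / 2"
    define D where "D = 1 - k / P n"
    define A where "A = 1 - real (Suc j) / real n"
    define B where "B = 1 - real n / P n - real j / P n"
    define E where "E = 1 - 2 * (real n / P n) + 1 / P n"
    define t where "t = sqrt (N n)"
    have b: "b > 0" using \<beta>_pos elim by (simp add: b_def)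
    note p = pos[OF elim(2)]
    have n: "real n > 0" using elim by simp
    have nz: "D \<noteq> 0" "t > 0" using elim b p by (auto simp: D_def t_def)
    have N: "N n = b * real n" by (simp add: N_def b_def)
    have tt: "t * t = b * real n" unfolding t_def using p N by simp
    have sa: "s_par1 n j = b * real n * A" using n by (simp add: s_par1_def b_def A_def field_simps)
    have "s_par2 n j = b * (P n - real n - real j)" by (simp add: s_par2_def b_def P_def)
    also have "\<dots> = b * P n * B" using p by (simp add: B_def field_simps)
    finally have sb: "s_par2 n j = b * P n * B" .
    have sa0: "s_par1 n j = b * (real n - real j - 1)" by (simp add: s_par1_def b_def)
    have sb0: "s_par2 n j = b * (P n - real n - real j)" by (simp add: s_par2_def b_def P_def)
    have "s_par1 n j + s_par2 n j = b * (P n - k)" unfolding sa0 sb0 k_def by (simp add: algebra_simps)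
    also have "\<dots> = b * P n * D" using p by (simp add: D_def field_simps)
    finally have sum: "s_par1 n j + s_par2 n j = b * P n * D" .
    have "s_par2 n j - s_par1 n j = b * (P n - 2 * real n + 1)" unfolding sa0 sb0 by (simp add: algebra_simps)
    also have "\<dots> = b * P n * E" using p by (simp add: E_def field_simps)
    finally have diff: "s_par2 n j - s_par1 n j = b * P n * E" .
    have sl: "s_scale n = t * P n / real n" by (simp add: s_scale_def t_def)
    have bt: "b = t * t / real n" using tt n by (simp add: field_simps)
    show ?case
      unfolding D_def[symmetric] A_def[symmetric] B_def[symmetric] E_def[symmetric] t_def[symmetric]
    proof (intro conjI)
      show "(s_scale n)\<^sup>2 * s_par1 n j * s_par2 n j / (s_par1 n j + s_par2 n j) ^ 3 = A * B / D ^ 3"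
        unfolding sum unfolding sa sb sl bt using nz p n
        by (simp add: field_simps power2_eq_square power3_eq_cube)
      show "s_scale n * (s_par2 n j - s_par1 n j) / (s_par1 n j + s_par2 n j)\<^sup>2 = 1 / t * E / D\<^sup>2"
        unfolding sum diff unfolding sl bt using nz p n
        by (simp add: field_simps power2_eq_square)
      show "1 / (s_par1 n j + s_par2 n j) = 1 / N n * (real n / P n) / D"
        unfolding sum N using nz p b n by (simp add: field_simps)
    qed
  qed
  have "(\<lambda>n. (1 - real (Suc j) / real n) * (1 - real n / P n - real j / P n) / (1 - k / P n) ^ 3)
      \<longlonglongrightarrow> (1 - 0) * (1 - \<gamma> * \<rho> - 0) / (1 - 0) ^ 3"
    by (intro tendsto_intros over_P_lim over_n_lim n_over_P_lim) simp
  then have "(\<lambda>n. (1 - real (Suc j) / real n) * (1 - real n / P n - real j / P n) / (1 - k / P n) ^ 3)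
      \<longlonglongrightarrow> 1 - \<gamma> * \<rho>" by simp
  then show "(\<lambda>n. (s_scale n)\<^sup>2 * s_par1 n j * s_par2 n j / (s_par1 n j + s_par2 n j) ^ 3) \<longlonglongrightarrow> 1 - \<gamma> * \<rho>"
    by (rule Lim_transform_eventually) (use forms in eventually_elim, simp)
  have "(\<lambda>n. 1 / sqrt (N n) * (1 - 2 * (real n / P n) + 1 / P n) / (1 - k / P n)\<^sup>2)
      \<longlonglongrightarrow> 0 * (1 - 2 * (\<gamma> * \<rho>) + 0) / (1 - 0)\<^sup>2"
    by (intro tendsto_intros over_P_lim n_over_P_lim inverse_sqrt_N_lim) simp
  then have "(\<lambda>n. 1 / sqrt (N n) * (1 - 2 * (real n / P n) + 1 / P n) / (1 - k / P n)\<^sup>2) \<longlonglongrightarrow> 0"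
    by simp
  then show "(\<lambda>n. s_scale n * (s_par2 n j - s_par1 n j) / (s_par1 n j + s_par2 n j)\<^sup>2) \<longlonglongrightarrow> 0"
    by (rule Lim_transform_eventually) (use forms in eventually_elim, simp)
  have "(\<lambda>n. 1 / N n * (real n / P n) / (1 - k / P n)) \<longlonglongrightarrow> 0 * (\<gamma> * \<rho>) / (1 - 0)"
    by (intro tendsto_intros over_P_lim n_over_P_lim inverse_N_lim) simp
  then have "(\<lambda>n. 1 / N n * (real n / P n) / (1 - k / P n)) \<longlonglongrightarrow> 0" by simp
  then show "(\<lambda>n. 1 / (s_par1 n j + s_par2 n j)) \<longlonglongrightarrow> 0"
    by (rule Lim_transform_eventually) (use forms in eventually_elim, simp)
qed

fun limit_variance :: "nat + nat \<Rightarrow> real" where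
  "limit_variance (Inl j) = 1 - \<rho>"
| "limit_variance (Inr j) = 1 - \<gamma> * \<rho>"

lemma pearson_array_W: "\<exists>\<kappa> \<theta> \<delta>. pearson_array M (\<lambda>n. W n i) \<kappa> \<theta> \<delta> (limit_variance i)"
proof (cases i)
  case (Inl j)
  show ?thesis unfolding Inl limit_variance.simps using pearson_array_c[of j] by blast
next
  case (Inr j)
  show ?thesis unfolding Inr limit_variance.simps using pearson_array_s[of j] by blast
qed

lemma W_indep:
  assumes "finite I"
  shows "\<forall>\<^sub>F n in sequentially. prob_space.indep_vars (M n) (\<lambda>_. borel) (W n) I"
proof -
  define h :: "nat + nat \<Rightarrow> nat + nat" where "h = map_sum Suc Suc"
  have inj: "inj h" unfolding h_def by (intro sum.inj_map) auto
  have "\<forall>\<^sub>F n in sequentially. h i \<in> {1..n} <+> {1..<n}" for i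
  proof (cases i)
    case (Inl j)
    show ?thesis
      using eventually_gt_at_top[of j] unfolding Inl h_def map_sum.simps
      by eventually_elim (rule InlI, simp)
  next
    case (Inr j)
    show ?thesis
      using eventually_gt_at_top[of "Suc j"] unfolding Inr h_def map_sum.simps
      by eventually_elim (rule InrI, simp)
  qed
  then have "\<forall>\<^sub>F n in sequentially. \<forall>i\<in>I. h i \<in> {1..n} <+> {1..<n}"
    using assms by (intro eventually_ball_finite) auto
  then show ?thesis using eventually_ge_at_top[of 1]
  proof eventually_elim
    case (elim n)
    interpret prob_space "M n" using model elim by (auto simp: beta_jacobi_model_def)
    have "indep_vars (\<lambda>_. borel) (case_sum (c n) (s n)) ({1..n} <+> {1..<n})"
      using model elim by (auto simp: beta_jacobi_model_def)
    then have "indep_vars (\<lambda>_. borel) (case_sum (c n) (s n)) (h ` I)"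
      by (rule indep_vars_subset) (use elim in auto)
    then have "indep_vars (\<lambda>_. borel) (\<lambda>i. case_sum (c n) (s n) (h i)) I"
      by (intro indep_vars_reindex[of h I "\<lambda>_. borel", OF inj_on_subset[OF inj]]) auto
    then have "indep_vars (\<lambda>_. borel) (\<lambda>i \<omega>. (case i of
        Inl j \<Rightarrow> \<lambda>x. c_scale n * (x - c_par1 n j / (c_par1 n j + c_par2 n j))
      | Inr j \<Rightarrow> \<lambda>x. s_scale n * (x - s_par1 n j / (s_par1 n j + s_par2 n j))) (case_sum (c n) (s n) (h i) \<omega>)) I"
      by (rule indep_vars_compose2) (auto split: sum.split)
    moreover have "(case i of Inl j \<Rightarrow> \<lambda>x. c_scale n * (x - c_par1 n j / (c_par1 n j + c_par2 n j))
      | Inr j \<Rightarrow> \<lambda>x. s_scale n * (x - s_par1 n j / (s_par1 n j + s_par2 n j))) (case_sum (c n) (s n) (h i) \<omega>) = W n i \<omega>" for i \<omega>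
      by (cases i) (auto simp: h_def)
    ultimately show ?case by simp
  qed
qed

sublocale fluctuation_array M W limit_variance N
proof
  fix i
  obtain \<kappa> \<theta> \<delta> where "pearson_array M (\<lambda>n. W n i) \<kappa> \<theta> \<delta> (limit_variance i)"
    using pearson_array_W by blast
  then interpret pearson_array M "\<lambda>n. W n i" \<kappa> \<theta> \<delta> "limit_variance i" .
  show "moment_bounded M (\<lambda>n. W n i)" by (rule moment_bounded)
  show "\<forall>\<^sub>F n in sequentially. (\<integral>\<omega>. W n i \<omega> \<partial>M n) = 0" by (rule eventually_centered)
  show "limit_variance i \<ge> 0" by (rule limit_nonneg)
  show "(\<lambda>n. char (distr (M n) borel (W n i)) (t n)) \<longlonglongrightarrow> complex_of_real (exp (- limit_variance i * t0\<^sup>2 / 2))"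
    if "t \<longlonglongrightarrow> t0" for t t0
    using that by (rule char_tendsto)
qed (use eventually_prob_space N_top W_indep in auto)

text \<open>The coordinates in which the model converges: \<open>c\<close> concentrates around \<open>r\<close> with deviations of order
  \<open>sqrt (n p\<^sub>1) / P\<close>, times the noise \<open>1 / sqrt N\<close>, while \<open>s\<close> is of order \<open>n / P\<close> and so has to be measured
  relative to its own size.\<close>

definition "c_scaled j n \<omega> = (P n * c n (Suc j) \<omega> - p1 n) / sqrt (real n * p1 n)"
definition "s_scaled j n \<omega> = P n * s n (Suc j) \<omega> / real n"

lemma convergent_deterministic:
  shows "convergent g" and "convergent r" and "convergent (\<lambda>n. x)"
  using g_lim r_lim by (auto simp: convergent_def)

lemma g_over_n:
  assumes "n \<ge> 1"
  shows "g n / real n = 1 / sqrt (real n * p1 n)"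
proof -
  define sn where "sn = sqrt (real n)"
  define sp where "sp = sqrt (p1 n)"
  have nz: "sn > 0" "sp > 0" using assms pos[OF assms] by (simp_all add: sn_def sp_def)
  have "g n / real n = sn / sp / (sn * sn)" by (simp add: g_def real_sqrt_divide sn_def sp_def)
  also have "\<dots> = 1 / (sn * sp)" using nz by simp
  finally show ?thesis by (simp add: real_sqrt_mult sn_def sp_def)
qed

lemma asymp_linear_c_scaled: "asymp_linear (c_scaled j)"
proof (rule asymp_linear_cong)
  define x where "x n = (P n * (c_par1 n j / (c_par1 n j + c_par2 n j)) - p1 n) / sqrt (real n * p1 n)" for n
  have "convergent x"
  proof -
    have "(\<lambda>n. real j / real n * g n * (r n - p2 n / P n) / (1 - 2 * real j / P n))
        \<longlonglongrightarrow> 0 * sqrt \<gamma> * (\<rho> - (1 - \<rho>)) / (1 - 0)"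
      by (intro tendsto_intros over_n_lim over_P_lim p2_lim r_lim g_lim) simp
    moreover have "\<forall>\<^sub>F n in sequentially.
        real j / real n * g n * (r n - p2 n / P n) / (1 - 2 * real j / P n) = x n"
      using P_factor[of "2 * real j"] eventually_ge_at_top[of 1]
    proof eventually_elim
      case (elim n)
      define D where "D = 1 - 2 * real j / P n"
      note p = pos[OF elim(2)]
      have b: "\<beta> n > 0" using \<beta>_pos elim by simp
      have nz: "D \<noteq> 0" using elim by (auto simp: D_def)
      have sum: "c_par1 n j + c_par2 n j = \<beta> n / 2 * (P n * D)"
        using p by (simp add: c_par1_def c_par2_def D_def P_def field_simps)
      have "c_par1 n j / (c_par1 n j + c_par2 n j) = (p1 n - real j) / (P n * D)"
        unfolding sum using b by (simp add: c_par1_def)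
      then have "P n * (c_par1 n j / (c_par1 n j + c_par2 n j)) - p1 n = (p1 n - real j) / D - p1 n"
        using p by simp
      also have "\<dots> = (p1 n - real j - p1 n * D) / D" using nz by (simp add: field_simps)
      also have "p1 n - real j - p1 n * D = real j * (r n - p2 n / P n)"
      proof -
        have "p2 n / P n = 1 - p1 n / P n" using p by (simp add: P_def field_simps)
        then show ?thesis unfolding D_def r_def by (simp only:) (simp add: algebra_simps)
      qed
      finally have num: "P n * (c_par1 n j / (c_par1 n j + c_par2 n j)) - p1 n = real j * (r n - p2 n / P n) / D" .
      have "real j / real n * g n * z / D = (real j * z / D) * (g n / real n)" for z
        by (simp add: mult_ac)
      then have "real j / real n * g n * (r n - p2 n / P n) / D
          = (real j * (r n - p2 n / P n) / D) * (1 / sqrt (real n * p1 n))"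
        by (simp only: g_over_n[OF elim(2)])
      then show ?case unfolding x_def num D_def[symmetric] by simp
    qed
    ultimately have "x \<longlonglongrightarrow> 0 * sqrt \<gamma> * (\<rho> - (1 - \<rho>)) / (1 - 0)" by (rule Lim_transform_eventually)
    then show ?thesis by (auto simp: convergent_def)
  qed
  then show "asymp_linear (\<lambda>n \<omega>. x n + W n (Inl j) \<omega> / sqrt (N n))"
    by (rule asymp_linear_fluctuation)
  show "\<forall>\<^sub>F n in sequentially. \<forall>\<omega>. c_scaled j n \<omega> = x n + W n (Inl j) \<omega> / sqrt (N n)"
    using eventually_ge_at_top[of 1]
  proof eventually_elim
    case (elim n)
    note p = pos[OF elim]
    have "\<beta> n / 2 > 0" "real n > 0" using \<beta>_pos elim by simp_all
    then have "c_scale n / sqrt (N n) = P n / sqrt (real n * p1 n)"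
      unfolding c_scale_def N_def real_sqrt_mult by simp
    then have W: "W n (Inl j) \<omega> / sqrt (N n)
        = P n / sqrt (real n * p1 n) * (c n (Suc j) \<omega> - c_par1 n j / (c_par1 n j + c_par2 n j))" for \<omega>
      by (simp add: W.simps flip: times_divide_eq_left)
    show ?case unfolding W unfolding c_scaled_def x_def
      by (simp add: diff_divide_distrib right_diff_distrib)
  qed
qed

lemma asymp_linear_s_scaled: "asymp_linear (s_scaled j)"
proof (rule asymp_linear_cong)
  define x where "x n = P n / real n * (s_par1 n j / (s_par1 n j + s_par2 n j))" for n
  define k where "k = 2 * real j + 1"
  have "convergent x"
  proof -
    have "(\<lambda>n. (1 - real (Suc j) / real n) / (1 - k / P n)) \<longlonglongrightarrow> (1 - 0) / (1 - 0)"
      by (intro tendsto_intros over_n_lim over_P_lim) simp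
    moreover have "\<forall>\<^sub>F n in sequentially. (1 - real (Suc j) / real n) / (1 - k / P n) = x n"
      using P_factor[of k] eventually_ge_at_top[of 1]
    proof eventually_elim
      case (elim n)
      define D where "D = 1 - k / P n"
      note p = pos[OF elim(2)]
      have b: "\<beta> n > 0" using \<beta>_pos elim by simp
      have nz: "D \<noteq> 0" "real n > 0" using elim by (auto simp: D_def)
      have "s_par1 n j + s_par2 n j = \<beta> n / 2 * (P n - k)"
        by (simp add: s_par1_def s_par2_def P_def k_def field_simps)
      also have "\<dots> = \<beta> n / 2 * (P n * D)" using p by (simp add: D_def field_simps)
      finally have sum: "s_par1 n j + s_par2 n j = \<beta> n / 2 * (P n * D)" .
      have "s_par1 n j / (s_par1 n j + s_par2 n j) = (real n - real (Suc j)) / (P n * D)"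
        unfolding sum using b by (simp add: s_par1_def)
      then have "x n = ((real n - real (Suc j)) / real n) / D" using p by (simp add: x_def)
      then show ?case unfolding D_def[symmetric] using nz by (simp add: diff_divide_distrib)
    qed
    ultimately have "x \<longlonglongrightarrow> (1 - 0) / (1 - 0)" by (rule Lim_transform_eventually)
    then show ?thesis by (auto simp: convergent_def)
  qed
  then show "asymp_linear (\<lambda>n \<omega>. x n + W n (Inr j) \<omega> / sqrt (N n))"
    by (rule asymp_linear_fluctuation)
  show "\<forall>\<^sub>F n in sequentially. \<forall>\<omega>. s_scaled j n \<omega> = x n + W n (Inr j) \<omega> / sqrt (N n)"
    using eventually_ge_at_top[of 1]
  proof eventually_elim
    case (elim n)
    have "s_scale n / sqrt (N n) = P n / real n" using pos[OF elim] by (simp add: s_scale_def)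
    then have W: "W n (Inr j) \<omega> / sqrt (N n)
        = P n / real n * (s n (Suc j) \<omega> - s_par1 n j / (s_par1 n j + s_par2 n j))" for \<omega>
      by (simp add: W.simps flip: times_divide_eq_left)
    show ?case unfolding W unfolding s_scaled_def x_def by (simp add: right_diff_distrib)
  qed
qed

text \<open>The entries of the rescaled matrix. The radicand of the squared off-diagonal entry is used
  without the square root; it is nonnegative almost surely.\<close>

definition "diag n \<omega> k =
  (P n * model_diag (\<lambda>k. c n k \<omega>) (\<lambda>k. s n k \<omega>) k - p1 n) / sqrt (real n * p1 n)"

definition "offdiag_sq n \<omega> k = (P n)\<^sup>2 / (real n * p1 n) *
  (c n k \<omega> * (1 - c n k \<omega>) * s n k \<omega> * (1 - s n (k - 1) \<omega>))"

lemma c_s_zero: "n \<ge> 1 \<Longrightarrow> c n 0 \<omega> = 0" "n \<ge> 1 \<Longrightarrow> s n 0 \<omega> = 0"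
  using model[of n] by (auto simp: beta_jacobi_model_def)

lemma c_eq: "n \<ge> 1 \<Longrightarrow> c n (Suc j) \<omega> = r n + g n * r n * c_scaled j n \<omega>"
proof -
  assume n: "n \<ge> 1"
  note p = pos[OF n]
  have "g n / sqrt (real n * p1 n) = 1 / p1 n"
    using p n by (simp add: g_def real_sqrt_divide real_sqrt_mult)
  moreover have "g n * r n * (z / sqrt (real n * p1 n)) = g n / sqrt (real n * p1 n) * r n * z" for z
    by simp
  ultimately have "g n * r n * c_scaled j n \<omega> = 1 / p1 n * r n * (P n * c n (Suc j) \<omega> - p1 n)"
    unfolding c_scaled_def by (simp only:)
  then show ?thesis using p by (simp add: r_def field_simps)
qed

lemma s_eq: "n \<ge> 1 \<Longrightarrow> s n (Suc j) \<omega> = (g n)\<^sup>2 * r n * s_scaled j n \<omega>"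
  using pos[of n] by (simp add: g_def r_def s_scaled_def)

text \<open>In the scaled coordinates the diagonal entry is a polynomial:
  \<open>C\<^sub>k + g S\<^sub>k\<^sub>-\<^sub>1 (1 - 2 r - g r C\<^sub>k\<^sub>-\<^sub>1 - g r C\<^sub>k)\<close>. The shift by \<open>p\<^sub>1\<close> in the rescaling is what
  centres the \<open>C\<^sub>k\<close>.\<close>

lemma asymp_linear_diag: "asymp_linear (\<lambda>n \<omega>. diag n \<omega> (Suc j))"
proof (cases j)
  case 0
  show ?thesis
  proof (rule asymp_linear_cong[OF asymp_linear_c_scaled[of 0]])
    show "\<forall>\<^sub>F n in sequentially. \<forall>\<omega>. diag n \<omega> (Suc j) = c_scaled 0 n \<omega>"
      using eventually_ge_at_top[of 1]
      by eventually_elim (simp add: 0 diag_def model_diag_def c_scaled_def c_s_zero)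
  qed
next
  case (Suc i)
  have "asymp_linear (\<lambda>n \<omega>. c_scaled j n \<omega> + g n * s_scaled i n \<omega> *
      (1 - 2 * r n - g n * r n * c_scaled i n \<omega> - g n * r n * c_scaled j n \<omega>))"
    by (intro asymp_linear_add asymp_linear_mult asymp_linear_diff asymp_linear_c_scaled asymp_linear_s_scaled
        asymp_linear_deterministic convergent_mult convergent_diff convergent_deterministic)
  then show ?thesis
  proof (rule asymp_linear_cong)
    show "\<forall>\<^sub>F n in sequentially. \<forall>\<omega>. diag n \<omega> (Suc j) = c_scaled j n \<omega> + g n * s_scaled i n \<omega> *
        (1 - 2 * r n - g n * r n * c_scaled i n \<omega> - g n * r n * c_scaled j n \<omega>)"
      using eventually_ge_at_top[of 1]
    proof eventually_elim
      case (elim n)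
      have gS: "P n * s n (Suc i) \<omega> / sqrt (real n * p1 n) = g n * s_scaled i n \<omega>" for \<omega>
      proof -
        have "g n * s_scaled i n \<omega> = P n * s n (Suc i) \<omega> * (g n / real n)" by (simp add: s_scaled_def)
        then show ?thesis unfolding g_over_n[OF elim] by simp
      qed
      show ?case
      proof
        fix \<omega>
        have "diag n \<omega> (Suc j) = c_scaled j n \<omega>
            + P n * s n (Suc i) \<omega> / sqrt (real n * p1 n) * (1 - c n (Suc i) \<omega> - c n (Suc j) \<omega>)"
          by (simp add: diag_def model_diag_def c_scaled_def Suc algebra_simps flip: add_divide_distrib diff_divide_distrib)
        then show "diag n \<omega> (Suc j) = c_scaled j n \<omega> + g n * s_scaled i n \<omega> *
            (1 - 2 * r n - g n * r n * c_scaled i n \<omega> - g n * r n * c_scaled j n \<omega>)"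
          unfolding gS c_eq[OF elim] by (simp add: algebra_simps)
      qed
    qed
  qed
qed

text \<open>Likewise the squared off-diagonal entry is
  \<open>(1 + g C\<^sub>k) (1 - r - g r C\<^sub>k) S\<^sub>k (1 - g\<^sup>2 r S\<^sub>k\<^sub>-\<^sub>1)\<close>.\<close>

lemma asymp_linear_offdiag_sq: "asymp_linear (\<lambda>n \<omega>. offdiag_sq n \<omega> (Suc j))"
proof -
  define S' where "S' n \<omega> = (if j = 0 then 0 else s_scaled (j - 1) n \<omega>)" for n \<omega>
  have S': "asymp_linear S'"
    unfolding S'_def[abs_def] by (cases "j = 0")
      (auto intro: asymp_linear_s_scaled asymp_linear_deterministic convergent_deterministic)
  have "asymp_linear (\<lambda>n \<omega>. (1 + g n * c_scaled j n \<omega>) * (1 - r n - g n * r n * c_scaled j n \<omega>) * s_scaled j n \<omega>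
      * (1 - g n * g n * r n * S' n \<omega>))"
    by (intro asymp_linear_add asymp_linear_mult asymp_linear_diff asymp_linear_c_scaled asymp_linear_s_scaled S'
        asymp_linear_deterministic convergent_mult convergent_diff convergent_deterministic)
  then show ?thesis
  proof (rule asymp_linear_cong)
    show "\<forall>\<^sub>F n in sequentially. \<forall>\<omega>. offdiag_sq n \<omega> (Suc j) =
        (1 + g n * c_scaled j n \<omega>) * (1 - r n - g n * r n * c_scaled j n \<omega>) * s_scaled j n \<omega> * (1 - g n * g n * r n * S' n \<omega>)"
      using eventually_ge_at_top[of 1]
    proof eventually_elim
      case (elim n)
      note p = pos[OF elim]
      show ?case
      proof
        fix \<omega>
        have 1: "1 + g n * c_scaled j n \<omega> = P n / p1 n * c n (Suc j) \<omega>"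
          unfolding c_eq[OF elim] using p by (simp add: r_def field_simps)
        have 2: "1 - r n - g n * r n * c_scaled j n \<omega> = 1 - c n (Suc j) \<omega>"
          unfolding c_eq[OF elim] by simp
        have 3: "s_scaled j n \<omega> = P n / real n * s n (Suc j) \<omega>" by (simp add: s_scaled_def)
        have 4: "g n * g n * r n * S' n \<omega> = s n j \<omega>"
          using s_eq[OF elim, of "j - 1" \<omega>] c_s_zero[OF elim] by (cases j) (simp_all add: S'_def power2_eq_square)
        show "offdiag_sq n \<omega> (Suc j) =
          (1 + g n * c_scaled j n \<omega>) * (1 - r n - g n * r n * c_scaled j n \<omega>) * s_scaled j n \<omega> * (1 - g n * g n * r n * S' n \<omega>)"
          unfolding 1 2 4 unfolding 3 by (simp add: offdiag_sq_def power2_eq_square mult_ac)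
      qed
    qed
  qed
qed

definition "walk_statistic p n \<omega> =
  (\<Sum>m\<le>degree p. coeff p m * jacobi_walk (diag n \<omega>) (offdiag_sq n \<omega>) m 0)"

lemma asymp_linear_walk_statistic: "asymp_linear (walk_statistic p)"
  unfolding walk_statistic_def[abs_def]
  by (intro asymp_linear_sum asymp_linear_mult asymp_linear_jacobi_walk asymp_linear_diag
      asymp_linear_offdiag_sq asymp_linear_deterministic convergent_deterministic)

text \<open>All Beta variables lie strictly between \<open>0\<close> and \<open>1\<close> almost surely, and there the square of the square root
  is the radicand. Indices up to the degree stay below \<open>n\<close>, so \<open>s n\<close>, which has no variable of index
  \<open>n\<close>, is never read out of range.\<close>

lemma linear_statistic_eq_walk_statistic:
  assumes n: "n > degree p"
  shows "linear_statistic n (p1 n) (p2 n) (c n) (s n) p \<in> borel_measurable (M n)"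
    and "AE \<omega> in M n. linear_statistic n (p1 n) (p2 n) (c n) (s n) p \<omega> = walk_statistic p n \<omega>"
proof -
  have n1: "n \<ge> 1" using n by simp
  note p = pos[OF n1] and m = model[OF n1, unfolded beta_jacobi_model_def]
  define q where "q \<omega> k = (P n / sqrt (real n * p1 n) * model_offdiag (\<lambda>k. c n k \<omega>) (\<lambda>k. s n k \<omega>) k)\<^sup>2" for \<omega> k
  have eq: "linear_statistic n (p1 n) (p2 n) (c n) (s n) p \<omega>
      = (\<Sum>m\<le>degree p. coeff p m * jacobi_walk (diag n \<omega>) (q \<omega>) m 0)" for \<omega>
    using linear_statistic_eq_jacobi_walk[of n p "p1 n" "p2 n" "c n" "s n" \<omega>] n
    unfolding diag_def[abs_def] q_def[abs_def] P_def by simp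
  have c [measurable]: "c n k \<in> borel_measurable (M n)" if "k < n" for k
  proof (cases "k = 0")
    case False
    then have "distributed (M n) lborel (c n k) (\<lambda>x. ennreal (beta_density
        (\<beta> n / 2 * (p1 n - real k + 1)) (\<beta> n / 2 * (p2 n - real k + 1)) x))" using m that by simp
    from distributed_measurable[OF this] show ?thesis by simp
  qed (use m in simp)
  have s [measurable]: "s n k \<in> borel_measurable (M n)" if "k < n" for k
  proof (cases "k = 0")
    case False
    then have "distributed (M n) lborel (s n k) (\<lambda>x. ennreal (beta_density
        (\<beta> n / 2 * (real n - real k)) (\<beta> n / 2 * (p1 n + p2 n - real n - real k + 1)) x))" using m that by simp
    from distributed_measurable[OF this] show ?thesis by simp
  qed (use m in simp)
  show "linear_statistic n (p1 n) (p2 n) (c n) (s n) p \<in> borel_measurable (M n)"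
    unfolding eq[abs_def]
  proof (intro borel_measurable_sum borel_measurable_times borel_measurable_const borel_measurable_jacobi_walk)
    fix m k assume mk: "m \<in> {..degree p}" "0 < k" "k \<le> 0 + m"
    have [measurable]: "c n k \<in> borel_measurable (M n)" "c n (k - 1) \<in> borel_measurable (M n)"
      "s n k \<in> borel_measurable (M n)" "s n (k - 1) \<in> borel_measurable (M n)"
      using mk n by (auto intro!: c s)
    show "(\<lambda>\<omega>. diag n \<omega> k) \<in> borel_measurable (M n)" unfolding diag_def model_diag_def by measurable
    show "(\<lambda>\<omega>. q \<omega> k) \<in> borel_measurable (M n)" unfolding q_def model_offdiag_def by measurable
  qed
  have c01: "AE \<omega> in M n. 0 < c n k \<omega> \<and> c n k \<omega> < 1" if "k \<in> {1..<n}" for k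
    by (rule beta_variable_in_unit_interval[of _ _ "\<beta> n / 2 * (p1 n - real k + 1)" "\<beta> n / 2 * (p2 n - real k + 1)"])
      (use m that in auto)
  have s01: "AE \<omega> in M n. 0 < s n k \<omega> \<and> s n k \<omega> < 1" if "k \<in> {1..<n}" for k
    by (rule beta_variable_in_unit_interval[of _ _ "\<beta> n / 2 * (real n - real k)"
          "\<beta> n / 2 * (p1 n + p2 n - real n - real k + 1)"])
      (use m that in auto)
  have "AE \<omega> in M n. \<forall>k\<in>{1..<n}. (0 < c n k \<omega> \<and> c n k \<omega> < 1) \<and> (0 < s n k \<omega> \<and> s n k \<omega> < 1)"
    by (intro eventually_ball_finite ballI eventually_conj c01 s01) auto
  then show "AE \<omega> in M n. linear_statistic n (p1 n) (p2 n) (c n) (s n) p \<omega> = walk_statistic p n \<omega>"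
  proof eventually_elim
    case (elim \<omega>)
    have "q \<omega> k = offdiag_sq n \<omega> k" if k: "0 < k" "k < n" for k
    proof -
      have "0 \<le> 1 - s n (k - 1) \<omega>"
      proof (cases "k = 1")
        case False
        then have "k - 1 \<in> {1..<n}" using k by auto
        then have "s n (k - 1) \<omega> < 1" using elim by blast
        then show ?thesis by simp
      qed (use c_s_zero[OF n1, of \<omega>] in simp)
      moreover have "0 < c n k \<omega> \<and> c n k \<omega> < 1" "0 < s n k \<omega> \<and> s n k \<omega> < 1" using elim k by auto
      ultimately have "0 \<le> c n k \<omega> * (1 - c n k \<omega>) * s n k \<omega> * (1 - s n (k - 1) \<omega>)" by simp
      then show ?thesis
        using p unfolding q_def offdiag_sq_def model_offdiag_def
        by (simp add: power_mult_distrib power_divide)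
    qed
    then show ?case unfolding eq walk_statistic_def using n
      by (intro sum.cong refl arg_cong2[where f = "(*)"] jacobi_walk_cong) auto
  qed
qed

theorem linear_statistic_clt:
  "\<exists>v\<ge>0. weak_conv_m
     (\<lambda>n. distr (M n) borel
        (\<lambda>\<omega>. sqrt (\<beta> n / 2 * real n) *
          (linear_statistic n (p1 n) (p2 n) (c n) (s n) p \<omega> -
           prob_space.expectation (M n) (linear_statistic n (p1 n) (p2 n) (c n) (s n) p))))
     (normal_law 0 v)"
proof -
  have "\<forall>\<^sub>F n in sequentially. linear_statistic n (p1 n) (p2 n) (c n) (s n) p \<in> borel_measurable (M n) \<and>
      (AE \<omega> in M n. linear_statistic n (p1 n) (p2 n) (c n) (s n) p \<omega> = walk_statistic p n \<omega>)"
    using eventually_gt_at_top[of "degree p"]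
    by eventually_elim (use linear_statistic_eq_walk_statistic in blast)
  from asymp_linear_clt[OF asymp_linear_walk_statistic this]
  show ?thesis unfolding N_def .
qed

end

theorem theorem9:
  fixes \<beta> p1 p2 :: "nat \<Rightarrow> real"
    and \<gamma> \<sigma> :: real
    and M :: "nat \<Rightarrow> 'a measure"
    and c s :: "nat \<Rightarrow> nat \<Rightarrow> 'a \<Rightarrow> real"
  assumes "\<And>n. n \<ge> 1 \<Longrightarrow> \<beta> n > 0"
    and "\<And>n. n \<ge> 1 \<Longrightarrow> p1 n \<ge> real n"
    and "\<And>n. n \<ge> 1 \<Longrightarrow> p2 n \<ge> real n"
    and "\<And>n. n \<ge> 1 \<Longrightarrow> beta_jacobi_model n (\<beta> n) (p1 n) (p2 n) (M n) (c n) (s n)"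
    and "0 \<le> \<gamma>" and "\<gamma> \<le> 1"
    and "0 \<le> \<sigma>" and "\<gamma> = 0 \<or> \<sigma> < inverse \<gamma>"
    and "(\<lambda>n. real n / p1 n) \<longlonglongrightarrow> \<gamma>"
    and "(\<lambda>n. p1 n / p2 n) \<longlonglongrightarrow> \<sigma>"
    and "filterlim (\<lambda>n. \<beta> n * real n) at_top sequentially"
  shows "\<forall>p :: real poly. \<exists>v\<ge>0.
           weak_conv_m
             (\<lambda>n. distr (M n) borel
                (\<lambda>\<omega>. sqrt (\<beta> n / 2 * real n) *
                  (linear_statistic n (p1 n) (p2 n) (c n) (s n) p \<omega> -
                   prob_space.expectation (M n) (linear_statistic n (p1 n) (p2 n) (c n) (s n) p))))
             (normal_law 0 v)"
proof
  fix p :: "real poly"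
  interpret beta_jacobi_limit \<beta> p1 p2 \<gamma> \<sigma> M c s
    by unfold_locales (fact assms)+
  show "\<exists>v\<ge>0. weak_conv_m
             (\<lambda>n. distr (M n) borel
                (\<lambda>\<omega>. sqrt (\<beta> n / 2 * real n) *
                  (linear_statistic n (p1 n) (p2 n) (c n) (s n) p \<omega> -
                   prob_space.expectation (M n) (linear_statistic n (p1 n) (p2 n) (c n) (s n) p))))
             (normal_law 0 v)"
    by (rule linear_statistic_clt)
qed

end
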